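(* Let $n\ge1$, let $\sigma\in S^{\nu}(\mathbb T^n\times\mathbb Z^n)$ with $\nu<-n$, and let $T=\sigma(x,D)$ be the toroidal pseudo-differential operator with symbol $\sigma$. Then $T\in\Gamma(\mathcal D_2)$ and $$\operatorname{Det}(I+\lambda T)=\exp\left(\sum_{m=1}^{\infty}\frac{(-1)^{m+1}}{m}\lambda^m\sum_{\substack{(j_0,j_1,\dots,j_m)\in(\mathbb Z^{n})^{m+1}\\ j_0=j_m}}\ \prod_{s=1}^{m}\widehat\sigma(j_{s-1}-j_s,j_s)\right)$$ for $\lambda$ in a sufficiently small disc centered at $0$ in $\mathbb C$, where $\operatorname{Det}=\operatorname{Det}_\Gamma$ is the Poincaré determinant on $\Gamma(\mathcal D_2)$. Moreover, the index in the condition $\nu<-n$ is sharp: there is a symbol $\sigma_0\in S^{-n}(\mathbb T^n\times\mathbb Z^n)$ whose operator $\sigma_0(x,D)$ does not belong to $\Gamma(\mathcal D_2)$.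
   Context: Symbols and quantisation. $\mathbb T^n=\mathbb R^n/\mathbb Z^n$. For $\nu\in\mathbb R$, $S^\nu(\mathbb T^n\times\mathbb Z^n)$ is the toroidal Kohn-Nirenberg class: functions $\sigma:\mathbb T^n\times\mathbb Z^n\to\mathbb C$, smooth in $x$, such that for all multi-indices $\alpha,\beta$ there is $C_{\alpha\beta}$ with $|\partial_x^\beta\Delta_k^\alpha\sigma(x,k)|\le C_{\alpha\beta}(1+|k|)^{\nu-|\alpha|}$, where $\Delta_k$ denotes the forward difference operators in $k$. The operator $T=\sigma(x,D)$ is $Tf(x)=\sum_{k\in\mathbb Z^n}e^{2\pi i x\cdot k}\sigma(x,k)\widehat f(k)$ for $f\in C^\infty(\mathbb T^n)$ (extended by density when bounded on $L^2$), where $\widehat f(k)=(\mathcal F_{\mathbb T^n}f)(k)=\int_{\mathbb T^n}e^{-2\pi i x\cdot k}f(x)\,dx$. Also $\widehat\sigma(l,k)=\int_{\mathbb T^n}e^{-2\pi i x\cdot l}\sigma(x,k)\,dx$. Poincaré algebra and determinant. $\mathcal D_2$ is the algebra of bounded operators $A$ on $\ell^2(\mathbb Z^n)$ whose matrix $(a_{jk})$ in the standard basis, $(A\varphi)(j)=\sum_k a_{jk}\varphi(k)$, satisfies $\|A\|_{\mathcal D_2}:=\sum_{j,k\in\mathbb Z^n}|a_{jk}|<\infty$. For $A\in\mathcal D_2$ put $\Gamma(A):=\mathcal F_{\mathbb T^n}^{-1}A\mathcal F_{\mathbb T^n}\in\mathcal L(L^2(\mathbb T^n))$, where $\mathcal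 F_{\mathbb T^n}:L^2(\mathbb T^n)\to\ell^2(\mathbb Z^n)$ is the (unitary) Fourier transform, and $\Gamma(\mathcal D_2)=\{\Gamma(A):A\in\mathcal D_2\}$ with norm $\|\Gamma(A)\|_\Gamma=\|A\|_{\mathcal D_2}$. For a finite rank operator $F$ on a Banach space $\mathcal B$, choose $\mathcal B=M\oplus N$ with $\dim M<\infty$, $F(M)\subset M$, $N\subset\ker F$, and set $\operatorname{Det}(I+F)=\det(I+F|_M)$ (independent of choices). Finite rank operators in $\mathcal D_2$ are dense in $\mathcal D_2$, and $\operatorname{Det}_{\mathcal D_2}(I+A)$ denotes the continuous extension of $\operatorname{Det}(I+F)$ in the norm $\|\cdot\|_{\mathcal D_2}$ to all $A\in\mathcal D_2$ (Poincaré determinant). The Poincaré determinant on $\Gamma(\mathcal D_2)$ is $\operatorname{Det}_\Gamma(I+\Gamma(A)):=\operatorname{Det}_{\mathcal D_2}(I+A)$. *)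

theory Defs
  imports
    "HOL-Analysis.Analysis"
    "Jordan_Normal_Form.Determinant"
begin

no_notation Matrix.vec_index (infixl "$" 100)
no_notation Matrix.scalar_prod (infix "\<bullet>" 70)

section \<open>Complex normed spaces and determinants of finite rank perturbations of the identity\<close>

class complex_normed_vector = real_normed_vector +
  fixes scaleC :: "complex \<Rightarrow> 'a \<Rightarrow> 'a"  (infixr "*\<^sub>C" 75)
  assumes scaleC_add_right: "c *\<^sub>C (x + y) = c *\<^sub>C x + c *\<^sub>C y"
    and scaleC_add_left: "(c + d) *\<^sub>C x = c *\<^sub>C x + d *\<^sub>C x"
    and scaleC_scaleC: "c *\<^sub>C (d *\<^sub>C x) = (c * d) *\<^sub>C x"
    and scaleC_one: "1 *\<^sub>C x = x"
    and scaleR_scaleC: "scaleR r x = complex_of_real r *\<^sub>C x"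
    and norm_scaleC: "norm (c *\<^sub>C x) = cmod c * norm x"

global_interpretation complex_vector:
  vector_space "scaleC :: complex \<Rightarrow> 'a \<Rightarrow> 'a::complex_normed_vector"
  by standard (simp_all add: scaleC_add_right scaleC_add_left scaleC_scaleC scaleC_one)

definition bounded_clinear ::
    "('a::complex_normed_vector \<Rightarrow> 'b::complex_normed_vector) \<Rightarrow> bool" where
  "bounded_clinear A \<longleftrightarrow> bounded_linear A \<and> (\<forall>c x. A (c *\<^sub>C x) = c *\<^sub>C A x)"

definition finite_rank :: "('a \<Rightarrow> 'a::complex_normed_vector) \<Rightarrow> bool" where
  "finite_rank F \<longleftrightarrow> (\<exists>B. finite B \<and> range F \<subseteq> complex_vector.span B)"

text \<open>Determinant of an endomorphism \<open>G\<close> of a finite dimensional subspace \<open>M\<close>: the determinant of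
  its matrix with respect to any basis \<open>b 0, \<dots>, b (d - 1)\<close> of \<open>M\<close>.\<close>

definition endo_det :: "'a set \<Rightarrow> ('a \<Rightarrow> 'a::complex_normed_vector) \<Rightarrow> complex" where
  "endo_det M G = (THE c. \<exists>d b C.
     inj_on b {..<d} \<and> complex_vector.independent (b ` {..<d}) \<and>
     complex_vector.span (b ` {..<d}) = M \<and> C \<in> carrier_mat d d \<and>
     (\<forall>j<d. G (b j) = (\<Sum>i<d. (C $$ (i, j)) *\<^sub>C b i)) \<and>
     c = Determinant.det C)"

text \<open>\<open>fr_det F\<close> is \<open>Det (I + F)\<close> for a finite rank operator \<open>F\<close>.  The complement \<open>N\<close> need
  not be closed: the value depends only on \<open>F\<close> in any case.\<close>

definition fr_det :: "('a \<Rightarrow> 'a::complex_normed_vector) \<Rightarrow> complex" where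
  "fr_det F = (THE c. \<exists>M N.
     complex_vector.subspace M \<and> (\<exists>B. finite B \<and> M = complex_vector.span B) \<and>
     complex_vector.subspace N \<and> M \<inter> N = {0} \<and> (\<forall>x. \<exists>u\<in>M. \<exists>v\<in>N. x = u + v) \<and>
     F ` M \<subseteq> M \<and> (\<forall>x\<in>N. F x = 0) \<and>
     c = endo_det M (\<lambda>x. x + F x))"


section \<open>The space of square summable families\<close>

typedef 'i ell2 = "{\<phi> :: 'i \<Rightarrow> complex. (\<lambda>i. (cmod (\<phi> i))\<^sup>2) summable_on UNIV}"
  by (rule exI[of _ "\<lambda>_. 0"]) simp

setup_lifting type_definition_ell2

lemma power2_norm_add_le: "(norm (a + b))\<^sup>2 \<le> 2 * (norm a)\<^sup>2 + 2 * (norm b)\<^sup>2"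
  for a b :: "'a::real_normed_vector"
proof -
  have "(norm (a + b))\<^sup>2 \<le> (norm a + norm b)\<^sup>2"
    by (simp add: norm_triangle_ineq power_mono)
  also have "\<dots> \<le> 2 * (norm a)\<^sup>2 + 2 * (norm b)\<^sup>2"
    using sum_squares_bound[of "norm a" "norm b"] by (simp add: power2_sum)
  finally show ?thesis .
qed

lemma abs_inner_le_power2: "\<bar>a \<bullet> b\<bar> \<le> (norm a)\<^sup>2 + (norm b)\<^sup>2" for a b :: "'a::real_inner"
proof -
  have "\<bar>a \<bullet> b\<bar> \<le> norm a * norm b"
    by (rule Cauchy_Schwarz_ineq2)
  also have "\<dots> \<le> (norm a)\<^sup>2 + (norm b)\<^sup>2"
    using sum_squares_bound[of "norm a" "norm b"] mult_nonneg_nonneg[of "norm a" "norm b"]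
      norm_ge_zero[of a] norm_ge_zero[of b]
    by linarith
  finally show ?thesis .
qed

lemma ell2_add_closed:
  fixes \<phi> \<psi> :: "'i \<Rightarrow> complex"
  assumes "(\<lambda>i. (cmod (\<phi> i))\<^sup>2) summable_on UNIV" "(\<lambda>i. (cmod (\<psi> i))\<^sup>2) summable_on UNIV"
  shows "(\<lambda>i. (cmod (\<phi> i + \<psi> i))\<^sup>2) summable_on UNIV"
proof (rule summable_on_comparison_test)
  show "(\<lambda>i. 2 * (cmod (\<phi> i))\<^sup>2 + 2 * (cmod (\<psi> i))\<^sup>2) summable_on UNIV"
    using assms by (intro summable_on_add summable_on_cmult_right)
qed (use power2_norm_add_le in auto)

lemma ell2_scale_closed:
  fixes \<phi> :: "'i \<Rightarrow> complex"
  assumes "(\<lambda>i. (cmod (\<phi> i))\<^sup>2) summable_on UNIV"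
  shows "(\<lambda>i. (cmod (c * \<phi> i))\<^sup>2) summable_on UNIV"
  using summable_on_cmult_right[OF assms, of "(cmod c)\<^sup>2"]
  by (simp add: norm_mult power_mult_distrib)

lemma ell2_inner_summable:
  fixes \<phi> \<psi> :: "'i \<Rightarrow> complex"
  assumes "(\<lambda>i. (cmod (\<phi> i))\<^sup>2) summable_on UNIV" "(\<lambda>i. (cmod (\<psi> i))\<^sup>2) summable_on UNIV"
  shows "(\<lambda>i. \<phi> i \<bullet> \<psi> i) summable_on UNIV"
proof (rule abs_summable_summable, rule summable_on_comparison_test)
  show "(\<lambda>i. (cmod (\<phi> i))\<^sup>2 + (cmod (\<psi> i))\<^sup>2) summable_on UNIV"
    using assms by (intro summable_on_add)
qed (use abs_inner_le_power2 in auto)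

instantiation ell2 :: (type) real_inner
begin

lift_definition zero_ell2 :: "'a ell2" is "\<lambda>_. 0" by simp
lift_definition plus_ell2 :: "'a ell2 \<Rightarrow> 'a ell2 \<Rightarrow> 'a ell2" is "\<lambda>\<phi> \<psi> i. \<phi> i + \<psi> i"
  by (rule ell2_add_closed)
lift_definition uminus_ell2 :: "'a ell2 \<Rightarrow> 'a ell2" is "\<lambda>\<phi> i. - \<phi> i" by simp
definition minus_ell2 :: "'a ell2 \<Rightarrow> 'a ell2 \<Rightarrow> 'a ell2" where
  "minus_ell2 \<phi> \<psi> = \<phi> + (- \<psi>)"
lift_definition scaleR_ell2 :: "real \<Rightarrow> 'a ell2 \<Rightarrow> 'a ell2"
  is "\<lambda>r \<phi> i. complex_of_real r * \<phi> i"
  by (rule ell2_scale_closed)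

text \<open>The real inner product \<open>Re \<langle>\<phi>, \<psi>\<rangle>\<close>; the induced norm is the usual \<open>\<ell>\<^sup>2\<close> norm.\<close>

lift_definition inner_ell2 :: "'a ell2 \<Rightarrow> 'a ell2 \<Rightarrow> real" is "\<lambda>\<phi> \<psi>. \<Sum>\<^sub>\<infinity>i. \<phi> i \<bullet> \<psi> i" .
definition norm_ell2 :: "'a ell2 \<Rightarrow> real" where
  "norm_ell2 \<phi> = sqrt (\<phi> \<bullet> \<phi>)"
definition sgn_ell2 :: "'a ell2 \<Rightarrow> 'a ell2" where
  "sgn_ell2 \<phi> = inverse (norm \<phi>) *\<^sub>R \<phi>"
definition dist_ell2 :: "'a ell2 \<Rightarrow> 'a ell2 \<Rightarrow> real" where
  "dist_ell2 \<phi> \<psi> = norm (\<phi> - \<psi>)"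
definition uniformity_ell2 :: "('a ell2 \<times> 'a ell2) filter" where
  "uniformity_ell2 = (INF e\<in>{0<..}. principal {(x, y). dist x y < e})"
definition open_ell2 :: "'a ell2 set \<Rightarrow> bool" where
  "open_ell2 U = (\<forall>x\<in>U. eventually (\<lambda>(x', y). x' = x \<longrightarrow> y \<in> U) uniformity)"

instance
proof
  fix a b c :: "'a ell2" and r s :: real and U :: "'a ell2 set"
  show "a + b + c = a + (b + c)" by transfer (simp add: add.assoc)
  show "a + b = b + a" by transfer (simp add: add.commute)
  show "0 + a = a" by transfer simp
  show "- a + a = 0" by transfer simp
  show "a - b = a + - b" by (simp add: minus_ell2_def)
  show "r *\<^sub>R (a + b) = r *\<^sub>R a + r *\<^sub>R b" by transfer (simp add: algebra_simps)
  show "(r + s) *\<^sub>R a = r *\<^sub>R a + s *\<^sub>R a" by transfer (simp add: algebra_simps)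
  show "r *\<^sub>R s *\<^sub>R a = (r * s) *\<^sub>R a" by transfer (simp add: algebra_simps)
  show "1 *\<^sub>R a = a" by transfer simp
  show "dist a b = norm (a - b)" by (simp add: dist_ell2_def)
  show "sgn a = inverse (norm a) *\<^sub>R a" by (simp add: sgn_ell2_def)
  show "uniformity = (INF e\<in>{0<..}. principal {(x, y :: 'a ell2). dist x y < e})"
    by (simp add: uniformity_ell2_def)
  show "open U = (\<forall>x\<in>U. eventually (\<lambda>(x', y). x' = x \<longrightarrow> y \<in> U) uniformity)"
    by (simp add: open_ell2_def)
  show "a \<bullet> b = b \<bullet> a" by transfer (simp add: inner_commute)
  show "(a + b) \<bullet> c = a \<bullet> c + b \<bullet> c"
    by transfer (simp add: inner_add_left infsum_add ell2_inner_summable)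
  show "(r *\<^sub>R a) \<bullet> b = r * (a \<bullet> b)"
    by transfer (simp flip: scaleR_conv_of_real add: infsum_cmult_right')
  show "0 \<le> a \<bullet> a" by transfer (simp add: infsum_nonneg)
  show "a \<bullet> a = 0 \<longleftrightarrow> a = 0"
  proof
    assume "a \<bullet> a = 0"
    then show "a = 0"
    proof transfer
      fix \<phi> :: "'a \<Rightarrow> complex"
      assume *: "(\<lambda>i. (cmod (\<phi> i))\<^sup>2) summable_on UNIV" "(\<Sum>\<^sub>\<infinity>i. \<phi> i \<bullet> \<phi> i) = 0"
      have "\<phi> i \<bullet> \<phi> i = 0" for i
        by (rule nonneg_infsum_le_0D[of _ UNIV]) (use * ell2_inner_summable[OF *(1) *(1)] in auto)
      then show "\<phi> = (\<lambda>_. 0)" by auto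
    qed
  qed (transfer, simp)
  show "norm a = sqrt (a \<bullet> a)" by (simp add: norm_ell2_def)
qed

end

instantiation ell2 :: (type) complex_normed_vector
begin

lift_definition scaleC_ell2 :: "complex \<Rightarrow> 'a ell2 \<Rightarrow> 'a ell2" is "\<lambda>c \<phi> i. c * \<phi> i"
  by (rule ell2_scale_closed)

instance
proof
  fix x y :: "'a ell2" and c d :: complex and r :: real
  show "c *\<^sub>C (x + y) = c *\<^sub>C x + c *\<^sub>C y" by transfer (simp add: algebra_simps)
  show "(c + d) *\<^sub>C x = c *\<^sub>C x + d *\<^sub>C x" by transfer (simp add: algebra_simps)
  show "c *\<^sub>C d *\<^sub>C x = (c * d) *\<^sub>C x" by transfer (simp add: algebra_simps)
  show "1 *\<^sub>C x = x" by transfer simp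
  show "r *\<^sub>R x = complex_of_real r *\<^sub>C x" by transfer simp
  have "(c *\<^sub>C x) \<bullet> (c *\<^sub>C x) = (cmod c)\<^sup>2 * (x \<bullet> x)"
    by transfer (simp add: dot_square_norm norm_mult power_mult_distrib infsum_cmult_right')
  then show "norm (c *\<^sub>C x) = cmod c * norm x"
    by (simp add: norm_eq_sqrt_inner real_sqrt_mult)
qed

end


section \<open>The space \<open>L\<^sup>2\<close> of the torus\<close>

text \<open>A function on the torus \<open>\<real>\<^sup>n / \<int>\<^sup>n\<close> is a function on \<open>\<real>\<^sup>n\<close> which is \<open>1\<close>-periodic in each
  variable, and integration over the torus is integration over the unit cube.  An element of
  \<open>L\<^sup>2\<close> is the class of a function modulo equality almost everywhere in the unit cube, so
  periodicity need not be required there.\<close>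

abbreviation cube_measure :: "(real^'n) measure" where
  "cube_measure \<equiv> lebesgue_on (cbox 0 One)"

definition square_integrable :: "(real^'n \<Rightarrow> complex) \<Rightarrow> bool" where
  "square_integrable f \<longleftrightarrow> f \<in> borel_measurable cube_measure \<and>
     integrable cube_measure (\<lambda>x. (cmod (f x))\<^sup>2)"

definition L2_eq :: "(real^'n \<Rightarrow> complex) \<Rightarrow> (real^'n \<Rightarrow> complex) \<Rightarrow> bool" where
  "L2_eq f g \<longleftrightarrow> square_integrable f \<and> square_integrable g \<and> (AE x in cube_measure. f x = g x)"

lemma square_integrable_zero: "square_integrable (\<lambda>_. 0)"
  by (simp add: square_integrable_def)

lemma square_integrable_add:
  assumes "square_integrable f" "square_integrable g"
  shows "square_integrable (\<lambda>x. f x + g x)"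
  unfolding square_integrable_def
proof
  show meas: "(\<lambda>x. f x + g x) \<in> borel_measurable cube_measure"
    using assms by (auto simp: square_integrable_def)
  show "integrable cube_measure (\<lambda>x. (cmod (f x + g x))\<^sup>2)"
  proof (rule Bochner_Integration.integrable_bound)
    show "integrable cube_measure (\<lambda>x. 2 * (cmod (f x))\<^sup>2 + 2 * (cmod (g x))\<^sup>2)"
      using assms by (auto simp: square_integrable_def)
  qed (use meas power2_norm_add_le in auto)
qed

lemma square_integrable_scale:
  assumes "square_integrable f"
  shows "square_integrable (\<lambda>x. c * f x)"
  using assms by (auto simp: square_integrable_def norm_mult power_mult_distrib)

lemma integrable_inner_L2:
  assumes "square_integrable f" "square_integrable g"
  shows "integrable cube_measure (\<lambda>x. f x \<bullet> g x)"
proof (rule Bochner_Integration.integrable_bound)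
  show "integrable cube_measure (\<lambda>x. (cmod (f x))\<^sup>2 + (cmod (g x))\<^sup>2)"
    using assms by (auto simp: square_integrable_def)
qed (use assms abs_inner_le_power2 in \<open>auto simp: square_integrable_def\<close>)

quotient_type (overloaded) 'n torus_L2 = "real^('n::finite) \<Rightarrow> complex" / partial: L2_eq
proof (rule part_equivpI)
  show "\<exists>f. L2_eq f f"
    using square_integrable_zero by (auto simp: L2_eq_def)
  show "symp L2_eq"
    by (auto simp: symp_def L2_eq_def eq_commute)
  show "transp L2_eq"
  proof (rule transpI)
    fix f g h
    assume *: "L2_eq f g" "L2_eq g h"
    then have "AE x in cube_measure. f x = g x" "AE x in cube_measure. g x = h x"
      by (auto simp: L2_eq_def)
    then have "AE x in cube_measure. f x = h x"
      by eventually_elim simp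
    with * show "L2_eq f h" by (auto simp: L2_eq_def)
  qed
qed

lemma L2_eq_AE: "L2_eq f g \<Longrightarrow> AE x in cube_measure. f x = g x"
  and L2_eq_square_integrable: "L2_eq f g \<Longrightarrow> square_integrable f" "L2_eq f g \<Longrightarrow> square_integrable g"
  by (auto simp: L2_eq_def)

lemma L2_eq_refl: "square_integrable f \<Longrightarrow> L2_eq f f"
  by (simp add: L2_eq_def)

lemma L2_eq_add:
  assumes "L2_eq f g" "L2_eq f' g'"
  shows "L2_eq (\<lambda>x. f x + f' x) (\<lambda>x. g x + g' x)"
proof -
  have "AE x in cube_measure. f x + f' x = g x + g' x"
    using L2_eq_AE[OF assms(1)] L2_eq_AE[OF assms(2)] by eventually_elim simp
  with assms show ?thesis by (auto simp: L2_eq_def intro: square_integrable_add)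
qed

lemma L2_eq_scale:
  assumes "L2_eq f g"
  shows "L2_eq (\<lambda>x. c * f x) (\<lambda>x. c * g x)"
proof -
  have "AE x in cube_measure. c * f x = c * g x"
    using L2_eq_AE[OF assms] by eventually_elim simp
  with assms show ?thesis by (auto simp: L2_eq_def intro: square_integrable_scale)
qed

instantiation torus_L2 :: (finite) real_inner
begin

lift_definition zero_torus_L2 :: "'a torus_L2" is "\<lambda>_. 0"
  by (simp add: L2_eq_refl square_integrable_zero)
lift_definition plus_torus_L2 :: "'a torus_L2 \<Rightarrow> 'a torus_L2 \<Rightarrow> 'a torus_L2"
  is "\<lambda>f g x. f x + g x"
  by (rule L2_eq_add)
lift_definition scaleR_torus_L2 :: "real \<Rightarrow> 'a torus_L2 \<Rightarrow> 'a torus_L2"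
  is "\<lambda>r f x. complex_of_real r * f x"
  by (rule L2_eq_scale)
definition uminus_torus_L2 :: "'a torus_L2 \<Rightarrow> 'a torus_L2" where
  "uminus_torus_L2 u = (- 1) *\<^sub>R u"
definition minus_torus_L2 :: "'a torus_L2 \<Rightarrow> 'a torus_L2 \<Rightarrow> 'a torus_L2" where
  "minus_torus_L2 u v = u + (- v)"
lift_definition inner_torus_L2 :: "'a torus_L2 \<Rightarrow> 'a torus_L2 \<Rightarrow> real"
  is "\<lambda>f g. LINT x|cube_measure. f x \<bullet> g x"
proof -
  fix f f' g g' :: "real^'a \<Rightarrow> complex"
  assume *: "L2_eq f f'" "L2_eq g g'"
  have "AE x in cube_measure. f x \<bullet> g x = f' x \<bullet> g' x"
    using L2_eq_AE[OF *(1)] L2_eq_AE[OF *(2)] by eventually_elim simp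
  moreover have "(\<lambda>x. f x \<bullet> g x) \<in> borel_measurable cube_measure"
    "(\<lambda>x. f' x \<bullet> g' x) \<in> borel_measurable cube_measure"
    using * by (auto simp: L2_eq_def intro!: borel_measurable_integrable integrable_inner_L2)
  ultimately show "(LINT x|cube_measure. f x \<bullet> g x) = (LINT x|cube_measure. f' x \<bullet> g' x)"
    by (intro integral_cong_AE)
qed
definition norm_torus_L2 :: "'a torus_L2 \<Rightarrow> real" where
  "norm_torus_L2 u = sqrt (u \<bullet> u)"
definition sgn_torus_L2 :: "'a torus_L2 \<Rightarrow> 'a torus_L2" where
  "sgn_torus_L2 u = inverse (norm u) *\<^sub>R u"
definition dist_torus_L2 :: "'a torus_L2 \<Rightarrow> 'a torus_L2 \<Rightarrow> real" where
  "dist_torus_L2 u v = norm (u - v)"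
definition uniformity_torus_L2 :: "('a torus_L2 \<times> 'a torus_L2) filter" where
  "uniformity_torus_L2 = (INF e\<in>{0<..}. principal {(x, y). dist x y < e})"
definition open_torus_L2 :: "'a torus_L2 set \<Rightarrow> bool" where
  "open_torus_L2 U = (\<forall>x\<in>U. eventually (\<lambda>(x', y). x' = x \<longrightarrow> y \<in> U) uniformity)"

instance
proof
  fix a b c :: "'a torus_L2" and r s :: real and U :: "'a torus_L2 set"
  show "a + b + c = a + (b + c)"
    by transfer (auto simp: add.assoc intro!: L2_eq_refl square_integrable_add
        dest: L2_eq_square_integrable)
  show "a + b = b + a"
    by transfer (auto simp: add.commute intro!: L2_eq_refl square_integrable_add
        dest: L2_eq_square_integrable)
  show "0 + a = a" by transfer simp
  show "- a + a = 0"
    unfolding uminus_torus_L2_def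
    by transfer (simp add: L2_eq_refl square_integrable_zero)
  show "a - b = a + - b" by (simp add: minus_torus_L2_def)
  show "r *\<^sub>R (a + b) = r *\<^sub>R a + r *\<^sub>R b"
    by transfer (auto simp: distrib_left intro!: L2_eq_refl square_integrable_add
        square_integrable_scale dest: L2_eq_square_integrable)
  show "(r + s) *\<^sub>R a = r *\<^sub>R a + s *\<^sub>R a"
    by transfer (auto simp: distrib_right intro!: L2_eq_refl square_integrable_add
        square_integrable_scale dest: L2_eq_square_integrable)
  show "r *\<^sub>R s *\<^sub>R a = (r * s) *\<^sub>R a"
    by transfer (auto simp: mult.assoc intro!: L2_eq_refl
        square_integrable_scale dest: L2_eq_square_integrable)
  show "1 *\<^sub>R a = a" by transfer simp
  show "dist a b = norm (a - b)" by (simp add: dist_torus_L2_def)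
  show "sgn a = inverse (norm a) *\<^sub>R a" by (simp add: sgn_torus_L2_def)
  show "uniformity = (INF e\<in>{0<..}. principal {(x, y :: 'a torus_L2). dist x y < e})"
    by (simp add: uniformity_torus_L2_def)
  show "open U = (\<forall>x\<in>U. eventually (\<lambda>(x', y). x' = x \<longrightarrow> y \<in> U) uniformity)"
    by (simp add: open_torus_L2_def)
  show "a \<bullet> b = b \<bullet> a" by transfer (simp add: inner_commute)
  show "(a + b) \<bullet> c = a \<bullet> c + b \<bullet> c"
    by transfer (simp add: inner_add_left L2_eq_def integrable_inner_L2)
  show "(r *\<^sub>R a) \<bullet> b = r * (a \<bullet> b)"
    by transfer (simp flip: scaleR_conv_of_real)
  show "0 \<le> a \<bullet> a" by transfer simp
  show "a \<bullet> a = 0 \<longleftrightarrow> a = 0"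
  proof transfer
    fix f :: "real^'a \<Rightarrow> complex"
    assume "L2_eq f f"
    then have f: "square_integrable f" by (simp add: L2_eq_def)
    have "(LINT x|cube_measure. f x \<bullet> f x) = 0 \<longleftrightarrow> (AE x in cube_measure. f x \<bullet> f x = 0)"
      by (rule integral_nonneg_eq_0_iff_AE) (auto intro: integrable_inner_L2 f)
    then show "(LINT x|cube_measure. f x \<bullet> f x) = 0 \<longleftrightarrow> L2_eq f (\<lambda>_. 0)"
      by (simp add: L2_eq_def f square_integrable_zero)
  qed
  show "norm a = sqrt (a \<bullet> a)" by (simp add: norm_torus_L2_def)
qed

end

instantiation torus_L2 :: (finite) complex_normed_vector
begin

lift_definition scaleC_torus_L2 :: "complex \<Rightarrow> 'a torus_L2 \<Rightarrow> 'a torus_L2"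
  is "\<lambda>c f x. c * f x"
  by (rule L2_eq_scale)

instance
proof
  fix x y :: "'a torus_L2" and c d :: complex and r :: real
  show "c *\<^sub>C (x + y) = c *\<^sub>C x + c *\<^sub>C y"
    by transfer (auto simp: distrib_left intro!: L2_eq_refl square_integrable_add
        square_integrable_scale dest: L2_eq_square_integrable)
  show "(c + d) *\<^sub>C x = c *\<^sub>C x + d *\<^sub>C x"
    by transfer (auto simp: distrib_right intro!: L2_eq_refl square_integrable_add
        square_integrable_scale dest: L2_eq_square_integrable)
  show "c *\<^sub>C d *\<^sub>C x = (c * d) *\<^sub>C x"
    by transfer (auto simp: mult.assoc intro!: L2_eq_refl
        square_integrable_scale dest: L2_eq_square_integrable)
  show "1 *\<^sub>C x = x" by transfer simp
  show "r *\<^sub>R x = complex_of_real r *\<^sub>C x"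
    by transfer (auto intro!: L2_eq_refl square_integrable_scale dest: L2_eq_square_integrable)
  have "(c *\<^sub>C x) \<bullet> (c *\<^sub>C x) = (cmod c)\<^sup>2 * (x \<bullet> x)"
    by transfer (simp add: dot_square_norm norm_mult power_mult_distrib)
  then show "norm (c *\<^sub>C x) = cmod c * norm x"
    by (simp add: norm_eq_sqrt_inner real_sqrt_mult)
qed

end


section \<open>Fourier transform and toroidal pseudo-differential operators\<close>

definition real_vec :: "int^'n \<Rightarrow> real^'n" where
  "real_vec k = (\<chi> i. real_of_int (k $ i))"

definition torus_ft :: "(real^'n \<Rightarrow> complex) \<Rightarrow> int^'n \<Rightarrow> complex" where
  "torus_ft f k = (LINT x|cube_measure. exp (- 2 * pi * \<i> * (x \<bullet> real_vec k)) * f x)"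

text \<open>By Parseval's identity, \<open>torus_ft\<close> maps square integrable functions to square summable
  families, and the induced map below is a bijection.\<close>

definition fourier :: "('n::finite) torus_L2 \<Rightarrow> (int^'n) ell2" where
  "fourier u = Abs_ell2 (torus_ft (rep_torus_L2 u))"

definition partial_deriv :: "'n \<Rightarrow> (real^'n \<Rightarrow> complex) \<Rightarrow> real^'n \<Rightarrow> complex" where
  "partial_deriv i f x = vector_derivative (\<lambda>t. f (x + t *\<^sub>R axis i 1)) (at 0)"

definition forward_diff :: "'n \<Rightarrow> (int^'n \<Rightarrow> complex) \<Rightarrow> int^'n \<Rightarrow> complex" where
  "forward_diff i a k = a (k + axis i 1) - a k"

text \<open>A multi-index \<open>\<beta>\<close> is represented by the lists in which every coordinate \<open>i\<close> occurs \<open>\<beta> i\<close>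
  times; thus \<open>|\<beta>|\<close> is the length.  The order of the entries is immaterial, since the difference
  operators commute, and so do the partial derivatives of smooth functions.\<close>

definition iter_deriv :: "'n list \<Rightarrow> (real^'n \<Rightarrow> complex) \<Rightarrow> real^'n \<Rightarrow> complex" where
  "iter_deriv \<beta> f = foldr partial_deriv \<beta> f"

definition iter_diff :: "'n list \<Rightarrow> (int^'n \<Rightarrow> complex) \<Rightarrow> int^'n \<Rightarrow> complex" where
  "iter_diff \<alpha> a = foldr forward_diff \<alpha> a"

text \<open>\<open>C\<^sup>\<infinity>\<close> functions on the torus: all iterated partial derivatives exist and are continuous.\<close>

definition torus_smooth :: "(real^'n \<Rightarrow> complex) set" where
  "torus_smooth = {f. (\<forall>x m. f (x + real_vec m) = f x) \<and>
     (\<forall>\<beta>. continuous_on UNIV (iter_deriv \<beta> f) \<and>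
        (\<forall>i x. (\<lambda>t. iter_deriv \<beta> f (x + t *\<^sub>R axis i 1)) differentiable (at 0)))}"

definition symbol_class :: "real \<Rightarrow> (real^'n \<Rightarrow> int^'n \<Rightarrow> complex) set" where
  "symbol_class \<nu> = {\<sigma>. (\<forall>k. (\<lambda>x. \<sigma> x k) \<in> torus_smooth) \<and>
     (\<forall>\<alpha> \<beta>. \<exists>C. \<forall>x k. cmod (iter_deriv \<beta> (\<lambda>y. iter_diff \<alpha> (\<sigma> y) k) x)
        \<le> C * (1 + norm (real_vec k)) powr (\<nu> - real (length \<alpha>)))}"

definition symbol_ft :: "(real^'n \<Rightarrow> int^'n \<Rightarrow> complex) \<Rightarrow> int^'n \<Rightarrow> int^'n \<Rightarrow> complex" where
  "symbol_ft \<sigma> l k = torus_ft (\<lambda>x. \<sigma> x k) l"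

definition pdo_smooth ::
    "(real^'n \<Rightarrow> int^'n \<Rightarrow> complex) \<Rightarrow> (real^'n \<Rightarrow> complex) \<Rightarrow> real^'n \<Rightarrow> complex" where
  "pdo_smooth \<sigma> f x = (\<Sum>\<^sub>\<infinity>k. exp (2 * pi * \<i> * (x \<bullet> real_vec k)) * \<sigma> x k * torus_ft f k)"

text \<open>\<open>L2_extension \<sigma> T\<close>: the bounded operator \<open>T\<close> on \<open>L\<^sup>2\<close> extends the operator \<open>pdo_smooth \<sigma>\<close>
  on smooth functions.  Smooth functions being dense, there is at most one such \<open>T\<close>.\<close>

definition L2_extension ::
    "(real^'n \<Rightarrow> int^'n \<Rightarrow> complex) \<Rightarrow> (('n::finite) torus_L2 \<Rightarrow> 'n torus_L2) \<Rightarrow> bool" where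
  "L2_extension \<sigma> T \<longleftrightarrow> bounded_clinear T \<and>
     (\<forall>f\<in>torus_smooth. L2_eq (pdo_smooth \<sigma> f) (rep_torus_L2 (T (abs_torus_L2 f))))"

definition pdo :: "(real^'n \<Rightarrow> int^'n \<Rightarrow> complex) \<Rightarrow> ('n::finite) torus_L2 \<Rightarrow> 'n torus_L2" where
  "pdo \<sigma> = (THE T. L2_extension \<sigma> T)"


section \<open>The algebra \<open>D\<^sub>2\<close> and the determinant\<close>

definition unit_vec_ell2 :: "'i \<Rightarrow> 'i ell2" where
  "unit_vec_ell2 k = Abs_ell2 (\<lambda>j. if j = k then 1 else 0)"

definition matrix_entry :: "('i ell2 \<Rightarrow> 'i ell2) \<Rightarrow> 'i \<Rightarrow> 'i \<Rightarrow> complex" where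
  "matrix_entry A j k = Rep_ell2 (A (unit_vec_ell2 k)) j"

definition D2 :: "('i ell2 \<Rightarrow> 'i ell2) set" where
  "D2 = {A. bounded_clinear A \<and> (\<lambda>(j, k). cmod (matrix_entry A j k)) summable_on UNIV}"

definition D2_norm :: "('i ell2 \<Rightarrow> 'i ell2) \<Rightarrow> real" where
  "D2_norm A = (\<Sum>\<^sub>\<infinity>(j, k). cmod (matrix_entry A j k))"

text \<open>\<open>D2_det A\<close> is \<open>Det (I + A)\<close>: the continuous extension of \<open>fr_det\<close> from the dense subspace
  of finite rank operators, i.e. the limit of \<open>fr_det F\<close> as \<open>F\<close> tends to \<open>A\<close> in the norm of \<open>D2\<close>.
  The value \<open>F = A\<close> is not excluded if \<open>A\<close> has finite rank.\<close>

definition finite_rank_nhds :: "('i ell2 \<Rightarrow> 'i ell2) \<Rightarrow> ('i ell2 \<Rightarrow> 'i ell2) filter" where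
  "finite_rank_nhds A =
     (INF e\<in>{0<..}. principal {F \<in> D2. finite_rank F \<and> D2_norm (\<lambda>x. F x - A x) < e})"

definition D2_det :: "('i ell2 \<Rightarrow> 'i ell2) \<Rightarrow> complex" where
  "D2_det A = Lim (finite_rank_nhds A) fr_det"

definition Gamma_op ::
    "((int^'n) ell2 \<Rightarrow> (int^'n) ell2) \<Rightarrow> ('n::finite) torus_L2 \<Rightarrow> 'n torus_L2" where
  "Gamma_op A = inv_into UNIV fourier \<circ> A \<circ> fourier"

text \<open>\<open>Gamma_det T\<close> is \<open>Det (I + T)\<close> for \<open>T = Gamma_op A\<close>, where \<open>A \<in> D2\<close> is determined by \<open>T\<close>.\<close>

definition Gamma_det :: "(('n::finite) torus_L2 \<Rightarrow> 'n torus_L2) \<Rightarrow> complex" where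
  "Gamma_det T = D2_det (THE A. A \<in> D2 \<and> Gamma_op A = T)"

end

(* A family (a_jk) with finite absolute sum maps square summable families to absolutely summable ones,
   and every absolutely summable family is the family of Fourier coefficients of its (uniformly
   convergent) Fourier series.  Hence conjugation with the Fourier transform never needs the
   Riesz-Fischer theorem, only the injectivity of the Fourier transform, which follows from
   the Stone-Weierstrass theorem on the torus.

   For a finite rank operator F of D_2-norm less than 1, let K be its matrix on a finite dimensional
   invariant subspace containing its range.  Triangularising K gives det (1 + K) = exp (sum over
   m of (-1)^(m+1)/m tr (K^m)), and tr (K^m) is the diagonal sum of the infinite matrix of F^m.  The right
   hand side is Lipschitz in the D_2-norm, so the formula extends to the Poincare determinant, and the
   diagonal sum of A^m is a sum over closed paths of length m.

   The matrix of sigma(x,D) in the basis of exponentials is sigma^(j - k, k).  Integrating by parts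
   bounds it by C (1 + |j - k|)^(-n-1) (1 + |k|)^nu, which is summable if nu < -n.  For the
   sharpness, the Fourier multiplier k_i^n / (1 + |k|^2)^n has order -n, but its values on the cone
   where k_i is the largest coordinate already dominate a harmonic series. *)
theory Submission
  imports Defs "Jordan_Normal_Form.Schur_Decomposition"
begin

text \<open>The definite descriptions \<open>endo_det\<close>, \<open>fr_det\<close> and
  \<open>pdo\<close> have a meaning only once all admissible choices agree. For the determinants
  every admissible basis and decomposition is shown to yield the same number
  \<open>exp (trace_log F)\<close>, so existence, uniqueness and value come together. The norm
  condition enters because the D_2-norm dominates the operator norm: all eigenvalues of F lie in the
  open unit disc, where the logarithm series converge, and the estimates are uniform for operators
  near a given one. The other obstacle is sharpness. At order - n the matrix need no longer be
  absolutely summable, yet the operator must be known to be the unique bounded extension before its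
  absence from the algebra means anything. The facts about \<open>pdo\<close> are therefore proved
  for all orders below - n / 2, where the \<ell>1 norms of the columns are still square summable;
  then the images still have absolutely convergent Fourier series. As n is at least 1, this covers
  order - n together with all orders below it.\<close>

no_notation Matrix.vec_index (infixl "$" 100)
no_notation Matrix.scalar_prod (infix "\<bullet>" 70)
no_notation Infinite_Set_Sum.abs_summable_on (infix "abs'_summable'_on" 50)

section \<open>Infinite sums and square summable families\<close>

section \<open>Summability\<close>

lemma abs_summable_on_pairs_iff:
  fixes f :: "'a \<times> 'b \<Rightarrow> complex"
  shows "f abs_summable_on UNIV \<longleftrightarrow> (\<forall>x. (\<lambda>y. f (x, y)) abs_summable_on UNIV) \<and>
    (\<lambda>x. \<Sum>\<^sub>\<infinity>y. cmod (f (x, y))) summable_on UNIV"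
  using Infinite_Sum.abs_summable_on_Sigma_iff[of f UNIV "\<lambda>_. UNIV"] by (simp add: infsum_nonneg)

text \<open>Triangle inequality under Tonelli. Products of matrices with vectors and with each other
  are all controlled by summing out the inner index in this way.\<close>

lemma abs_summable_on_infsum_bound:
  fixes f :: "'a \<times> 'b \<Rightarrow> complex"
  assumes "f abs_summable_on UNIV"
  shows "(\<lambda>x. \<Sum>\<^sub>\<infinity>y. f (x, y)) abs_summable_on UNIV"
    and "(\<Sum>\<^sub>\<infinity>x. cmod (\<Sum>\<^sub>\<infinity>y. f (x, y))) \<le> (\<Sum>\<^sub>\<infinity>z. cmod (f z))"
proof -
  have row: "(\<lambda>y. f (x, y)) abs_summable_on UNIV"
    and tot: "(\<lambda>x. \<Sum>\<^sub>\<infinity>y. cmod (f (x, y))) summable_on UNIV" for x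
    using assms unfolding abs_summable_on_pairs_iff by auto
  have le: "cmod (\<Sum>\<^sub>\<infinity>y. f (x, y)) \<le> (\<Sum>\<^sub>\<infinity>y. cmod (f (x, y)))" for x
    by (rule norm_infsum_bound[OF row])
  show 1: "(\<lambda>x. \<Sum>\<^sub>\<infinity>y. f (x, y)) abs_summable_on UNIV"
    by (rule Infinite_Sum.abs_summable_on_comparison_test'[OF tot]) (rule le)
  have "(\<Sum>\<^sub>\<infinity>x. cmod (\<Sum>\<^sub>\<infinity>y. f (x, y))) \<le> (\<Sum>\<^sub>\<infinity>x. \<Sum>\<^sub>\<infinity>y. cmod (f (x, y)))"
    by (rule infsum_mono[OF 1 tot]) (rule le)
  also have "\<dots> = (\<Sum>\<^sub>\<infinity>z. cmod (f z))"
    using infsum_Sigma_banach[of "\<lambda>z. cmod (f z)" UNIV "\<lambda>_. UNIV"] assms by simp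
  finally show "(\<Sum>\<^sub>\<infinity>x. cmod (\<Sum>\<^sub>\<infinity>y. f (x, y))) \<le> (\<Sum>\<^sub>\<infinity>z. cmod (f z))" .
qed

lemma abs_summable_on_swap_UNIV:
  fixes f :: "'a \<times> 'b \<Rightarrow> complex"
  shows "(\<lambda>(y, x). f (x, y)) abs_summable_on UNIV \<longleftrightarrow> f abs_summable_on UNIV"
  using summable_on_swap[of "\<lambda>z. cmod (f z)" UNIV UNIV] by (simp add: case_prod_unfold)

lemma infsum_swap_UNIV:
  fixes f :: "'a \<times> 'b \<Rightarrow> 'c::{comm_monoid_add, t2_space}"
  shows "(\<Sum>\<^sub>\<infinity>(y, x). f (x, y)) = infsum f UNIV"
  using infsum_reindex_bij_betw[of prod.swap UNIV UNIV f] by (simp add: prod.swap_def case_prod_unfold)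

lemma abs_summable_on_imp_square:
  fixes f :: "'a \<Rightarrow> complex"
  assumes "f abs_summable_on UNIV"
  shows "(\<lambda>i. (cmod (f i))\<^sup>2) summable_on UNIV"
    and "(\<Sum>\<^sub>\<infinity>i. (cmod (f i))\<^sup>2) \<le> (\<Sum>\<^sub>\<infinity>i. cmod (f i))\<^sup>2"
proof -
  let ?S = "\<Sum>\<^sub>\<infinity>i. cmod (f i)"
  have "cmod (f i) \<le> ?S" for i
    using finite_sum_le_infsum[OF assms, of "{i}"] by simp
  then have le: "(cmod (f i))\<^sup>2 \<le> ?S * cmod (f i)" for i
    by (simp add: power2_eq_square mult_right_mono)
  have s: "(\<lambda>i. ?S * cmod (f i)) summable_on UNIV"
    by (intro summable_on_cmult_right assms)
  show 1: "(\<lambda>i. (cmod (f i))\<^sup>2) summable_on UNIV"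
    by (rule summable_on_comparison_test[OF s]) (use le in auto)
  have "(\<Sum>\<^sub>\<infinity>i. (cmod (f i))\<^sup>2) \<le> (\<Sum>\<^sub>\<infinity>i. ?S * cmod (f i))"
    by (rule infsum_mono[OF 1 s le])
  also have "\<dots> = ?S\<^sup>2"
    by (simp add: infsum_cmult_right' power2_eq_square)
  finally show "(\<Sum>\<^sub>\<infinity>i. (cmod (f i))\<^sup>2) \<le> ?S\<^sup>2" .
qed

lemma abs_summable_on_mult_ell2:
  fixes f g :: "'a \<Rightarrow> complex"
  assumes "(\<lambda>i. (cmod (f i))\<^sup>2) summable_on UNIV" "(\<lambda>i. (cmod (g i))\<^sup>2) summable_on UNIV"
  shows "(\<lambda>i. f i * g i) abs_summable_on UNIV"
  by (rule abs_summable_product) (use assms in \<open>simp_all add: norm_mult power2_eq_square\<close>)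


section \<open>Square summable families\<close>

lemma Rep_ell2_summable: "(\<lambda>i. (cmod (Rep_ell2 \<phi> i))\<^sup>2) summable_on UNIV"
  using Rep_ell2[of \<phi>] by simp

lemma Rep_ell2_minus: "Rep_ell2 (\<phi> - \<psi>) i = Rep_ell2 \<phi> i - Rep_ell2 \<psi> i"
  unfolding minus_ell2_def by (simp only: plus_ell2.rep_eq uminus_ell2.rep_eq) simp

lemma Rep_ell2_sum: "Rep_ell2 (sum f A) i = (\<Sum>x\<in>A. Rep_ell2 (f x) i)"
  by (induction A rule: infinite_finite_induct) (auto simp: zero_ell2.rep_eq plus_ell2.rep_eq)

lemmas Rep_ell2_simps = zero_ell2.rep_eq plus_ell2.rep_eq uminus_ell2.rep_eq Rep_ell2_minus
  scaleC_ell2.rep_eq scaleR_ell2.rep_eq Rep_ell2_sum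

lemma ell2_eqI: "(\<And>i. Rep_ell2 \<phi> i = Rep_ell2 \<psi> i) \<Longrightarrow> \<phi> = \<psi>"
  by (simp add: Rep_ell2_inject[symmetric] fun_eq_iff)

lemma norm_ell2_square: "(norm \<phi>)\<^sup>2 = (\<Sum>\<^sub>\<infinity>i. (cmod (Rep_ell2 \<phi> i))\<^sup>2)"
  by (simp add: power2_norm_eq_inner inner_ell2.rep_eq)

lemma cmod_Rep_ell2_le: "cmod (Rep_ell2 \<phi> i) \<le> norm \<phi>"
proof -
  have "(cmod (Rep_ell2 \<phi> i))\<^sup>2 \<le> (norm \<phi>)\<^sup>2"
    using finite_sum_le_infsum[OF Rep_ell2_summable, of "{i}" \<phi>] by (simp add: norm_ell2_square)
  then show ?thesis by (simp add: power_mono_iff)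
qed

lemma Rep_Abs_ell1:
  assumes "f abs_summable_on UNIV"
  shows "Rep_ell2 (Abs_ell2 f) = f"
  using abs_summable_on_imp_square(1)[OF assms] by (simp add: Abs_ell2_inverse)

lemma norm_ell2_le_ell1:
  assumes "Rep_ell2 \<phi> abs_summable_on UNIV"
  shows "norm \<phi> \<le> (\<Sum>\<^sub>\<infinity>i. cmod (Rep_ell2 \<phi> i))"
proof -
  have "(norm \<phi>)\<^sup>2 \<le> (\<Sum>\<^sub>\<infinity>i. cmod (Rep_ell2 \<phi> i))\<^sup>2"
    using abs_summable_on_imp_square(2)[OF assms] by (simp add: norm_ell2_square)
  then show ?thesis
    by (rule power2_le_imp_le) (simp add: infsum_nonneg)
qed

text \<open>Cauchy-Schwarz, taken from the real inner product of \<open>ell2\<close> by regarding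
  the weights and the moduli of \<phi> as two of its elements.\<close>

lemma infsum_mult_ell2_le:
  assumes "(\<lambda>i. (w i)\<^sup>2) summable_on UNIV" "\<And>i. 0 \<le> w i"
  shows "(\<lambda>i. w i * cmod (Rep_ell2 \<phi> i)) summable_on UNIV"
    and "(\<Sum>\<^sub>\<infinity>i. w i * cmod (Rep_ell2 \<phi> i)) \<le> sqrt (\<Sum>\<^sub>\<infinity>i. (w i)\<^sup>2) * norm \<phi>"
proof -
  let ?W = "Abs_ell2 (\<lambda>i. complex_of_real (w i))"
  let ?P = "Abs_ell2 (\<lambda>i. complex_of_real (cmod (Rep_ell2 \<phi> i)))"
  have W: "Rep_ell2 ?W = (\<lambda>i. complex_of_real (w i))"
    by (rule Abs_ell2_inverse) (simp add: assms)
  have P: "Rep_ell2 ?P = (\<lambda>i. complex_of_real (cmod (Rep_ell2 \<phi> i)))"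
    by (rule Abs_ell2_inverse) (simp add: Rep_ell2_summable)
  have nP: "norm ?P = norm \<phi>"
  proof -
    have "(norm ?P)\<^sup>2 = (norm \<phi>)\<^sup>2"
      by (simp add: norm_ell2_square P)
    then show ?thesis by simp
  qed
  have nW: "norm ?W = sqrt (\<Sum>\<^sub>\<infinity>i. (w i)\<^sup>2)"
  proof -
    have "(norm ?W)\<^sup>2 = (\<Sum>\<^sub>\<infinity>i. (w i)\<^sup>2)"
      by (simp add: norm_ell2_square W)
    then show ?thesis by (metis norm_ge_zero real_sqrt_unique)
  qed
  show "(\<lambda>i. w i * cmod (Rep_ell2 \<phi> i)) summable_on UNIV"
    using abs_summable_on_mult_ell2[of "\<lambda>i. complex_of_real (w i)" "Rep_ell2 \<phi>"] assms
    by (simp add: Rep_ell2_summable norm_mult)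
  have "(\<Sum>\<^sub>\<infinity>i. w i * cmod (Rep_ell2 \<phi> i)) = ?W \<bullet> ?P"
    by (simp add: inner_ell2.rep_eq W P inner_complex_def)
  also have "\<dots> \<le> norm ?W * norm ?P"
    by (rule norm_cauchy_schwarz)
  finally show "(\<Sum>\<^sub>\<infinity>i. w i * cmod (Rep_ell2 \<phi> i)) \<le> sqrt (\<Sum>\<^sub>\<infinity>i. (w i)\<^sup>2) * norm \<phi>"
    by (simp add: nP nW)
qed

lemma Rep_unit_vec_ell2: "Rep_ell2 (unit_vec_ell2 k) j = (if j = k then 1 else 0)"
proof -
  have "(\<lambda>j. if j = k then 1 else 0 :: complex) abs_summable_on UNIV"
    by (rule finite_nonzero_values_imp_summable_on) simp
  from Rep_Abs_ell1[OF this] show ?thesis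
    by (simp add: unit_vec_ell2_def)
qed

text \<open>Pythagoras: the squared distance from \<phi> to its partial sum over \<open>F\<close> is
  the square sum outside \<open>F\<close>, which tends to 0. Hence a bounded operator is determined
  by its values on unit vectors.\<close>

lemma ell2_has_sum_unit_vec:
  "((\<lambda>k. Rep_ell2 \<phi> k *\<^sub>C unit_vec_ell2 k) has_sum \<phi>) UNIV"
proof -
  let ?s = "\<lambda>F. \<Sum>k\<in>F. Rep_ell2 \<phi> k *\<^sub>C unit_vec_ell2 k"
  let ?q = "\<lambda>i. (cmod (Rep_ell2 \<phi> i))\<^sup>2"
  have rep: "Rep_ell2 (?s F) i = (if i \<in> F then Rep_ell2 \<phi> i else 0)" if "finite F" for F i
  proof -
    have "Rep_ell2 (?s F) i = (\<Sum>k\<in>F. if k = i then Rep_ell2 \<phi> i else 0)"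
      by (auto simp: Rep_ell2_simps Rep_unit_vec_ell2 intro!: sum.cong)
    then show ?thesis using that by simp
  qed
  have n: "(norm (?s F - \<phi>))\<^sup>2 = infsum ?q UNIV - sum ?q F" if F: "finite F" for F
  proof -
    have "(norm (?s F - \<phi>))\<^sup>2 = infsum ?q (UNIV - F)"
      unfolding norm_ell2_square
      by (rule infsum_cong_neutral) (auto simp: Rep_ell2_minus rep[OF F])
    also have "\<dots> = infsum ?q UNIV - infsum ?q F"
      by (rule infsum_Diff) (auto simp: Rep_ell2_summable F)
    finally show ?thesis using F by simp
  qed
  have "((\<lambda>F. infsum ?q UNIV - sum ?q F) \<longlongrightarrow> infsum ?q UNIV - infsum ?q UNIV)
      (finite_subsets_at_top UNIV)"
    by (intro tendsto_intros infsum_tendsto Rep_ell2_summable)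
  then have "((\<lambda>F. infsum ?q UNIV - sum ?q F) \<longlongrightarrow> 0) (finite_subsets_at_top UNIV)"
    by simp
  then have "((\<lambda>F. (norm (?s F - \<phi>))\<^sup>2) \<longlongrightarrow> 0) (finite_subsets_at_top UNIV)"
    by (rule Lim_transform_eventually) (auto simp: n intro!: eventually_finite_subsets_at_top_weakI)
  from tendsto_real_sqrt[OF this] have "((\<lambda>F. norm (?s F - \<phi>)) \<longlongrightarrow> 0) (finite_subsets_at_top UNIV)"
    by (simp only: real_sqrt_abs abs_norm_cancel real_sqrt_zero)
  then have "((\<lambda>F. ?s F - \<phi>) \<longlongrightarrow> 0) (finite_subsets_at_top UNIV)"
    by (rule tendsto_norm_zero_cancel)
  from LIM_zero_cancel[OF this] show ?thesis
    unfolding has_sum_def .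
qed


section \<open>Bounded operators and their matrices\<close>

section \<open>Bounded complex linear maps\<close>

text \<open>Lets functionals count as bounded complex linear maps, so that coordinates and dual
  functionals fall under \<open>bounded_clinear\<close>.\<close>

instantiation complex :: complex_normed_vector
begin
definition scaleC_complex :: "complex \<Rightarrow> complex \<Rightarrow> complex" where
  "scaleC_complex c z = c * z"
instance
  by standard (auto simp: scaleC_complex_def algebra_simps norm_mult scaleR_conv_of_real)
end

lemma bounded_clinear_bounded_linear: "bounded_clinear A \<Longrightarrow> bounded_linear A"
  by (simp add: bounded_clinear_def)

lemma bounded_clinear_scaleC: "bounded_clinear A \<Longrightarrow> A (c *\<^sub>C x) = c *\<^sub>C A x"
  by (simp add: bounded_clinear_def)

lemma bounded_clinear_linear: "bounded_clinear A \<Longrightarrow> linear A"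
  by (simp add: bounded_clinear_def bounded_linear.linear)

lemmas bounded_clinear_diff = bounded_clinear_linear[THEN linear_diff]
  and bounded_clinear_add = bounded_clinear_linear[THEN linear_add]
  and bounded_clinear_sum = bounded_clinear_linear[THEN linear_sum]
  and bounded_clinear_0 = bounded_clinear_linear[THEN linear_0]

lemma bounded_clinearI:
  assumes "\<And>x y. A (x + y) = A x + A y" "\<And>c x. A (c *\<^sub>C x) = c *\<^sub>C A x"
    "\<And>x. norm (A x) \<le> K * norm x"
  shows "bounded_clinear A"
  unfolding bounded_clinear_def
proof (intro conjI allI)
  show "bounded_linear A"
    by (rule bounded_linear_intro[of A K])
      (use assms in \<open>auto simp: scaleR_scaleC mult.commute\<close>)
qed (rule assms)

lemma bounded_linear_scaleC: "bounded_linear (\<lambda>x::'a::complex_normed_vector. c *\<^sub>C x)"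
  by (rule bounded_linear_intro[of _ "cmod c"])
    (auto simp: scaleC_add_right scaleR_scaleC scaleC_scaleC norm_scaleC mult.commute)

lemma bounded_clinear_compose: "bounded_clinear A \<Longrightarrow> bounded_clinear B \<Longrightarrow> bounded_clinear (\<lambda>x. A (B x))"
  by (auto simp: bounded_clinear_def intro: bounded_linear_compose)

lemma bounded_clinear_id: "bounded_clinear (\<lambda>x. x)"
  by (auto simp: bounded_clinear_def)

lemma bounded_clinear_minus_fun:
  "bounded_clinear A \<Longrightarrow> bounded_clinear B \<Longrightarrow> bounded_clinear (\<lambda>x. A x - B x)"
  by (auto simp: bounded_clinear_def bounded_linear_sub complex_vector.scale_right_diff_distrib)

lemma bounded_clinear_scaleC_fun: "bounded_clinear A \<Longrightarrow> bounded_clinear (\<lambda>x. c *\<^sub>C A x)"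
  by (auto simp: bounded_clinear_def complex_vector.scale_left_commute
      intro: bounded_linear_compose[OF bounded_linear_scaleC])

lemma bounded_clinear_sum_fun:
  "(\<And>i. i \<in> I \<Longrightarrow> bounded_clinear (A i)) \<Longrightarrow> bounded_clinear (\<lambda>x. \<Sum>i\<in>I. A i x)"
  by (auto simp: bounded_clinear_def bounded_linear_sum complex_vector.scale_sum_right)

lemma bounded_clinear_Rep_ell2: "bounded_clinear (\<lambda>\<phi>. Rep_ell2 \<phi> i)"
  by (rule bounded_clinearI[of _ 1]) (auto simp: Rep_ell2_simps scaleC_complex_def cmod_Rep_ell2_le)

lemma bounded_clinear_has_sum:
  assumes "bounded_clinear A"
  shows "((\<lambda>k. Rep_ell2 \<phi> k *\<^sub>C A (unit_vec_ell2 k)) has_sum A \<phi>) UNIV"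
  using has_sum_bounded_linear[OF bounded_clinear_bounded_linear[OF assms] ell2_has_sum_unit_vec[of \<phi>]]
  by (simp add: bounded_clinear_scaleC[OF assms])

lemma matrix_entry_has_sum:
  assumes "bounded_clinear A"
  shows "((\<lambda>k. matrix_entry A j k * Rep_ell2 \<phi> k) has_sum Rep_ell2 (A \<phi>) j) UNIV"
  using bounded_clinear_has_sum[OF bounded_clinear_compose[OF bounded_clinear_Rep_ell2[of j] assms], of \<phi>]
  by (simp add: matrix_entry_def scaleC_complex_def mult.commute)

lemma bounded_clinear_eqI:
  assumes "bounded_clinear A" "bounded_clinear B" "\<And>k. A (unit_vec_ell2 k) = B (unit_vec_ell2 k)"
  shows "A = B"
proof
  fix \<phi>
  show "A \<phi> = B \<phi>"
    using bounded_clinear_has_sum[OF assms(1), of \<phi>] bounded_clinear_has_sum[OF assms(2), of \<phi>] assms(3)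
    by (auto intro: has_sum_unique)
qed


section \<open>Operators given by matrices\<close>

text \<open>Weaker than membership in \<open>D\<^sub>2\<close>, so as to cover also the symbols of order \<open>- n\<close>.\<close>

definition col_ell2 :: "('i \<Rightarrow> 'i \<Rightarrow> complex) \<Rightarrow> bool" where
  "col_ell2 a \<longleftrightarrow> (\<forall>k. (\<lambda>j. a j k) abs_summable_on UNIV) \<and>
     (\<lambda>k. (\<Sum>\<^sub>\<infinity>j. cmod (a j k))\<^sup>2) summable_on UNIV"

definition mat_op :: "('i \<Rightarrow> 'i \<Rightarrow> complex) \<Rightarrow> 'i ell2 \<Rightarrow> 'i ell2" where
  "mat_op a \<phi> = Abs_ell2 (\<lambda>j. \<Sum>\<^sub>\<infinity>k. a j k * Rep_ell2 \<phi> k)"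

definition mat_bound :: "('i \<Rightarrow> 'i \<Rightarrow> complex) \<Rightarrow> real" where
  "mat_bound a = sqrt (\<Sum>\<^sub>\<infinity>k. (\<Sum>\<^sub>\<infinity>j. cmod (a j k))\<^sup>2)"

text \<open>Summed by columns, the total pairs the \<ell>1 norms of the columns with the moduli of
  \<phi>, and Cauchy-Schwarz gives the constant \<open>mat_bound a\<close>. The images of
  \<open>mat_op a\<close> thus lie in \<ell>1, which makes their Fourier series converge
  uniformly.\<close>

lemma mat_op_summable:
  assumes "col_ell2 a"
  shows "(\<lambda>(j, k). a j k * Rep_ell2 \<phi> k) abs_summable_on UNIV"
    and "(\<Sum>\<^sub>\<infinity>(j, k). cmod (a j k * Rep_ell2 \<phi> k)) \<le> mat_bound a * norm \<phi>"
proof -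
  let ?f = "\<lambda>(k, j). a j k * Rep_ell2 \<phi> k" and ?w = "\<lambda>k. \<Sum>\<^sub>\<infinity>j. cmod (a j k)"
  have col: "(\<lambda>j. cmod (a j k)) summable_on UNIV"
    and w: "(\<lambda>k. (?w k)\<^sup>2) summable_on UNIV" for k
    using assms by (auto simp: col_ell2_def)
  have eq: "(\<Sum>\<^sub>\<infinity>j. cmod (?f (k, j))) = ?w k * cmod (Rep_ell2 \<phi> k)" for k
    by (simp add: norm_mult infsum_cmult_left')
  have s: "?f abs_summable_on UNIV"
    unfolding abs_summable_on_pairs_iff
    using infsum_mult_ell2_le(1)[OF w, of \<phi>]
    by (auto simp: norm_mult infsum_cmult_left' infsum_nonneg intro!: summable_on_cmult_left col)
  then show "(\<lambda>(j, k). a j k * Rep_ell2 \<phi> k) abs_summable_on UNIV"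
    by (subst (asm) abs_summable_on_swap_UNIV[symmetric]) simp
  have "(\<Sum>\<^sub>\<infinity>(j, k). cmod (a j k * Rep_ell2 \<phi> k)) = (\<Sum>\<^sub>\<infinity>z. cmod (?f z))"
    by (subst infsum_swap_UNIV[symmetric]) (simp add: case_prod_unfold)
  also have "\<dots> = (\<Sum>\<^sub>\<infinity>k. \<Sum>\<^sub>\<infinity>j. cmod (?f (k, j)))"
    using infsum_Sigma_banach[of "\<lambda>z. cmod (?f z)" UNIV "\<lambda>_. UNIV"] s by simp
  also have "\<dots> = (\<Sum>\<^sub>\<infinity>k. ?w k * cmod (Rep_ell2 \<phi> k))"
    by (simp only: eq)
  also have "\<dots> \<le> mat_bound a * norm \<phi>"
    unfolding mat_bound_def by (rule infsum_mult_ell2_le(2)[OF w]) (simp add: infsum_nonneg)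
  finally show "(\<Sum>\<^sub>\<infinity>(j, k). cmod (a j k * Rep_ell2 \<phi> k)) \<le> mat_bound a * norm \<phi>" .
qed

lemma
  assumes "col_ell2 a"
  shows Rep_mat_op: "Rep_ell2 (mat_op a \<phi>) j = (\<Sum>\<^sub>\<infinity>k. a j k * Rep_ell2 \<phi> k)"
    and mat_op_row_summable: "(\<lambda>k. a j k * Rep_ell2 \<phi> k) abs_summable_on UNIV"
    and mat_op_ell1: "Rep_ell2 (mat_op a \<phi>) abs_summable_on UNIV"
    and mat_op_ell1_le: "(\<Sum>\<^sub>\<infinity>j. cmod (Rep_ell2 (mat_op a \<phi>) j)) \<le> mat_bound a * norm \<phi>"
proof -
  note s = mat_op_summable[OF assms, of \<phi>]
  note b = abs_summable_on_infsum_bound[OF s(1), simplified]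
  have R: "Rep_ell2 (mat_op a \<phi>) = (\<lambda>j. \<Sum>\<^sub>\<infinity>k. a j k * Rep_ell2 \<phi> k)"
    unfolding mat_op_def by (rule Rep_Abs_ell1) (rule b(1))
  show "Rep_ell2 (mat_op a \<phi>) j = (\<Sum>\<^sub>\<infinity>k. a j k * Rep_ell2 \<phi> k)"
    by (simp add: R)
  show "Rep_ell2 (mat_op a \<phi>) abs_summable_on UNIV"
    unfolding R by (rule b(1))
  show "(\<Sum>\<^sub>\<infinity>j. cmod (Rep_ell2 (mat_op a \<phi>) j)) \<le> mat_bound a * norm \<phi>"
    unfolding R using b(2) s(2) by (simp add: case_prod_unfold)
  show "(\<lambda>k. a j k * Rep_ell2 \<phi> k) abs_summable_on UNIV"
    using s(1) unfolding abs_summable_on_pairs_iff by simp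
qed

lemma bounded_clinear_mat_op:
  assumes a: "col_ell2 a"
  shows "bounded_clinear (mat_op a)"
proof (rule bounded_clinearI[of _ "mat_bound a"])
  note s = abs_summable_summable[OF mat_op_row_summable[OF a]]
  show "mat_op a (x + y) = mat_op a x + mat_op a y" for x y
    by (rule ell2_eqI) (simp add: Rep_mat_op[OF a] Rep_ell2_simps distrib_left infsum_add s)
  show "mat_op a (c *\<^sub>C x) = c *\<^sub>C mat_op a x" for c x
    by (rule ell2_eqI)
      (simp add: Rep_mat_op[OF a] Rep_ell2_simps mult.left_commute[of _ c] infsum_cmult_right')
  show "norm (mat_op a x) \<le> mat_bound a * norm x" for x
    using norm_ell2_le_ell1[OF mat_op_ell1[OF a]] mat_op_ell1_le[OF a] by (rule order_trans)
qed

lemma matrix_entry_mat_op: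
  assumes "col_ell2 a"
  shows "matrix_entry (mat_op a) j k = a j k"
proof -
  have "(\<Sum>\<^sub>\<infinity>l. a j l * Rep_ell2 (unit_vec_ell2 k) l) = infsum (\<lambda>l. a j l) {k}"
    by (rule infsum_cong_neutral) (auto simp: Rep_unit_vec_ell2)
  then show ?thesis by (simp add: matrix_entry_def Rep_mat_op[OF assms])
qed

lemma abs_summable_imp_col_ell2:
  assumes "(\<lambda>(j, k). a j k) abs_summable_on UNIV"
  shows "col_ell2 a"
proof -
  have "(\<lambda>(k, j). a j k) abs_summable_on UNIV"
    using assms abs_summable_on_swap_UNIV[of "\<lambda>(j, k). a j k"] by simp
  then have "(\<lambda>j. a j k) abs_summable_on UNIV" "(\<lambda>k. \<Sum>\<^sub>\<infinity>j. cmod (a j k)) summable_on UNIV" for k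
    unfolding abs_summable_on_pairs_iff by simp_all
  with abs_summable_on_imp_square(1)[of "\<lambda>k. complex_of_real (\<Sum>\<^sub>\<infinity>j. cmod (a j k))"] show ?thesis
    by (simp add: col_ell2_def infsum_nonneg)
qed


section \<open>The algebra \<open>D2\<close>, its trace and closed paths\<close>

section \<open>The algebra \<open>D\<^sub>2\<close>\<close>

lemma D2_bounded_clinear: "A \<in> D2 \<Longrightarrow> bounded_clinear A"
  by (simp add: D2_def)

lemma D2_summable: "A \<in> D2 \<Longrightarrow> (\<lambda>(j, k). matrix_entry A j k) abs_summable_on UNIV"
  by (simp add: D2_def case_prod_unfold)

lemma D2_norm_eq: "D2_norm A = (\<Sum>\<^sub>\<infinity>z. cmod (case z of (j, k) \<Rightarrow> matrix_entry A j k))"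
  by (simp add: D2_norm_def case_prod_unfold)

lemma D2_norm_nonneg: "0 \<le> D2_norm A"
  unfolding D2_norm_eq by (rule infsum_nonneg) simp

lemma D2I: "bounded_clinear A \<Longrightarrow> (\<lambda>(j, k). matrix_entry A j k) abs_summable_on UNIV \<Longrightarrow> A \<in> D2"
  by (simp add: D2_def case_prod_unfold)

lemma matrix_entry_minus: "matrix_entry (\<lambda>x. A x - B x) j k = matrix_entry A j k - matrix_entry B j k"
  by (simp add: matrix_entry_def Rep_ell2_simps)

lemma matrix_entry_scaleC: "matrix_entry (\<lambda>x. c *\<^sub>C A x) j k = c * matrix_entry A j k"
  by (simp add: matrix_entry_def Rep_ell2_simps)

lemma mat_op_in_D2:
  assumes "(\<lambda>(j, k). a j k) abs_summable_on UNIV"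
  shows "mat_op a \<in> D2"
  by (rule D2I) (use assms abs_summable_imp_col_ell2[OF assms] in
      \<open>auto simp: matrix_entry_mat_op intro: bounded_clinear_mat_op\<close>)

lemma D2_minus:
  assumes A: "A \<in> D2" and B: "B \<in> D2"
  shows "(\<lambda>x. A x - B x) \<in> D2" "D2_norm (\<lambda>x. A x - B x) \<le> D2_norm A + D2_norm B"
proof -
  let ?a = "\<lambda>(j, k). matrix_entry A j k" and ?b = "\<lambda>(j, k). matrix_entry B j k"
  let ?c = "\<lambda>(j, k). matrix_entry (\<lambda>x. A x - B x) j k"
  note a = D2_summable[OF A] and b = D2_summable[OF B]
  have ab: "(\<lambda>z. cmod (?a z) + cmod (?b z)) summable_on UNIV"
    by (rule summable_on_add[OF a b])
  have le: "cmod (?c z) \<le> cmod (?a z) + cmod (?b z)" for z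
    by (auto simp: matrix_entry_minus case_prod_unfold norm_triangle_ineq4)
  have c: "?c abs_summable_on UNIV"
    by (rule Infinite_Sum.abs_summable_on_comparison_test'[OF ab le])
  show "(\<lambda>x. A x - B x) \<in> D2"
    by (rule D2I[OF bounded_clinear_minus_fun c]) (use A B in \<open>auto simp: D2_bounded_clinear\<close>)
  have "D2_norm (\<lambda>x. A x - B x) \<le> (\<Sum>\<^sub>\<infinity>z. cmod (?a z) + cmod (?b z))"
    unfolding D2_norm_eq by (rule infsum_mono[OF c ab le])
  also have "\<dots> = D2_norm A + D2_norm B"
    unfolding D2_norm_eq by (rule infsum_add[OF a b])
  finally show "D2_norm (\<lambda>x. A x - B x) \<le> D2_norm A + D2_norm B" .
qed

lemma D2_norm_minus_commute: "D2_norm (\<lambda>x. A x - B x) = D2_norm (\<lambda>x. B x - A x)"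
  unfolding D2_norm_def matrix_entry_minus by (simp add: norm_minus_commute)

lemma D2_scaleC:
  assumes A: "A \<in> D2"
  shows "(\<lambda>x. c *\<^sub>C A x) \<in> D2" "D2_norm (\<lambda>x. c *\<^sub>C A x) = cmod c * D2_norm A"
proof -
  show "(\<lambda>x. c *\<^sub>C A x) \<in> D2"
    by (rule D2I[OF bounded_clinear_scaleC_fun[OF D2_bounded_clinear[OF A]]])
      (use summable_on_cmult_right[OF D2_summable[OF A], of "cmod c"] in
        \<open>simp add: matrix_entry_scaleC norm_mult case_prod_unfold\<close>)
  show "D2_norm (\<lambda>x. c *\<^sub>C A x) = cmod c * D2_norm A"
    by (simp add: D2_norm_eq matrix_entry_scaleC norm_mult case_prod_unfold infsum_cmult_right')
qed

text \<open>Every coordinate of \<phi> is at most \<open>norm \<phi>\<close>, so the D_2-norm even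
  bounds the norm of \<open>A\<close> as a map from \<open>ell2\<close> to \<ell>1. The second claim
  will confine eigenvalues to the unit disc.\<close>

lemma
  assumes A: "A \<in> D2"
  shows D2_ell1: "Rep_ell2 (A \<phi>) abs_summable_on UNIV"
    and D2_norm_bound: "norm (A \<phi>) \<le> D2_norm A * norm \<phi>"
proof -
  let ?a = "\<lambda>(j, k). matrix_entry A j k" and ?b = "\<lambda>(j, k). matrix_entry A j k * Rep_ell2 \<phi> k"
  note a = D2_summable[OF A]
  have a': "(\<lambda>z. cmod (?a z) * norm \<phi>) summable_on UNIV"
    by (rule summable_on_cmult_left[OF a])
  have le: "cmod (?b z) \<le> cmod (?a z) * norm \<phi>" for z
    by (auto simp: norm_mult case_prod_unfold intro!: mult_left_mono cmod_Rep_ell2_le)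
  have b: "?b abs_summable_on UNIV"
    by (rule Infinite_Sum.abs_summable_on_comparison_test'[OF a' le])
  have R: "(\<Sum>\<^sub>\<infinity>k. ?b (j, k)) = Rep_ell2 (A \<phi>) j" for j
    using matrix_entry_has_sum[OF D2_bounded_clinear[OF A]] by (simp add: infsumI)
  note B = abs_summable_on_infsum_bound[OF b, unfolded R]
  show *: "Rep_ell2 (A \<phi>) abs_summable_on UNIV" by (rule B(1))
  have "norm (A \<phi>) \<le> (\<Sum>\<^sub>\<infinity>j. cmod (Rep_ell2 (A \<phi>) j))"
    by (rule norm_ell2_le_ell1[OF *])
  also have "\<dots> \<le> (\<Sum>\<^sub>\<infinity>z. cmod (?b z))" by (rule B(2))
  also have "\<dots> \<le> (\<Sum>\<^sub>\<infinity>z. cmod (?a z) * norm \<phi>)" by (rule infsum_mono[OF b a' le])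
  also have "\<dots> = D2_norm A * norm \<phi>" by (simp add: D2_norm_eq infsum_cmult_left')
  finally show "norm (A \<phi>) \<le> D2_norm A * norm \<phi>" .
qed

text \<open>The products \<open>matrix_entry A j l * matrix_entry B l k\<close> form a subfamily of
  the products of arbitrary pairs of entries, selected by the injection \<open>?e\<close>; the full
  family has absolute sum \<open>D2_norm A * D2_norm B\<close>.\<close>

lemma
  assumes A: "A \<in> D2" and B: "B \<in> D2"
  shows D2_compose: "(\<lambda>x. A (B x)) \<in> D2"
    and D2_norm_compose: "D2_norm (\<lambda>x. A (B x)) \<le> D2_norm A * D2_norm B"
proof -
  let ?a = "\<lambda>(j, k). matrix_entry A j k" and ?b = "\<lambda>(j, k). matrix_entry B j k"
  let ?g = "\<lambda>(z, w). ?a z * ?b w"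
  let ?h = "\<lambda>((j, k), l). matrix_entry A j l * matrix_entry B l k"
  let ?e = "\<lambda>((j, k), l). ((j, l), (l, k))"
  note a = D2_summable[OF A] and b = D2_summable[OF B]
  have g: "?g abs_summable_on UNIV"
    by (rule iffD2[OF abs_summable_on_pairs_iff])
      (simp add: norm_mult infsum_cmult_right' summable_on_cmult_right[OF b] summable_on_cmult_left[OF a])
  have gsum: "(\<Sum>\<^sub>\<infinity>z. cmod (?g z)) = D2_norm A * D2_norm B"
  proof -
    have "(\<Sum>\<^sub>\<infinity>z. cmod (?g z)) = (\<Sum>\<^sub>\<infinity>z. \<Sum>\<^sub>\<infinity>w. cmod (?g (z, w)))"
      using infsum_Sigma_banach[of "\<lambda>z. cmod (?g z)" UNIV "\<lambda>_. UNIV"] g by simp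
    then show ?thesis
      by (simp add: D2_norm_eq norm_mult infsum_cmult_right' infsum_cmult_left' case_prod_unfold)
  qed
  have inj: "inj ?e" by (auto simp: inj_on_def)
  have he: "cmod (?h z) = cmod (?g (?e z))" for z by (auto split: prod.splits)
  have gr: "(\<lambda>z. cmod (?g z)) summable_on range ?e"
    by (rule summable_on_subset_banach[OF g]) simp
  then have h: "?h abs_summable_on UNIV"
    unfolding he using summable_on_reindex[OF inj, of "\<lambda>z. cmod (?g z)"] by (simp add: o_def)
  have "(\<Sum>\<^sub>\<infinity>z. cmod (?h z)) = infsum (\<lambda>z. cmod (?g z)) (range ?e)"
    unfolding he using infsum_reindex[OF inj, of "\<lambda>z. cmod (?g z)"] by (simp add: o_def)
  also have "\<dots> \<le> D2_norm A * D2_norm B"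
    unfolding gsum[symmetric] by (rule infsum_mono2[OF gr g]) auto
  finally have hsum: "(\<Sum>\<^sub>\<infinity>z. cmod (?h z)) \<le> D2_norm A * D2_norm B" .
  have AB: "matrix_entry (\<lambda>x. A (B x)) j k = (\<Sum>\<^sub>\<infinity>l. matrix_entry A j l * matrix_entry B l k)" for j k
    using infsumI[OF matrix_entry_has_sum[OF D2_bounded_clinear[OF A], of j "B (unit_vec_ell2 k)"]]
    by (simp add: matrix_entry_def)
  have eq: "(\<Sum>\<^sub>\<infinity>l. ?h (z, l)) = (case z of (j, k) \<Rightarrow> matrix_entry (\<lambda>x. A (B x)) j k)" for z
    by (simp add: AB case_prod_unfold)
  note H = abs_summable_on_infsum_bound[OF h, unfolded eq]
  show "(\<lambda>x. A (B x)) \<in> D2"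
    using bounded_clinear_compose[OF D2_bounded_clinear[OF A] D2_bounded_clinear[OF B]] H(1)
    by (rule D2I)
  show "D2_norm (\<lambda>x. A (B x)) \<le> D2_norm A * D2_norm B"
    unfolding D2_norm_eq[of "\<lambda>x. A (B x)"] using H(2) hsum by (rule order_trans)
qed

lemma D2_funpow: "A \<in> D2 \<Longrightarrow> A ^^ Suc m \<in> D2"
proof (induction m)
  case (Suc m)
  then show ?case using D2_compose[OF Suc.prems, of "A ^^ Suc m"] by (simp add: o_def)
qed simp

lemma D2_norm_funpow:
  fixes r :: real
  assumes "A \<in> D2" "D2_norm A \<le> r"
  shows "D2_norm (A ^^ Suc m) \<le> r ^ Suc m"
proof (induction m)
  case (Suc m)
  have "0 \<le> r" using assms(2) D2_norm_nonneg[of A] by linarith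
  then have "D2_norm (\<lambda>x. A ((A ^^ Suc m) x)) \<le> r * r ^ Suc m"
    by (intro order_trans[OF D2_norm_compose[OF assms(1) D2_funpow[OF assms(1)]]] mult_mono
        assms Suc.IH D2_norm_nonneg)
  then show ?case by (simp add: o_def)
qed (use assms in simp)

text \<open>Telescoping: \<open>A X - B Y = A (X - Y) - (B - A) Y\<close>, with \<open>X\<close> and
  \<open>Y\<close> the powers of \<open>A\<close> and \<open>B\<close>. The factor
  \<open>Suc m\<close> will cancel the denominator in the logarithm series.\<close>

lemma D2_norm_funpow_diff:
  fixes r :: real
  assumes A: "A \<in> D2" "D2_norm A \<le> r" and B: "B \<in> D2" "D2_norm B \<le> r"
  shows "D2_norm (\<lambda>x. (A ^^ Suc m) x - (B ^^ Suc m) x) \<le> Suc m * r ^ m * D2_norm (\<lambda>x. A x - B x)"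
proof (induction m)
  case (Suc m)
  let ?d = "D2_norm (\<lambda>x. A x - B x)"
  have r: "0 \<le> r" using A(2) D2_norm_nonneg[of A] by linarith
  note Am = D2_funpow[OF A(1), of m] and Bm = D2_funpow[OF B(1), of m]
  note AB = D2_minus(1)[OF Am Bm] and BA = D2_minus(1)[OF B(1) A(1)]
  let ?X = "\<lambda>x. A ((A ^^ Suc m) x - (B ^^ Suc m) x)"
  let ?Y = "\<lambda>x. B ((B ^^ Suc m) x) - A ((B ^^ Suc m) x)"
  have X: "D2_norm ?X \<le> r * (Suc m * r ^ m * ?d)"
    by (intro order_trans[OF D2_norm_compose[OF A(1) AB]] mult_mono A Suc.IH D2_norm_nonneg r)
  have "D2_norm ?Y \<le> ?d * r ^ Suc m"
    by (intro order_trans[OF D2_norm_compose[OF BA Bm]] mult_mono D2_norm_funpow[OF B] D2_norm_nonneg)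
      (simp_all add: D2_norm_minus_commute[of B A])
  then have "D2_norm (\<lambda>x. ?X x - ?Y x) \<le> r * (Suc m * r ^ m * ?d) + ?d * r ^ Suc m"
    using X D2_minus(2)[OF D2_compose[OF A(1) AB] D2_compose[OF BA Bm]] by linarith
  moreover have "(\<lambda>x. (A ^^ Suc (Suc m)) x - (B ^^ Suc (Suc m)) x) = (\<lambda>x. ?X x - ?Y x)"
    by (simp add: bounded_clinear_diff[OF D2_bounded_clinear[OF A(1)]])
  ultimately have "D2_norm (\<lambda>x. (A ^^ Suc (Suc m)) x - (B ^^ Suc (Suc m)) x)
      \<le> r * (Suc m * r ^ m * ?d) + ?d * r ^ Suc m"
    by (simp only:)
  then show ?case by (simp add: algebra_simps)
qed simp


section \<open>The trace\<close>

definition D2_trace :: "('i ell2 \<Rightarrow> 'i ell2) \<Rightarrow> complex" where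
  "D2_trace A = (\<Sum>\<^sub>\<infinity>j. matrix_entry A j j)"

lemma
  assumes A: "A \<in> D2"
  shows D2_trace_summable: "(\<lambda>j. matrix_entry A j j) abs_summable_on UNIV"
    and D2_trace_bound: "cmod (D2_trace A) \<le> D2_norm A"
proof -
  let ?a = "\<lambda>(j, k). matrix_entry A j k" and ?e = "\<lambda>j. (j, j)"
  note a = D2_summable[OF A]
  have inj: "inj ?e" by (auto simp: inj_on_def)
  have r: "(\<lambda>z. cmod (?a z)) summable_on range ?e"
    by (rule summable_on_subset_banach[OF a]) simp
  then show s: "(\<lambda>j. matrix_entry A j j) abs_summable_on UNIV"
    using summable_on_reindex[OF inj, of "\<lambda>z. cmod (?a z)"] by (simp add: o_def)
  have "cmod (D2_trace A) \<le> (\<Sum>\<^sub>\<infinity>j. cmod (matrix_entry A j j))"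
    unfolding D2_trace_def by (rule norm_infsum_bound[OF s])
  also have "\<dots> = infsum (\<lambda>z. cmod (?a z)) (range ?e)"
    using infsum_reindex[OF inj, of "\<lambda>z. cmod (?a z)"] by (simp add: o_def)
  also have "\<dots> \<le> D2_norm A"
    unfolding D2_norm_eq by (rule infsum_mono2[OF r a]) auto
  finally show "cmod (D2_trace A) \<le> D2_norm A" .
qed

lemma D2_trace_minus:
  assumes A: "A \<in> D2" and B: "B \<in> D2"
  shows "D2_trace (\<lambda>x. A x - B x) = D2_trace A - D2_trace B"
proof -
  have "((\<lambda>j. matrix_entry A j j + - matrix_entry B j j) has_sum (D2_trace A + - D2_trace B)) UNIV"
    unfolding D2_trace_def
    by (intro has_sum_add has_sum_uminusI has_sum_infsum abs_summable_summable[OF D2_trace_summable[OF A]]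
        abs_summable_summable[OF D2_trace_summable[OF B]])
  then show ?thesis
    unfolding D2_trace_def matrix_entry_minus by (auto intro: infsumI)
qed

lemma D2_trace_scaleC: "D2_trace (\<lambda>x. c *\<^sub>C A x) = c * D2_trace A"
  by (simp add: D2_trace_def matrix_entry_scaleC infsum_cmult_right')


section \<open>Traces of powers as sums over closed paths\<close>

definition path_weight :: "('i \<Rightarrow> 'i \<Rightarrow> complex) \<Rightarrow> nat \<Rightarrow> 'i list \<Rightarrow> complex" where
  "path_weight a m js = (\<Prod>s=1..m. a (js ! (s - 1)) (js ! s))"

lemma path_weight_0 [simp]: "path_weight a 0 js = 1"
  by (simp add: path_weight_def)

lemma path_weight_Cons: "path_weight a (Suc m) (i # js) = a i (js ! 0) * path_weight a m js"
proof -
  have "path_weight a (Suc m) (i # js) = a i (js ! 0) * (\<Prod>s=Suc 1..Suc m. a ((i # js) ! (s - 1)) ((i # js) ! s))"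
    unfolding path_weight_def by (subst prod.atLeast_Suc_atMost) auto
  also have "(\<Prod>s=Suc 1..Suc m. a ((i # js) ! (s - 1)) ((i # js) ! s)) = path_weight a m js"
    unfolding path_weight_def
    by (subst prod.shift_bounds_cl_Suc_ivl) (auto intro!: prod.cong simp: nth_Cons split: nat.splits)
  finally show ?thesis .
qed

text \<open>A vertex put in front contributes a factor whose absolute sum over that vertex is a
  column sum, hence at most the absolute sum of all entries. Paths have at least one step: those
  with none have weight 1 each and are not summable over an infinite index set.\<close>

lemma path_weight_summable:
  assumes a: "(\<lambda>(j, k). a j k) abs_summable_on UNIV"
  shows "path_weight a (Suc m) abs_summable_on {js. length js = Suc (Suc m)}"
proof (induction m)
  case 0
  have bij: "bij_betw (\<lambda>(j, k). [j, k]) UNIV {js. length js = Suc (Suc 0)}"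
    by (rule bij_betw_byWitness[of _ "\<lambda>js. (js ! 0, js ! 1)"]) (auto simp: length_Suc_conv)
  have "(\<lambda>z. cmod (path_weight a (Suc 0) (case z of (j, k) \<Rightarrow> [j, k]))) summable_on UNIV"
    using a by (simp add: path_weight_def case_prod_unfold)
  then show ?case by (subst (asm) summable_on_reindex_bij_betw[OF bij])
next
  case (Suc m)
  let ?L = "{js :: 'a list. length js = Suc (Suc m)}"
  let ?S = "\<Sum>\<^sub>\<infinity>z. cmod (case z of (j, k) \<Rightarrow> a j k)"
  have bij: "bij_betw (\<lambda>(js, i). i # js) (?L \<times> UNIV) {js. length js = Suc (Suc (Suc m))}"
    by (rule bij_betw_byWitness[of _ "\<lambda>js. (tl js, hd js)"]) (auto simp: length_Suc_conv)
  have a': "(\<lambda>(k, j). a j k) abs_summable_on UNIV"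
    using a abs_summable_on_swap_UNIV[of "\<lambda>(j, k). a j k"] by simp
  then have col: "(\<lambda>j. a j k) abs_summable_on UNIV"
    and tot: "(\<lambda>k. \<Sum>\<^sub>\<infinity>j. cmod (a j k)) summable_on UNIV" for k
    unfolding abs_summable_on_pairs_iff by simp_all
  have colS: "(\<Sum>\<^sub>\<infinity>j. cmod (a j k)) \<le> infsum (\<lambda>k. \<Sum>\<^sub>\<infinity>j. cmod (a j k)) UNIV" for k
    using finite_sum_le_infsum[OF tot, of "{k}"] by (simp add: infsum_nonneg)
  have eq: "path_weight a (Suc (Suc m)) (i # js) = a i (js ! 0) * path_weight a (Suc m) js" for i js
    by (rule path_weight_Cons)
  have "(\<lambda>z. path_weight a (Suc (Suc m)) (case z of (js, i) \<Rightarrow> i # js)) abs_summable_on ?L \<times> UNIV"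
    unfolding Infinite_Sum.abs_summable_on_Sigma_iff
  proof (intro conjI ballI)
    fix js :: "'a list"
    show "(\<lambda>i. path_weight a (Suc (Suc m)) (case (js, i) of (js, i) \<Rightarrow> i # js)) abs_summable_on UNIV"
      by (simp add: eq norm_mult summable_on_cmult_left col)
  next
    have "(\<lambda>js. infsum (\<lambda>k. \<Sum>\<^sub>\<infinity>j. cmod (a j k)) UNIV * cmod (path_weight a (Suc m) js)) summable_on ?L"
      by (intro summable_on_cmult_right Suc.IH)
    then show "(\<lambda>js. \<Sum>\<^sub>\<infinity>i. norm (path_weight a (Suc (Suc m)) (case (js, i) of (js, i) \<Rightarrow> i # js))) abs_summable_on ?L"
      by (rule Infinite_Sum.abs_summable_on_comparison_test')
        (simp add: eq norm_mult infsum_cmult_left' infsum_nonneg mult_right_mono colS)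
  qed
  then show ?case by (subst (asm) summable_on_reindex_bij_betw[OF bij])
qed

lemma matrix_entry_id: "matrix_entry (\<lambda>x. x) j k = (if j = k then 1 else 0)"
  by (simp add: matrix_entry_def Rep_unit_vec_ell2)

text \<open>Induction on the first step. Summability over all paths permits grouping them by their
  second vertex \<open>l\<close>, and what remains is the matrix product of \<open>A\<close> with
  the next lower power.\<close>

lemma matrix_entry_funpow_has_sum:
  assumes A: "A \<in> D2"
  shows "((path_weight (matrix_entry A) m) has_sum matrix_entry (A ^^ m) i k)
    {js. length js = Suc m \<and> js ! 0 = i \<and> js ! m = k}"
proof (induction m arbitrary: i)
  case 0
  have "matrix_entry (A ^^ 0) i k = (if i = k then 1 else 0)"
    using matrix_entry_id[of i k] by (simp add: id_def)
  moreover have "{js. length js = Suc 0 \<and> js ! 0 = i \<and> js ! 0 = k} = (if i = k then {[i]} else {})"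
    by (auto simp: length_Suc_conv)
  ultimately show ?case
    by (simp add: has_sum_finite_iff matrix_entry_id)
next
  case (Suc m)
  let ?a = "matrix_entry A"
  let ?S = "\<lambda>i. {js. length js = Suc m \<and> js ! 0 = i \<and> js ! m = k}"
  have bij: "bij_betw (\<lambda>(l, js). i # js) (SIGMA l:UNIV. ?S l)
      {js. length js = Suc (Suc m) \<and> js ! 0 = i \<and> js ! Suc m = k}"
    by (rule bij_betw_byWitness[of _ "\<lambda>js. (tl js ! 0, tl js)"]) (auto simp: length_Suc_conv nth_Cons)
  have sm: "path_weight ?a (Suc m) summable_on {js. length js = Suc (Suc m) \<and> js ! 0 = i \<and> js ! Suc m = k}"
    by (rule summable_on_subset_banach[OF abs_summable_summable[OF path_weight_summable[OF D2_summable[OF A]]]]) auto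
  have sig: "(\<lambda>z. path_weight ?a (Suc m) (case z of (l, js) \<Rightarrow> i # js)) summable_on (SIGMA l:UNIV. ?S l)"
    using sm by (subst summable_on_reindex_bij_betw[OF bij])
  have inner: "((\<lambda>js. path_weight ?a (Suc m) (case (l, js) of (l, js) \<Rightarrow> i # js)) has_sum
      ?a i l * matrix_entry (A ^^ m) l k) (?S l)" for l
    by (rule has_sum_cong[THEN iffD1, OF _ has_sum_cmult_right[OF Suc.IH]]) (auto simp: path_weight_Cons)
  have ent: "((\<lambda>l. ?a i l * matrix_entry (A ^^ m) l k) has_sum matrix_entry (A ^^ Suc m) i k) UNIV"
    using matrix_entry_has_sum[OF D2_bounded_clinear[OF A], of i "(A ^^ m) (unit_vec_ell2 k)"]
    by (simp add: matrix_entry_def)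
  have "((\<lambda>z. path_weight ?a (Suc m) (case z of (l, js) \<Rightarrow> i # js)) has_sum
      matrix_entry (A ^^ Suc m) i k) (SIGMA l:UNIV. ?S l)"
    by (rule has_sum_SigmaI[OF _ ent sig]) (rule inner)
  then show ?case by (subst (asm) has_sum_reindex_bij_betw[OF bij])
qed

text \<open>Closed paths are grouped by their base vertex; each group sums to a diagonal entry of
  the power.\<close>

lemma
  assumes A: "A \<in> D2" and m: "m \<ge> 1"
  shows closed_paths_summable: "path_weight (matrix_entry A) m summable_on {js. length js = Suc m \<and> js ! 0 = js ! m}"
    and closed_paths_trace: "(\<Sum>\<^sub>\<infinity>js\<in>{js. length js = Suc m \<and> js ! 0 = js ! m}. path_weight (matrix_entry A) m js)
      = D2_trace (A ^^ m)"
proof -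
  let ?C = "{js :: 'a list. length js = Suc m \<and> js ! 0 = js ! m}"
  let ?S = "\<lambda>i :: 'a. {js. length js = Suc m \<and> js ! 0 = i \<and> js ! m = i}"
  obtain m' where m': "m = Suc m'" using m by (cases m) auto
  show s: "path_weight (matrix_entry A) m summable_on ?C"
    unfolding m'
    by (rule summable_on_subset_banach[OF abs_summable_summable[OF path_weight_summable[OF D2_summable[OF A]]]]) auto
  have bij: "bij_betw snd (SIGMA i:UNIV. ?S i) ?C"
    by (rule bij_betw_byWitness[of _ "\<lambda>js. (js ! 0, js)"]) auto
  have sig: "(\<lambda>z. path_weight (matrix_entry A) m (snd z)) summable_on (SIGMA i:UNIV. ?S i)"
    using s by (subst summable_on_reindex_bij_betw[OF bij])
  have "infsum (path_weight (matrix_entry A) m) ?C = infsum (\<lambda>z. path_weight (matrix_entry A) m (snd z)) (SIGMA i:UNIV. ?S i)"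
    by (rule infsum_reindex_bij_betw[OF bij, symmetric])
  also have "\<dots> = (\<Sum>\<^sub>\<infinity>i. infsum (path_weight (matrix_entry A) m) (?S i))"
    using infsum_Sigma_banach[OF sig] by simp
  also have "\<dots> = D2_trace (A ^^ m)"
    unfolding D2_trace_def by (intro infsum_cong infsumI matrix_entry_funpow_has_sum[OF A])
  finally show "infsum (path_weight (matrix_entry A) m) ?C = D2_trace (A ^^ m)" .
qed


section \<open>Determinants of finite rank perturbations of the identity\<close>

section \<open>Determinants and eigenvalues of complex matrices\<close>

lemma trace_mat_mult_commute:
  fixes X Y :: "complex mat"
  assumes "X \<in> carrier_mat d d" "Y \<in> carrier_mat d d"
  shows "(\<Sum>i<d. (X * Y) $$ (i, i)) = (\<Sum>i<d. (Y * X) $$ (i, i))"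
proof -
  have "(\<Sum>i<d. (X * Y) $$ (i, i)) = (\<Sum>i<d. \<Sum>k<d. X $$ (i, k) * Y $$ (k, i))"
    using assms by (auto simp: scalar_prod_def atLeast0LessThan intro!: sum.cong)
  also have "\<dots> = (\<Sum>k<d. \<Sum>i<d. Y $$ (k, i) * X $$ (i, k))"
    by (subst sum.swap) (simp add: mult.commute)
  also have "\<dots> = (\<Sum>i<d. (Y * X) $$ (i, i))"
    using assms by (auto simp: scalar_prod_def atLeast0LessThan intro!: sum.cong)
  finally show ?thesis .
qed

lemma upper_triangular_pow:
  fixes B :: "complex mat"
  assumes B: "B \<in> carrier_mat d d" "upper_triangular B"
  shows "upper_triangular (B ^\<^sub>m m) \<and> (\<forall>i<d. (B ^\<^sub>m m) $$ (i, i) = (B $$ (i, i)) ^ m)"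
proof (induction m)
  case 0
  then show ?case using B by auto
next
  case (Suc m)
  let ?X = "B ^\<^sub>m m"
  have X: "?X \<in> carrier_mat d d" using B by simp
  have e: "(?X * B) $$ (i, j) = (\<Sum>k<d. ?X $$ (i, k) * B $$ (k, j))" if "i < d" "j < d" for i j
    using B X that by (simp add: scalar_prod_def atLeast0LessThan)
  have z: "?X $$ (i, k) * B $$ (k, j) = 0" if "i < d" "k < d" "k < i \<or> j < k" for i j k
    using that Suc.IH B X by (auto dest: upper_triangularD)
  have "upper_triangular (?X * B)"
  proof (rule upper_triangularI)
    fix i j assume "j < i" "i < dim_row (?X * B)"
    then have ij: "j < i" "i < d" using X by auto
    have "(\<Sum>k<d. ?X $$ (i, k) * B $$ (k, j)) = 0"
    proof (rule sum.neutral, intro ballI)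
      fix k assume "k \<in> {..<d}"
      moreover have "k < i \<or> j < k" using ij by linarith
      ultimately show "?X $$ (i, k) * B $$ (k, j) = 0" using z ij by auto
    qed
    then show "(?X * B) $$ (i, j) = 0" using ij by (simp only: e)
  qed
  moreover have "(?X * B) $$ (i, i) = (B $$ (i, i)) ^ Suc m" if "i < d" for i
  proof -
    have "(\<Sum>k<d. ?X $$ (i, k) * B $$ (k, i)) = (\<Sum>k\<in>{i}. ?X $$ (i, k) * B $$ (k, i))"
    proof (rule sum.mono_neutral_right)
      show "\<forall>k\<in>{..<d} - {i}. ?X $$ (i, k) * B $$ (k, i) = 0"
        using that z[of i _ i] by (metis DiffD1 DiffD2 lessThan_iff linorder_neqE_nat singletonI)
    qed (use that in auto)
    then show ?thesis using that Suc.IH by (simp add: e)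
  qed
  ultimately show ?case by simp
qed

text \<open>Schur triangularisation: the determinant and the traces of powers are invariant under
  similarity and can be read off the diagonal of \<open>B\<close>. The family \<open>es\<close>
  therefore lists the eigenvalues with algebraic multiplicity.\<close>

lemma complex_mat_eigenvalues:
  fixes K :: "complex mat"
  assumes K: "K \<in> carrier_mat d d"
  obtains es where "Determinant.det (1\<^sub>m d + K) = (\<Prod>i<d. 1 + es i)"
    "\<And>m. (\<Sum>i<d. (K ^\<^sub>m m) $$ (i, i)) = (\<Sum>i<d. es i ^ m)"
    "\<And>i. i < d \<Longrightarrow> eigenvalue K (es i)"
proof -
  obtain as where as: "char_poly K = (\<Prod>a\<leftarrow>as. [:- a, 1:])" "length as = d"
    using char_poly_factorized[OF K] by auto
  obtain B P Q where BPQ: "schur_decomposition K as = (B, P, Q)"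
    by (cases "schur_decomposition K as") auto
  from schur_decomposition[OF K as(1) BPQ]
  have w: "similar_mat_wit K B P Q" and ut: "upper_triangular B" and dg: "diag_mat B = as"
    by auto
  from w K have cB: "B \<in> carrier_mat d d" and cP: "P \<in> carrier_mat d d" and cQ: "Q \<in> carrier_mat d d"
    and PQ: "P * Q = 1\<^sub>m d" "Q * P = 1\<^sub>m d" and KB: "K = P * B * Q"
    by (auto simp: similar_mat_wit_def Let_def)
  have es: "as ! i = B $$ (i, i)" if "i < d" for i
    using dg cB that by (auto simp: diag_mat_def)
  have conj_tr: "(\<Sum>i<d. (P * X * Q) $$ (i, i)) = (\<Sum>i<d. X $$ (i, i))" if X: "X \<in> carrier_mat d d" for X
  proof -
    have "(\<Sum>i<d. (P * X * Q) $$ (i, i)) = (\<Sum>i<d. (Q * (P * X)) $$ (i, i))"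
      by (rule trace_mat_mult_commute) (use cP cQ X in auto)
    also have "Q * (P * X) = (Q * P) * X" by (rule assoc_mult_mat[symmetric, OF cQ cP X])
    also have "\<dots> = X" using X by (simp add: PQ)
    finally show ?thesis .
  qed
  show ?thesis
  proof (rule that[of "\<lambda>i. as ! i"])
    have "1\<^sub>m d + K = P * (1\<^sub>m d + B) * Q"
    proof -
      have "P * (1\<^sub>m d + B) * Q = (P * 1\<^sub>m d + P * B) * Q"
        using cP cB by (simp add: mult_add_distrib_mat[of _ d d _ d])
      also have "\<dots> = P * Q + P * B * Q"
        using cP cB cQ by (simp add: add_mult_distrib_mat[of _ d d _ _ d])
      finally show ?thesis by (simp add: PQ KB)
    qed
    then have "Determinant.det (1\<^sub>m d + K) = Determinant.det P * Determinant.det (1\<^sub>m d + B) * Determinant.det Q"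
      using cP cB cQ by (simp add: det_mult[of _ d])
    also have "\<dots> = Determinant.det (P * Q) * Determinant.det (1\<^sub>m d + B)"
      using cP cQ by (simp add: det_mult[of _ d])
    also have "\<dots> = Determinant.det (1\<^sub>m d + B)" by (simp add: PQ)
    also have "\<dots> = prod_list (diag_mat (1\<^sub>m d + B))"
      by (rule det_upper_triangular[of _ d]) (use cB upper_triangularD[OF ut] in \<open>auto intro!: upper_triangularI\<close>)
    also have "\<dots> = (\<Prod>i<d. 1 + as ! i)"
      using cB by (auto simp: prod_list_diag_prod es atLeast0LessThan intro!: prod.cong)
    finally show "Determinant.det (1\<^sub>m d + K) = (\<Prod>i<d. 1 + as ! i)" .
  next
    fix m
    have "K ^\<^sub>m m = P * B ^\<^sub>m m * Q" by (rule similar_mat_wit_pow_id[OF w])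
    then have "(\<Sum>i<d. (K ^\<^sub>m m) $$ (i, i)) = (\<Sum>i<d. (B ^\<^sub>m m) $$ (i, i))"
      using conj_tr[of "B ^\<^sub>m m"] cB by simp
    also have "\<dots> = (\<Sum>i<d. (as ! i) ^ m)"
      using upper_triangular_pow[OF cB ut, of m] by (auto simp: es)
    finally show "(\<Sum>i<d. (K ^\<^sub>m m) $$ (i, i)) = (\<Sum>i<d. (as ! i) ^ m)" .
  next
    fix i assume "i < d"
    then have "as ! i \<in> set as" using as(2) by auto
    then have "poly (char_poly K) (as ! i) = 0"
      unfolding as(1) by (auto simp: poly_prod_list prod_list_zero_iff)
    then show "eigenvalue K (as ! i)" by (simp add: eigenvalue_root_char_poly[OF K])
  qed
qed


section \<open>Finite rank operators\<close>

text \<open>The functional for a new vector \<open>x\<close> is a coordinate \<open>j\<close> that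
  does not vanish on the remainder \<open>y\<close> of \<open>x\<close>, corrected by the old
  functionals so as to vanish on \<open>B\<close>, and normalised. Being built from coordinates, all
  functionals are bounded, as the evaluation of infinite diagonal sums requires.\<close>

lemma dual_functionals:
  fixes B :: "'i ell2 set"
  assumes "finite B" "complex_vector.independent B"
  shows "\<exists>L :: 'i ell2 \<Rightarrow> 'i ell2 \<Rightarrow> complex.
    \<forall>b\<in>B. bounded_clinear (L b) \<and> (\<forall>b'\<in>B. L b b' = (if b' = b then 1 else 0))"
  using assms
proof (induction B)
  case (insert x B)
  then have ind: "complex_vector.independent B" and x: "x \<notin> complex_vector.span B"
    by (auto simp: complex_vector.independent_insert)
  then obtain L :: "'i ell2 \<Rightarrow> 'i ell2 \<Rightarrow> complex"
    where L: "\<And>b. b \<in> B \<Longrightarrow> bounded_clinear (L b)"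
      "\<And>b b'. b \<in> B \<Longrightarrow> b' \<in> B \<Longrightarrow> L b b' = (if b' = b then 1 else 0)"
    using insert.IH by metis
  define y where "y = x - (\<Sum>b\<in>B. L b x *\<^sub>C b)"
  have "(\<Sum>b\<in>B. L b x *\<^sub>C b) \<in> complex_vector.span B"
    by (intro complex_vector.span_sum complex_vector.span_scale complex_vector.span_base)
  then have "y \<noteq> 0" using x by (auto simp: y_def)
  then obtain j where j: "Rep_ell2 y j \<noteq> 0"
    using ell2_eqI[of y 0] by (auto simp: zero_ell2.rep_eq)
  define L' :: "'i ell2 \<Rightarrow> complex"
    where "L' = (\<lambda>\<phi>. (1 / Rep_ell2 y j) *\<^sub>C (Rep_ell2 \<phi> j - (\<Sum>b\<in>B. Rep_ell2 b j *\<^sub>C L b \<phi>)))"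
  have bL': "bounded_clinear L'"
    unfolding L'_def
    by (intro bounded_clinear_scaleC_fun bounded_clinear_minus_fun bounded_clinear_sum_fun
        bounded_clinear_Rep_ell2 L)
  have L'B: "L' b' = 0" if "b' \<in> B" for b'
  proof -
    have "(\<Sum>b\<in>B. Rep_ell2 b j *\<^sub>C L b b') = (\<Sum>b\<in>B. if b = b' then Rep_ell2 b j else 0)"
      using that by (intro sum.cong) (auto simp: L scaleC_complex_def)
    also have "\<dots> = Rep_ell2 b' j" using insert.hyps that by simp
    finally show ?thesis by (simp add: L'_def scaleC_complex_def)
  qed
  have "Rep_ell2 y j = Rep_ell2 x j - (\<Sum>b\<in>B. Rep_ell2 b j *\<^sub>C L b x)"
    by (simp add: y_def Rep_ell2_simps scaleC_complex_def mult.commute)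
  then have L'x: "L' x = 1" using j by (simp add: L'_def scaleC_complex_def)
  \<comment> \<open>The old functionals are made to vanish on \<open>x\<close>; their values on
    \<open>B\<close> are unchanged because \<open>L'\<close> is zero there.\<close>
  let ?L = "\<lambda>b. if b = x then L' else (\<lambda>\<phi>. L b \<phi> - (L b x) *\<^sub>C L' \<phi>)"
  show ?case
  proof (rule exI[of _ ?L], intro ballI conjI)
    fix b assume b: "b \<in> insert x B"
    show "bounded_clinear (?L b)"
      using b by (auto intro!: bL' bounded_clinear_minus_fun bounded_clinear_scaleC_fun L)
    fix b' assume b': "b' \<in> insert x B"
    show "?L b b' = (if b' = b then 1 else 0)"
      using b b' insert.hyps by (auto simp: L L'x L'B scaleC_complex_def)
  qed
qed auto

lemma dual_functionals_expansion:
  fixes B :: "'i ell2 set"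
  assumes fin: "finite B"
    and L: "\<And>b. b \<in> B \<Longrightarrow> bounded_clinear (L b)"
      "\<And>b b'. b \<in> B \<Longrightarrow> b' \<in> B \<Longrightarrow> L b b' = (if b' = b then 1 else (0::complex))"
    and x: "x \<in> complex_vector.span B"
  shows "x = (\<Sum>b\<in>B. L b x *\<^sub>C b)"
proof -
  from x obtain u where u: "x = (\<Sum>b\<in>B. u b *\<^sub>C b)"
    by (auto simp: complex_vector.span_finite[OF fin])
  have "L b x = u b" if "b \<in> B" for b
  proof -
    have "L b x = (\<Sum>b'\<in>B. u b' * L b b')"
      unfolding u by (simp add: bounded_clinear_sum[OF L(1)[OF that]] bounded_clinear_scaleC[OF L(1)[OF that]]
          scaleC_complex_def)
    also have "\<dots> = (\<Sum>b'\<in>B. if b' = b then u b' else 0)"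
      using that by (intro sum.cong) (auto simp: L)
    finally show ?thesis using that fin by simp
  qed
  then show ?thesis using u by simp
qed

text \<open>Continuity of \<open>g i\<close> sums
  \<open>Rep_ell2 (b i) j * g i (unit_vec_ell2 j)\<close> over \<open>j\<close> to
  \<open>g i (b i)\<close>. The infinite diagonal sum of a finite rank operator is thus its
  algebraic trace.\<close>

lemma D2_trace_finite_rank:
  fixes d :: nat
  assumes H: "\<And>\<phi>. H \<phi> = (\<Sum>i<d. g i \<phi> *\<^sub>C b i)" and g: "\<And>i. i < d \<Longrightarrow> bounded_clinear (g i)"
  shows "D2_trace H = (\<Sum>i<d. g i (b i))"
proof -
  have "((\<lambda>j. \<Sum>i<d'. Rep_ell2 (b i) j * g i (unit_vec_ell2 j)) has_sum (\<Sum>i<d'. g i (b i))) UNIV"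
    if "d' \<le> d" for d'
    using that
  proof (induction d')
    case (Suc d')
    then show ?case
      using bounded_clinear_has_sum[OF g[of d'], of "b d'"]
      by (auto simp: scaleC_complex_def intro!: has_sum_add)
  qed simp
  then show ?thesis
    unfolding D2_trace_def
    by (intro infsumI) (simp add: matrix_entry_def H Rep_ell2_simps mult.commute)
qed

text \<open>The series of the trace of log (I + A), shifted by one: index \<open>i\<close> belongs
  to the power \<open>m = Suc i\<close>, and \<open>(- 1) ^ (m + 1) = (- 1) ^ i\<close>.\<close>

definition trace_log_term :: "('i ell2 \<Rightarrow> 'i ell2) \<Rightarrow> nat \<Rightarrow> complex" where
  "trace_log_term A i = (- 1) ^ i / of_nat (Suc i) * D2_trace (A ^^ Suc i)"

definition trace_log :: "('i ell2 \<Rightarrow> 'i ell2) \<Rightarrow> complex" where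
  "trace_log A = suminf (trace_log_term A)"

text \<open>Stated for any basis of any finite dimensional space containing the range: the
  right-hand side mentions neither \<open>b\<close> nor \<open>C\<close>, and this independence
  later resolves both definite descriptions. The link is that the diagonal sum of a power of
  \<open>F\<close> is the trace of the same power of its matrix \<open>K\<close>.\<close>

lemma finite_rank_det_eq_exp_trace_log:
  fixes F :: "'i ell2 \<Rightarrow> 'i ell2"
  assumes F: "F \<in> D2" "D2_norm F < 1"
    and b: "inj_on b {..<d}" "complex_vector.independent (b ` {..<d})"
    and ran: "range F \<subseteq> complex_vector.span (b ` {..<d})"
    and C: "C \<in> carrier_mat d d" "\<And>j. j < d \<Longrightarrow> b j + F (b j) = (\<Sum>i<d. (C $$ (i, j)) *\<^sub>C b i)"
  shows "Determinant.det C = exp (trace_log F)"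
proof -
  note bF = D2_bounded_clinear[OF F(1)]
  obtain L where L: "\<And>c. c \<in> b ` {..<d} \<Longrightarrow> bounded_clinear (L c)"
      "\<And>c c'. c \<in> b ` {..<d} \<Longrightarrow> c' \<in> b ` {..<d} \<Longrightarrow> L c c' = (if c' = c then 1 else (0::complex))"
    using dual_functionals[OF _ b(2)] by (metis finite_imageI finite_lessThan)
  define l where "l i = L (b i)" for i
  have l: "bounded_clinear (l i)" if "i < d" for i using that by (simp add: l_def L)
  have lb: "l i (b j) = (if j = i then 1 else 0)" if "i < d" "j < d" for i j
    using that b(1) by (auto simp: l_def L inj_on_def)
  have exp_b: "x = (\<Sum>i<d. l i x *\<^sub>C b i)" if "x \<in> complex_vector.span (b ` {..<d})" for x
    using dual_functionals_expansion[OF _ L that] by (simp add: sum.reindex[OF b(1)] l_def o_def)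
  have l_sum: "l i (\<Sum>j<d. u j *\<^sub>C b j) = u i" if "i < d" for i u
  proof -
    have "l i (\<Sum>j<d. u j *\<^sub>C b j) = (\<Sum>j<d. u j * l i (b j))"
      by (simp add: bounded_clinear_sum[OF l[OF that]] bounded_clinear_scaleC[OF l[OF that]] scaleC_complex_def)
    also have "\<dots> = (\<Sum>j<d. if j = i then u j else 0)"
      using that by (intro sum.cong) (auto simp: lb)
    finally show ?thesis using that by simp
  qed
  define K where "K = C - 1\<^sub>m d"
  have K: "K \<in> carrier_mat d d" using C(1) by (auto simp: K_def)
  have CK: "C = 1\<^sub>m d + K" using C(1) by (auto simp: K_def)
  have FK: "F (b j) = (\<Sum>i<d. (K $$ (i, j)) *\<^sub>C b i)" if j: "j < d" for j
  proof -
    have "(\<Sum>i<d. (K $$ (i, j)) *\<^sub>C b i)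
        = (\<Sum>i<d. (C $$ (i, j)) *\<^sub>C b i) - (\<Sum>i<d. if i = j then b j else 0)"
      unfolding sum_subtractf[symmetric]
      using C(1) j by (intro sum.cong) (auto simp: K_def complex_vector.scale_left_diff_distrib scaleC_one)
    also have "\<dots> = F (b j)" using j C(2)[OF j] by (simp flip: C(2)[OF j])
    finally show ?thesis by simp
  qed
  have bFm: "bounded_clinear (F ^^ m)" for m
    by (induction m) (auto simp: id_def o_def bounded_clinear_id intro: bounded_clinear_compose[OF bF])
  have Fm: "(F ^^ m) (b j) = (\<Sum>i<d. ((K ^\<^sub>m m) $$ (i, j)) *\<^sub>C b i)" if "j < d" for m j
    using that
  proof (induction m arbitrary: j)
    case 0
    have "(\<Sum>i<d. ((K ^\<^sub>m 0) $$ (i, j)) *\<^sub>C b i) = (\<Sum>i<d. if i = j then b j else 0)"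
      using 0 K by (intro sum.cong) (auto simp: scaleC_one)
    then show ?case using 0 by simp
  next
    case (Suc m)
    have "(F ^^ Suc m) (b j) = (F ^^ m) (\<Sum>k<d. (K $$ (k, j)) *\<^sub>C b k)"
      unfolding funpow_Suc_right using Suc.prems by (simp add: FK)
    also have "\<dots> = (\<Sum>k<d. (K $$ (k, j)) *\<^sub>C (F ^^ m) (b k))"
      by (simp add: bounded_clinear_sum[OF bFm] bounded_clinear_scaleC[OF bFm])
    also have "\<dots> = (\<Sum>k<d. \<Sum>i<d. ((K ^\<^sub>m m) $$ (i, k) * K $$ (k, j)) *\<^sub>C b i)"
      by (intro sum.cong) (auto simp: Suc.IH complex_vector.scale_sum_right scaleC_scaleC mult.commute)
    also have "\<dots> = (\<Sum>i<d. \<Sum>k<d. ((K ^\<^sub>m m) $$ (i, k) * K $$ (k, j)) *\<^sub>C b i)"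
      by (rule sum.swap)
    also have "\<dots> = (\<Sum>i<d. ((K ^\<^sub>m Suc m) $$ (i, j)) *\<^sub>C b i)"
      using K Suc.prems by (intro sum.cong)
        (auto simp: scalar_prod_def complex_vector.scale_sum_left atLeast0LessThan)
    finally show ?case .
  qed
  \<comment> \<open>At least one factor \<open>F\<close> is present, so the power has its range in
    the span and can be expanded in the basis.\<close>
  have tr: "D2_trace (F ^^ Suc m) = (\<Sum>i<d. (K ^\<^sub>m Suc m) $$ (i, i))" for m
  proof -
    have "D2_trace (F ^^ Suc m) = (\<Sum>i<d. l i ((F ^^ Suc m) (b i)))"
    proof (rule D2_trace_finite_rank[where g = "\<lambda>i \<phi>. l i ((F ^^ Suc m) \<phi>)"])
      show "(F ^^ Suc m) \<phi> = (\<Sum>i<d. l i ((F ^^ Suc m) \<phi>) *\<^sub>C b i)" for \<phi>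
        by (rule exp_b) (use ran in auto)
      show "bounded_clinear (\<lambda>\<phi>. l i ((F ^^ Suc m) \<phi>))" if "i < d" for i
        by (rule bounded_clinear_compose[OF l[OF that] bFm])
    qed
    also have "\<dots> = (\<Sum>i<d. (K ^\<^sub>m Suc m) $$ (i, i))"
      by (intro sum.cong) (auto simp: Fm l_sum simp del: funpow.simps pow_mat.simps)
    finally show ?thesis .
  qed
  obtain es where es: "Determinant.det (1\<^sub>m d + K) = (\<Prod>i<d. 1 + es i)"
    "\<And>m. (\<Sum>i<d. (K ^\<^sub>m m) $$ (i, i)) = (\<Sum>i<d. es i ^ m)"
    "\<And>i. i < d \<Longrightarrow> eigenvalue K (es i)"
    by (rule complex_mat_eigenvalues[OF K], rule that)
  \<comment> \<open>An eigenvector of \<open>K\<close> gives the coordinates of an eigenvector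
    \<open>x\<close> of \<open>F\<close>, so the eigenvalue is at most the operator norm and hence
    the D_2-norm.\<close>
  have small: "cmod (es k) < 1" if k: "k < d" for k
  proof -
    from es(3)[OF k] obtain v where "eigenvector K v (es k)"
      by (auto simp: eigenvalue_def)
    then have v: "v \<in> carrier_vec d" "v \<noteq> 0\<^sub>v d" "K *\<^sub>v v = es k \<cdot>\<^sub>v v"
      using K by (auto simp: eigenvector_def)
    define x where "x = (\<Sum>j<d. vec_index v j *\<^sub>C b j)"
    have "F x = (\<Sum>j<d. \<Sum>i<d. (K $$ (i, j) * vec_index v j) *\<^sub>C b i)"
      unfolding x_def
      by (auto simp: bounded_clinear_sum[OF bF] bounded_clinear_scaleC[OF bF] FK
          complex_vector.scale_sum_right scaleC_scaleC mult.commute intro!: sum.cong)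
    also have "\<dots> = (\<Sum>i<d. \<Sum>j<d. (K $$ (i, j) * vec_index v j) *\<^sub>C b i)" by (rule sum.swap)
    also have "\<dots> = (\<Sum>i<d. vec_index (K *\<^sub>v v) i *\<^sub>C b i)"
      using K v(1) by (intro sum.cong)
        (auto simp: scalar_prod_def complex_vector.scale_sum_left atLeast0LessThan)
    also have "\<dots> = es k *\<^sub>C x"
      using v(1) by (auto simp: v(3) x_def complex_vector.scale_sum_right scaleC_scaleC intro!: sum.cong)
    finally have Fx: "F x = es k *\<^sub>C x" .
    have "x \<noteq> 0"
    proof
      assume "x = 0"
      then have "vec_index v i = 0" if "i < d" for i
        using l_sum[OF that, of "vec_index v"] bounded_clinear_0[OF l[OF that]] by (simp add: x_def)
      then have "v = 0\<^sub>v d" using v(1) by (intro eq_vecI) auto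
      with v(2) show False by simp
    qed
    moreover have "cmod (es k) * norm x \<le> D2_norm F * norm x"
      using D2_norm_bound[OF F(1), of x] by (simp add: Fx norm_scaleC)
    ultimately have "cmod (es k) \<le> D2_norm F" by simp
    with F(2) show ?thesis by simp
  qed
  \<comment> \<open>\<open>Ln_series\<close> also has a term of index 0, which is zero since
    division by 0 yields 0; hence the shift by one.\<close>
  have ser: "(\<lambda>i. (- 1) ^ i / of_nat (Suc i) * es k ^ Suc i) sums Ln (1 + es k)" if "k < d" for k
    using sums_split_initial_segment[OF Ln_series[OF small[OF that]], of 1] by simp
  have "(\<lambda>i. \<Sum>k<d. (- 1) ^ i / of_nat (Suc i) * es k ^ Suc i) sums (\<Sum>k<d. Ln (1 + es k))"
    by (rule sums_sum) (use ser in auto)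
  moreover have "trace_log_term F = (\<lambda>i. \<Sum>k<d. (- 1) ^ i / of_nat (Suc i) * es k ^ Suc i)"
    unfolding trace_log_term_def tr es(2) sum_distrib_left ..
  ultimately have "trace_log F = (\<Sum>k<d. Ln (1 + es k))"
    by (simp add: trace_log_def sums_iff)
  then have "exp (trace_log F) = (\<Prod>k<d. exp (Ln (1 + es k)))"
    by (simp add: exp_sum)
  also have "\<dots> = (\<Prod>k<d. 1 + es k)"
  proof (rule prod.cong)
    fix k assume "k \<in> {..<d}"
    then have "cmod (es k) < 1" using small by simp
    then have "1 + es k \<noteq> 0"
      by (metis add.commute add_eq_0_iff2 norm_minus_cancel norm_one less_irrefl)
    then show "exp (Ln (1 + es k)) = 1 + es k" by simp
  qed simp
  finally show ?thesis by (simp add: CK es(1))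
qed


lemma span_finite_basis:
  fixes M :: "'a::complex_normed_vector set"
  assumes "complex_vector.subspace M" "finite B" "M \<subseteq> complex_vector.span B"
  obtains B' where "finite B'" "complex_vector.independent B'" "complex_vector.span B' = M"
proof -
  obtain B' where B': "B' \<subseteq> M" "complex_vector.independent B'" "M \<subseteq> complex_vector.span B'"
    by (rule complex_vector.maximal_independent_subset)
  have "finite B'"
    using complex_vector.independent_span_bound[OF assms(2) B'(2)] B'(1) assms(3) by auto
  moreover have "complex_vector.span B' = M"
    using B' complex_vector.span_minimal[OF B'(1) assms(1)] by auto
  ultimately show ?thesis using that B' by blast
qed

text \<open>The basis drops out by \<open>finite_rank_det_eq_exp_trace_log\<close>, which settles
  uniqueness; for existence any basis of \<open>M\<close> serves, its matrix \<open>C\<close> being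
  read off by dual functionals.\<close>

lemma endo_det_eq_exp_trace_log:
  fixes F :: "'i ell2 \<Rightarrow> 'i ell2"
  assumes F: "F \<in> D2" "D2_norm F < 1"
    and M: "complex_vector.subspace M" "finite B0" "M = complex_vector.span B0"
    and ran: "range F \<subseteq> M"
  shows "endo_det M (\<lambda>x. x + F x) = exp (trace_log F)"
  unfolding endo_det_def
proof (rule the_equality)
  obtain B where B: "finite B" "complex_vector.independent B" "complex_vector.span B = M"
    by (rule span_finite_basis[OF M(1,2)]) (use M(3) in auto)
  obtain h where h: "bij_betw h {0..<card B} B"
    using ex_bij_betw_nat_finite[OF B(1)] by auto
  let ?d = "card B"
  have hB: "h ` {..<?d} = B" "inj_on h {..<?d}"
    using h by (auto simp: bij_betw_def atLeast0LessThan)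
  obtain L where L: "\<And>c. c \<in> B \<Longrightarrow> bounded_clinear (L c)"
      "\<And>c c'. c \<in> B \<Longrightarrow> c' \<in> B \<Longrightarrow> L c c' = (if c' = c then 1 else (0::complex))"
    using dual_functionals[OF B(1,2)] by metis
  define C where "C = mat ?d ?d (\<lambda>(i, j). L (h i) (h j + F (h j)))"
  have C: "C \<in> carrier_mat ?d ?d" by (simp add: C_def)
  have exp_B: "x = (\<Sum>i<?d. L (h i) x *\<^sub>C h i)" if "x \<in> M" for x
  proof -
    have "x = (\<Sum>b\<in>B. L b x *\<^sub>C b)"
      using that by (intro dual_functionals_expansion[OF B(1) L]) (auto simp: B(3))
    also have "\<dots> = (\<Sum>i<?d. L (h i) x *\<^sub>C h i)"
      using sum.reindex[OF hB(2), of "\<lambda>b. L b x *\<^sub>C b"] by (simp add: hB(1))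
    finally show ?thesis .
  qed
  have G: "h j + F (h j) = (\<Sum>i<?d. (C $$ (i, j)) *\<^sub>C h i)" if j: "j < ?d" for j
  proof -
    have "h j \<in> M" using j hB(1) complex_vector.span_superset[of B] by (auto simp: B(3))
    then have "h j + F (h j) \<in> M"
      using ran by (intro complex_vector.subspace_add[OF M(1)]) auto
    from exp_B[OF this] j show ?thesis by (simp add: C_def)
  qed
  have "Determinant.det C = exp (trace_log F)"
    by (rule finite_rank_det_eq_exp_trace_log[OF F hB(2) _ _ C G]) (use hB B ran in auto)
  then show "\<exists>d b C. inj_on b {..<d} \<and> complex_vector.independent (b ` {..<d}) \<and>
     complex_vector.span (b ` {..<d}) = M \<and> C \<in> carrier_mat d d \<and>
     (\<forall>j<d. b j + F (b j) = (\<Sum>i<d. (C $$ (i, j)) *\<^sub>C b i)) \<and>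
     exp (trace_log F) = Determinant.det C"
    using hB B C G by (intro exI[of _ ?d] exI[of _ h] exI[of _ C]) simp
next
  fix c
  assume "\<exists>d b C. inj_on b {..<d} \<and> complex_vector.independent (b ` {..<d}) \<and>
     complex_vector.span (b ` {..<d}) = M \<and> C \<in> carrier_mat d d \<and>
     (\<forall>j<d. b j + F (b j) = (\<Sum>i<d. (C $$ (i, j)) *\<^sub>C b i)) \<and> c = Determinant.det C"
  then obtain d b C where b: "inj_on b {..<d}" "complex_vector.independent (b ` {..<d})"
     "complex_vector.span (b ` {..<d}) = M" "C \<in> carrier_mat d d"
     "\<And>j. j < d \<Longrightarrow> b j + F (b j) = (\<Sum>i<d. (C $$ (i, j)) *\<^sub>C b i)" "c = Determinant.det C"
    by auto
  show "c = exp (trace_log F)"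
    unfolding b(6) by (rule finite_rank_det_eq_exp_trace_log[OF F b(1,2) _ b(4,5)]) (use b(3) ran in auto)
qed

text \<open>\<open>M\<close> is spanned by a basis \<open>R\<close> of the range and by preimages of
  \<open>R\<close>, so it is invariant and together with the kernel \<open>Z\<close> spans
  everything. As \<open>M\<close> may meet \<open>Z\<close>, the complement \<open>N\<close> is only
  the part of \<open>Z\<close> killed by a projection \<open>P\<close> onto
  \<open>M \<inter> Z\<close>.\<close>

lemma finite_rank_decomposition:
  fixes F :: "'i ell2 \<Rightarrow> 'i ell2"
  assumes F: "bounded_clinear F" "finite_rank F"
  obtains M N B where "complex_vector.subspace M" "finite B" "M = complex_vector.span B"
    "complex_vector.subspace N" "M \<inter> N = {0}" "\<And>x. \<exists>u\<in>M. \<exists>v\<in>N. x = u + v"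
    "range F \<subseteq> M" "\<And>x. x \<in> N \<Longrightarrow> F x = 0"
proof -
  obtain B0 where B0: "finite B0" "range F \<subseteq> complex_vector.span B0"
    using F(2) by (auto simp: finite_rank_def)
  have subR: "complex_vector.subspace (range F)"
    by (rule complex_vector.subspaceI)
      (auto simp: bounded_clinear_add[OF F(1), symmetric] bounded_clinear_scaleC[OF F(1), symmetric]
        intro: range_eqI[of _ _ 0] simp: bounded_clinear_0[OF F(1)])
  obtain R where R: "finite R" "complex_vector.independent R" "complex_vector.span R = range F"
    by (rule span_finite_basis[OF subR B0])
  obtain L where L: "\<And>c. c \<in> R \<Longrightarrow> bounded_clinear (L c)"
      "\<And>c c'. c \<in> R \<Longrightarrow> c' \<in> R \<Longrightarrow> L c c' = (if c' = c then 1 else (0::complex))"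
    using dual_functionals[OF R(1,2)] by metis
  have "\<forall>r\<in>R. \<exists>x. F x = r" using R(3) complex_vector.span_superset[of R] by auto
  then obtain p where p: "\<And>r. r \<in> R \<Longrightarrow> F (p r) = r" by metis
  define B where "B = R \<union> p ` R"
  define M where "M = complex_vector.span B"
  have finB: "finite B" using R(1) by (simp add: B_def)
  have subM: "complex_vector.subspace M" by (simp add: M_def)
  define Z where "Z = {x. F x = 0}"
  have subZ: "complex_vector.subspace Z"
    by (rule complex_vector.subspaceI)
      (auto simp: Z_def bounded_clinear_add[OF F(1)] bounded_clinear_scaleC[OF F(1)] bounded_clinear_0[OF F(1)])
  have MZ: "\<exists>u\<in>M. \<exists>v\<in>Z. x = u + v" for x
  proof -
    let ?u = "\<Sum>r\<in>R. L r (F x) *\<^sub>C p r"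
    have "F x = (\<Sum>r\<in>R. L r (F x) *\<^sub>C r)"
      by (rule dual_functionals_expansion[OF R(1) L]) (auto simp: R(3))
    also have "\<dots> = F ?u"
      by (simp add: bounded_clinear_sum[OF F(1)] bounded_clinear_scaleC[OF F(1)] p)
    finally have "x - ?u \<in> Z" by (simp add: Z_def bounded_clinear_diff[OF F(1)])
    moreover have "?u \<in> M"
      unfolding M_def B_def by (intro complex_vector.span_sum complex_vector.span_scale complex_vector.span_base) auto
    ultimately show ?thesis by (intro bexI[of _ ?u] bexI[of _ "x - ?u"]) auto
  qed
  have subMZ: "complex_vector.subspace (M \<inter> Z)" by (rule complex_vector.subspace_inter[OF subM subZ])
  obtain Q where Q: "finite Q" "complex_vector.independent Q" "complex_vector.span Q = M \<inter> Z"
    by (rule span_finite_basis[OF subMZ finB]) (auto simp: M_def)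
  obtain K where K: "\<And>c. c \<in> Q \<Longrightarrow> bounded_clinear (K c)"
      "\<And>c c'. c \<in> Q \<Longrightarrow> c' \<in> Q \<Longrightarrow> K c c' = (if c' = c then 1 else (0::complex))"
    using dual_functionals[OF Q(1,2)] by metis
  define P where "P x = (\<Sum>q\<in>Q. K q x *\<^sub>C q)" for x
  have Pin: "P x \<in> M \<inter> Z" for x
    unfolding P_def Q(3)[symmetric] by (intro complex_vector.span_sum complex_vector.span_scale complex_vector.span_base)
  have Pid: "P x = x" if "x \<in> M \<inter> Z" for x
    using dual_functionals_expansion[OF Q(1) K, of x] that by (simp add: Q(3) P_def)
  have Padd: "P (x + y) = P x + P y" for x y
    by (simp add: P_def bounded_clinear_add[OF K(1)] complex_vector.scale_left_distrib sum.distrib)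
  have Pscale: "P (c *\<^sub>C x) = c *\<^sub>C P x" for c x
    by (simp add: P_def bounded_clinear_scaleC[OF K(1)] scaleC_complex_def complex_vector.scale_sum_right scaleC_scaleC)
  have P0: "P 0 = 0" by (simp add: P_def bounded_clinear_0[OF K(1)])
  have Pdiff: "P (x - y) = P x - P y" for x y
    using Padd[of "x - y" y] by (simp add: algebra_simps)
  define N where "N = {x \<in> Z. P x = 0}"
  have subN: "complex_vector.subspace N"
    using subZ unfolding N_def complex_vector.subspace_def by (auto simp: Padd Pscale P0)
  have MN: "M \<inter> N = {0}"
    using Pid complex_vector.subspace_0[OF subM] complex_vector.subspace_0[OF subN] by (auto simp: N_def)
  have all: "\<exists>u\<in>M. \<exists>v\<in>N. x = u + v" for x
  proof -
    obtain u v where uv: "u \<in> M" "v \<in> Z" "x = u + v" using MZ by blast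
    \<comment> \<open>\<open>P v\<close> lies in both \<open>M\<close> and \<open>Z\<close>; moving
      it into the first summand leaves a remainder killed by \<open>P\<close>.\<close>
    have "v - P v \<in> N"
      using complex_vector.subspace_diff[OF subZ uv(2)] Pin[of v] Pid[OF Pin[of v]] by (auto simp: N_def Pdiff)
    moreover have "u + P v \<in> M" using complex_vector.subspace_add[OF subM uv(1)] Pin[of v] by auto
    ultimately show ?thesis using uv(3) by (intro bexI[of _ "u + P v"] bexI[of _ "v - P v"]) auto
  qed
  have ran: "range F \<subseteq> M"
    unfolding R(3)[symmetric] M_def B_def by (rule complex_vector.span_mono) auto
  have N0: "F x = 0" if "x \<in> N" for x using that by (simp add: N_def Z_def)
  show ?thesis by (rule that[OF subM finB M_def subN MN all ran N0])
qed

text \<open>In any admissible decomposition \<open>M\<close> contains the range of \<open>F\<close>,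
  because \<open>F\<close> kills \<open>N\<close> and maps \<open>M\<close> into itself. So every
  choice leads to the value of \<open>endo_det_eq_exp_trace_log\<close>.\<close>

lemma fr_det_eq_exp_trace_log:
  fixes F :: "'i ell2 \<Rightarrow> 'i ell2"
  assumes F: "F \<in> D2" "D2_norm F < 1" "finite_rank F"
  shows "fr_det F = exp (trace_log F)"
  unfolding fr_det_def
proof (rule the_equality)
  note bF = D2_bounded_clinear[OF F(1)]
  obtain M N B where MN: "complex_vector.subspace M" "finite B" "M = complex_vector.span B"
    "complex_vector.subspace N" "M \<inter> N = {0}" "\<And>x. \<exists>u\<in>M. \<exists>v\<in>N. x = u + v"
    "range F \<subseteq> M" "\<And>x. x \<in> N \<Longrightarrow> F x = 0"
    by (rule finite_rank_decomposition[OF bF F(3)], rule that)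
  show "\<exists>M N. complex_vector.subspace M \<and> (\<exists>B. finite B \<and> M = complex_vector.span B) \<and>
     complex_vector.subspace N \<and> M \<inter> N = {0} \<and> (\<forall>x. \<exists>u\<in>M. \<exists>v\<in>N. x = u + v) \<and>
     F ` M \<subseteq> M \<and> (\<forall>x\<in>N. F x = 0) \<and> exp (trace_log F) = endo_det M (\<lambda>x. x + F x)"
    by (rule exI[of _ M], rule exI[of _ N])
      (use MN endo_det_eq_exp_trace_log[OF F(1,2) MN(1,2,3,7)] in auto)
next
  note bF = D2_bounded_clinear[OF F(1)]
  fix c
  assume "\<exists>M N. complex_vector.subspace M \<and> (\<exists>B. finite B \<and> M = complex_vector.span B) \<and>
     complex_vector.subspace N \<and> M \<inter> N = {0} \<and> (\<forall>x. \<exists>u\<in>M. \<exists>v\<in>N. x = u + v) \<and>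
     F ` M \<subseteq> M \<and> (\<forall>x\<in>N. F x = 0) \<and> c = endo_det M (\<lambda>x. x + F x)"
  then obtain M N B where MN: "complex_vector.subspace M" "finite B" "M = complex_vector.span B"
    "\<And>x. \<exists>u\<in>M. \<exists>v\<in>N. x = u + v" "F ` M \<subseteq> M" "\<And>x. x \<in> N \<Longrightarrow> F x = 0"
    "c = endo_det M (\<lambda>x. x + F x)"
    by blast
  have "F x \<in> M" for x
  proof -
    obtain u v where "u \<in> M" "v \<in> N" "x = u + v" using MN(4) by blast
    then show ?thesis using MN(5,6) by (auto simp: bounded_clinear_add[OF bF])
  qed
  then have "range F \<subseteq> M" by auto
  with endo_det_eq_exp_trace_log[OF F(1,2) MN(1,2,3)] MN(7) show "c = exp (trace_log F)" by simp
qed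


section \<open>Passage to the limit in the \<open>D2\<close> norm\<close>

section \<open>The Poincare determinant near the identity\<close>

lemma trace_log_term_bound:
  assumes A: "A \<in> D2" "D2_norm A \<le> r"
  shows "cmod (trace_log_term A i) \<le> r ^ Suc i"
proof -
  have r: "0 \<le> r" using A(2) D2_norm_nonneg[of A] by linarith
  have "cmod (trace_log_term A i) = cmod (D2_trace (A ^^ Suc i)) / real (Suc i)"
    by (simp add: trace_log_term_def norm_mult norm_divide norm_power del: of_nat_Suc funpow.simps)
  also have "\<dots> \<le> r ^ Suc i / real (Suc i)"
    by (intro divide_right_mono order_trans[OF D2_trace_bound D2_norm_funpow] D2_funpow A) auto
  also have "\<dots> \<le> r ^ Suc i / 1"
    by (rule divide_left_mono) (use r in auto)
  finally show ?thesis by simp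
qed

lemma trace_log_sums:
  assumes A: "A \<in> D2" "D2_norm A < 1"
  shows "trace_log_term A sums trace_log A"
  unfolding trace_log_def
proof (rule summable_sums, rule summable_comparison_test')
  show "summable (\<lambda>i. D2_norm A ^ Suc i)"
    using A(2) D2_norm_nonneg[of A] by (simp add: summable_geometric summable_mult)
  show "cmod (trace_log_term A i) \<le> D2_norm A ^ Suc i" for i
    by (rule trace_log_term_bound[OF A(1)]) simp
qed

text \<open>The denominator \<open>Suc i\<close> of each term cancels against the factor in
  \<open>D2_norm_funpow_diff\<close>, leaving a geometric series in \<open>r\<close>.\<close>

lemma trace_log_lipschitz:
  assumes A: "A \<in> D2" "D2_norm A \<le> r" and B: "B \<in> D2" "D2_norm B \<le> r" and r: "r < 1"
  shows "cmod (trace_log A - trace_log B) \<le> D2_norm (\<lambda>x. A x - B x) / (1 - r)"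
proof -
  let ?d = "D2_norm (\<lambda>x. A x - B x)"
  have r0: "0 \<le> r" using A(2) D2_norm_nonneg[of A] by linarith
  have s: "(\<lambda>i. trace_log_term A i - trace_log_term B i) sums (trace_log A - trace_log B)"
    by (intro sums_diff trace_log_sums) (use assms in auto)
  have g: "(\<lambda>i. r ^ i * ?d) sums (1 / (1 - r) * ?d)"
    by (intro sums_mult2 geometric_sums) (use r r0 in simp)
  have "cmod (trace_log_term A i - trace_log_term B i) \<le> r ^ i * ?d" for i
  proof -
    note Ai = D2_funpow[OF A(1), of i] and Bi = D2_funpow[OF B(1), of i]
    have "trace_log_term A i - trace_log_term B i
        = (- 1) ^ i / of_nat (Suc i) * D2_trace (\<lambda>x. (A ^^ Suc i) x - (B ^^ Suc i) x)"
      unfolding D2_trace_minus[OF Ai Bi] trace_log_term_def by (simp add: right_diff_distrib del: funpow.simps of_nat_Suc)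
    then have "cmod (trace_log_term A i - trace_log_term B i)
        = cmod (D2_trace (\<lambda>x. (A ^^ Suc i) x - (B ^^ Suc i) x)) / real (Suc i)"
      by (simp add: norm_mult norm_divide norm_power del: of_nat_Suc funpow.simps)
    also have "\<dots> \<le> (real (Suc i) * r ^ i * ?d) / real (Suc i)"
      by (intro divide_right_mono order_trans[OF D2_trace_bound[OF D2_minus(1)[OF Ai Bi]]]
          D2_norm_funpow_diff A B) auto
    finally show ?thesis by (simp del: of_nat_Suc)
  qed
  from norm_sums_le[OF s g this] show ?thesis by simp
qed

text \<open>Keep finitely many matrix entries: the error is the tail of the absolute sum, and the
  range is spanned by the unit vectors of the rows that occur.\<close>

lemma finite_rank_approx:
  fixes A :: "'i ell2 \<Rightarrow> 'i ell2"
  assumes A: "A \<in> D2" and e: "0 < e"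
  obtains F where "F \<in> D2" "finite_rank F" "D2_norm (\<lambda>x. F x - A x) < e"
proof -
  let ?a = "\<lambda>(j, k). matrix_entry A j k"
  note a = D2_summable[OF A]
  \<comment> \<open>The approximation of the sum is only up to \<le>, while a strict bound by
    \<open>e\<close> is wanted; hence \<open>e / 2\<close>.\<close>
  obtain S where S: "finite S" "dist (\<Sum>z\<in>S. cmod (?a z)) (\<Sum>\<^sub>\<infinity>z. cmod (?a z)) \<le> e / 2"
    using infsum_finite_approximation[OF a, of "e / 2"] e by auto
  define f where "f j k = (if (j, k) \<in> S then matrix_entry A j k else 0)" for j k
  have f: "(\<lambda>(j, k). f j k) abs_summable_on UNIV"
    by (rule finite_nonzero_values_imp_summable_on, rule finite_subset[OF _ S(1)]) (auto simp: f_def split: if_splits)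
  let ?F = "mat_op f"
  have FD: "?F \<in> D2" by (rule mat_op_in_D2[OF f])
  note cf = abs_summable_imp_col_ell2[OF f]
  have "finite_rank ?F"
    unfolding finite_rank_def
  proof (intro exI[of _ "unit_vec_ell2 ` fst ` S"] conjI)
    show "finite (unit_vec_ell2 ` fst ` S)" using S(1) by simp
    have "?F \<phi> = (\<Sum>j\<in>fst ` S. Rep_ell2 (?F \<phi>) j *\<^sub>C unit_vec_ell2 j)" for \<phi>
    proof (rule ell2_eqI)
      fix i
      have "Rep_ell2 (?F \<phi>) i = 0" if "i \<notin> fst ` S"
      proof -
        have "f i k = 0" for k using that by (force simp: f_def)
        then show ?thesis by (simp add: Rep_mat_op[OF cf])
      qed
      moreover have "Rep_ell2 (\<Sum>j\<in>fst ` S. Rep_ell2 (?F \<phi>) j *\<^sub>C unit_vec_ell2 j) i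
          = (\<Sum>j\<in>fst ` S. if j = i then Rep_ell2 (?F \<phi>) i else 0)"
        by (auto simp: Rep_ell2_simps Rep_unit_vec_ell2 intro!: sum.cong)
      ultimately show "Rep_ell2 (?F \<phi>) i = Rep_ell2 (\<Sum>j\<in>fst ` S. Rep_ell2 (?F \<phi>) j *\<^sub>C unit_vec_ell2 j) i"
        using S(1) by simp
    qed
    moreover have "(\<Sum>j\<in>fst ` S. Rep_ell2 (?F \<phi>) j *\<^sub>C unit_vec_ell2 j)
        \<in> complex_vector.span (unit_vec_ell2 ` fst ` S)" for \<phi>
      by (intro complex_vector.span_sum complex_vector.span_scale complex_vector.span_base) auto
    ultimately show "range ?F \<subseteq> complex_vector.span (unit_vec_ell2 ` fst ` S)"
      by (metis image_subsetI)
  qed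
  moreover have "D2_norm (\<lambda>x. ?F x - A x) < e"
  proof -
    have "D2_norm (\<lambda>x. ?F x - A x) = infsum (\<lambda>z. cmod (?a z)) (UNIV - S)"
      unfolding D2_norm_eq
      by (rule infsum_cong_neutral) (auto simp: matrix_entry_minus matrix_entry_mat_op[OF cf] f_def split: if_splits)
    also have "\<dots> = (\<Sum>\<^sub>\<infinity>z. cmod (?a z)) - (\<Sum>z\<in>S. cmod (?a z))"
      using infsum_Diff[OF a, of S] S(1) by simp
    finally show ?thesis using S(2) e unfolding dist_real_def by linarith
  qed
  ultimately show ?thesis using FD that by blast
qed

text \<open>Limits are unique only along a proper filter, so this is where the density of the finite
  rank operators enters the definition of \<open>D2_det\<close>.\<close>

lemma finite_rank_nhds_not_bot:
  assumes "A \<in> D2"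
  shows "finite_rank_nhds A \<noteq> bot"
proof -
  have *: "\<not> eventually (\<lambda>_. False) (finite_rank_nhds A)"
    unfolding finite_rank_nhds_def
  proof (subst eventually_INF_base)
    show "\<exists>x\<in>{0<..}. principal {F \<in> D2. finite_rank F \<and> D2_norm (\<lambda>y. F y - A y) < x}
        \<le> inf (principal {F \<in> D2. finite_rank F \<and> D2_norm (\<lambda>y. F y - A y) < a})
          (principal {F \<in> D2. finite_rank F \<and> D2_norm (\<lambda>y. F y - A y) < b})"
      if "a \<in> {0<..}" "b \<in> {0<..}" for a b :: real
      using that by (intro bexI[of _ "min a b"]) auto
    show "\<not> (\<exists>e\<in>{0<..}. \<forall>\<^sub>F x in principal {F \<in> D2. finite_rank F \<and> D2_norm (\<lambda>y. F y - A y) < e}. False)"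
    proof
      assume "\<exists>e\<in>{0<..}. \<forall>\<^sub>F x in principal {F \<in> D2. finite_rank F \<and> D2_norm (\<lambda>y. F y - A y) < e}. False"
      then obtain e where "e > 0" "\<And>F. F \<in> D2 \<Longrightarrow> finite_rank F \<Longrightarrow> \<not> D2_norm (\<lambda>y. F y - A y) < e"
        by (auto simp: eventually_principal)
      with finite_rank_approx[OF assms, of e] show False by blast
    qed
  qed auto
  then show ?thesis by (metis eventually_bot)
qed

lemma D2_det_eq_exp_trace_log:
  assumes A: "A \<in> D2" "D2_norm A < 1"
  shows "D2_det A = exp (trace_log A)"
proof -
  \<comment> \<open>Halfway between the norm of \<open>A\<close> and 1: operators near
    \<open>A\<close> stay below \<open>r\<close>, which gives a common Lipschitz constant.\<close>
  define r where "r = (1 + D2_norm A) / 2"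
  have r: "D2_norm A < r" "r < 1" using A(2) by (auto simp: r_def)
  have tri: "D2_norm F \<le> D2_norm (\<lambda>x. F x - A x) + D2_norm A" if "F \<in> D2" for F
  proof -
    \<comment> \<open>Written so that the estimates for differences and scalar multiples yield the
      triangle inequality.\<close>
    have "F = (\<lambda>x. (F x - A x) - (- 1) *\<^sub>C A x)"
      by (simp add: complex_vector.scale_minus_left scaleC_one)
    then show ?thesis
      using D2_minus(2)[OF D2_minus(1)[OF that A(1)] D2_scaleC(1)[OF A(1), of "- 1"]]
        D2_scaleC(2)[OF A(1), of "- 1"] by simp
  qed
  have ev: "eventually (\<lambda>F. F \<in> D2 \<and> finite_rank F \<and> D2_norm (\<lambda>x. F x - A x) < e) (finite_rank_nhds A)"
    if "e > 0" for e
    unfolding finite_rank_nhds_def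
    by (rule eventually_INF1[of e]) (use that in \<open>auto simp: eventually_principal\<close>)
  have "(trace_log \<longlongrightarrow> trace_log A) (finite_rank_nhds A)"
  proof (rule tendstoI)
    fix e :: real assume e: "e > 0"
    \<comment> \<open>The first entry keeps \<open>D2_norm F\<close> below \<open>r\<close>; the
      second makes the Lipschitz bound smaller than \<open>e\<close>.\<close>
    let ?e = "min (r - D2_norm A) (e * (1 - r))"
    have "?e > 0" using r e by simp
    from ev[OF this] show "\<forall>\<^sub>F F in finite_rank_nhds A. dist (trace_log F) (trace_log A) < e"
    proof eventually_elim
      case (elim F)
      have "D2_norm F \<le> r" using tri[of F] elim by simp
      then have "cmod (trace_log F - trace_log A) \<le> D2_norm (\<lambda>x. F x - A x) / (1 - r)"
        using elim r by (intro trace_log_lipschitz A) auto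
      also have "\<dots> < e" using elim r by (simp add: divide_less_eq)
      finally show ?case by (simp add: dist_norm)
    qed
  qed
  then have "((\<lambda>F. exp (trace_log F)) \<longlongrightarrow> exp (trace_log A)) (finite_rank_nhds A)"
    by (rule tendsto_exp)
  moreover have "0 < 1 - D2_norm A" using A(2) by simp
  from ev[OF this] have "\<forall>\<^sub>F F in finite_rank_nhds A. exp (trace_log F) = fr_det F"
  proof eventually_elim
    case (elim F)
    then have "D2_norm F < 1" using tri[of F] by simp
    with elim fr_det_eq_exp_trace_log[of F] show ?case using A(2) by simp
  qed
  ultimately have "(fr_det \<longlongrightarrow> exp (trace_log A)) (finite_rank_nhds A)"
    by (rule Lim_transform_eventually)
  then show ?thesis
    unfolding D2_det_def by (rule tendsto_Lim[OF finite_rank_nhds_not_bot[OF A(1)]])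
qed


section \<open>Fourier coefficients of continuous and smooth functions\<close>

section \<open>Integration over the unit cube\<close>

lemmas cart_eq = Finite_Cartesian_Product.vec_eq_iff

lemma One_cart [simp]: "(One :: real^'n) $ i = 1"
  by (simp add: cart_eq_inner_axis)

lemma sum_Basis_cart [simp]: "(\<Sum>b\<in>Basis. (b :: real^'n) $ i) = 1"
  using One_cart[of i] by simp

lemma mem_cube_iff: "x \<in> cbox 0 (One :: real^'n) \<longleftrightarrow> (\<forall>i. 0 \<le> x $ i \<and> x $ i \<le> 1)"
  by (simp add: mem_box_cart One_cart)

lemma emeasure_cube: "emeasure (cube_measure :: (real^'n) measure) (cbox 0 One) = 1"
  by (simp add: emeasure_restrict_space emeasure_lborel_cbox_eq)

lemma measure_cube: "measure (cube_measure :: (real^'n) measure) (cbox 0 One) = 1"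
  by (simp add: Sigma_Algebra.measure_def emeasure_cube)

lemma finite_measure_cube: "finite_measure (cube_measure :: (real^'n) measure)"
  by (rule finite_measureI) (simp add: emeasure_cube)

lemma integrable_cube_const: "integrable (cube_measure :: (real^'n) measure) (\<lambda>_. c :: real)"
  by (rule finite_measure.integrable_const[OF finite_measure_cube])

lemma integrable_cube_continuous:
  fixes f :: "real^'n \<Rightarrow> complex"
  assumes "continuous_on UNIV f"
  shows "integrable cube_measure f"
  by (rule continuous_imp_integrable[OF continuous_on_subset[OF assms]]) simp

lemma integral_cube_continuous:
  fixes f :: "real^'n \<Rightarrow> complex"
  assumes "continuous_on UNIV f"
  shows "(LINT x|cube_measure. f x) = integral (cbox 0 One) f"
  by (rule lebesgue_integral_eq_integral[OF integrable_cube_continuous[OF assms]]) simp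

lemma real_vec_nth [simp]: "real_vec k $ i = real_of_int (k $ i)"
  by (simp add: real_vec_def)

lemma real_vec_add: "real_vec (k + l) = real_vec k + real_vec l"
  and real_vec_uminus: "real_vec (- k) = - real_vec k"
  and real_vec_0: "real_vec 0 = 0"
  by (simp_all add: cart_eq)

lemma real_vec_axis: "real_vec (axis i 1) = axis i 1"
  by (simp add: cart_eq axis_def)

text \<open>The translated cube is cut where coordinate \<open>i\<close> equals 1; periodicity moves
  the protruding slab back into the gap between 0 and \<open>t\<close>.\<close>

lemma integral_cube_translate:
  fixes g :: "real^'n \<Rightarrow> complex"
  assumes g: "continuous_on UNIV g" and per: "\<And>x. g (x + axis i 1) = g x"
    and t: "0 \<le> t" "t \<le> 1"
  shows "integral (cbox 0 One) (\<lambda>x. g (x + t *\<^sub>R axis i 1)) = integral (cbox 0 One) g"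
proof -
  let ?c = "t *\<^sub>R axis i (1::real)" and ?b = "One - (1 - t) *\<^sub>R axis i (1::real)"
  have ci: "continuous_on S g" for S using g by (rule continuous_on_subset) simp
  have basis: "axis i (1::real) \<in> Basis" by simp
  have nth: "axis i (1::real) $ j = (if j = i then 1 else 0)" for j by (simp add: axis_def)
  have "integral (cbox 0 One) (\<lambda>x. g (x + ?c)) = integral (cbox ?c (One + ?c)) g"
    using integral_shift_cbox[of ?c ?c "One + ?c" g] by simp
  also have "\<dots> = integral (cbox ?c (One + ?c) \<inter> {x. x \<bullet> axis i 1 \<le> 1}) g
      + integral (cbox ?c (One + ?c) \<inter> {x. x \<bullet> axis i 1 \<ge> 1}) g"
    by (rule integral_split[OF integrable_continuous[OF ci] basis])
  also have "cbox ?c (One + ?c) \<inter> {x. x \<bullet> axis i 1 \<le> 1} = cbox 0 One \<inter> {x. x \<bullet> axis i 1 \<ge> t}"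
    using t unfolding inner_axis inner_real_def mult_1_right interval_split_cart[unfolded interval_cbox_cart]
    by (intro arg_cong2[where f = cbox]) (simp_all add: cart_eq nth)
  also have "cbox ?c (One + ?c) \<inter> {x. x \<bullet> axis i 1 \<ge> 1} = cbox (axis i 1) (?b + axis i 1)"
    using t unfolding inner_axis inner_real_def mult_1_right interval_split_cart[unfolded interval_cbox_cart]
    by (intro arg_cong2[where f = cbox]) (simp_all add: cart_eq nth)
  also have "integral (cbox (axis i 1) (?b + axis i 1)) g = integral (cbox 0 ?b) (\<lambda>x. g (x + axis i 1))"
    using integral_shift_cbox[of "axis i 1" "axis i 1" "?b + axis i 1" g] by simp
  also have "\<dots> = integral (cbox 0 ?b) g" by (simp add: per)
  also have "cbox 0 ?b = cbox 0 One \<inter> {x. x \<bullet> axis i 1 \<le> t}"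
    using t unfolding inner_axis inner_real_def mult_1_right interval_split_cart[unfolded interval_cbox_cart]
    by (intro arg_cong2[where f = cbox]) (simp_all add: cart_eq nth)
  also have "integral (cbox 0 One \<inter> {x. x \<bullet> axis i 1 \<ge> t}) g
      + integral (cbox 0 One \<inter> {x. x \<bullet> axis i 1 \<le> t}) g = integral (cbox 0 One) g"
    using integral_split[OF integrable_continuous[OF ci] basis, of 0 One t] by simp
  finally show ?thesis .
qed


section \<open>Exponentials on the torus\<close>

definition torus_exp :: "int^'n \<Rightarrow> real^'n \<Rightarrow> complex" where
  "torus_exp k x = exp (2 * pi * \<i> * (x \<bullet> real_vec k))"

lemma torus_exp_cis: "torus_exp k x = cis (2 * pi * (x \<bullet> real_vec k))"
  by (simp add: torus_exp_def cis_conv_exp mult_ac)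

lemma norm_torus_exp [simp]: "cmod (torus_exp k x) = 1"
  by (simp add: torus_exp_cis)

lemma torus_exp_0 [simp]: "torus_exp 0 x = 1"
  by (simp add: torus_exp_def real_vec_0)

lemma torus_exp_add: "torus_exp (k + l) x = torus_exp k x * torus_exp l x"
  by (simp add: torus_exp_cis real_vec_add inner_add_right distrib_left cis_mult)

lemma torus_exp_minus: "torus_exp (- k) x = cnj (torus_exp k x)"
  by (simp add: torus_exp_cis real_vec_uminus cis_cnj)

lemma continuous_on_torus_exp [continuous_intros]: "continuous_on S (torus_exp k)"
  unfolding torus_exp_def by (intro continuous_intros)

lemma torus_exp_translate:
  "torus_exp k (x + t *\<^sub>R axis i 1) = cis (2 * pi * t * real_of_int (k $ i)) * torus_exp k x"
  by (simp add: torus_exp_cis inner_add_left inner_axis' cis_mult algebra_simps)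

lemma torus_exp_periodic: "torus_exp k (x + real_vec m) = torus_exp k x"
proof -
  have "real_vec m \<bullet> real_vec k = real_of_int (\<Sum>i\<in>UNIV. m $ i * k $ i)"
    by (simp add: inner_vec_def)
  then have "cis (2 * pi * (real_vec m \<bullet> real_vec k)) = 1"
    by (metis cis_multiple_2pi Ints_of_int mult.commute mult.left_commute)
  then show ?thesis
    by (simp add: torus_exp_cis inner_add_left distrib_left flip: cis_mult)
qed

lemma torus_exp_periodic_axis: "torus_exp k (x + axis i 1) = torus_exp k x"
  using torus_exp_periodic[of k x "axis i 1"] by (simp add: real_vec_axis)

lemma torus_ft_eq: "torus_ft f k = (LINT x|cube_measure. torus_exp (- k) x * f x)"
  by (simp add: torus_ft_def torus_exp_def real_vec_uminus)

lemma torus_ft_continuous: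
  assumes "continuous_on UNIV f"
  shows "torus_ft f k = integral (cbox 0 One) (\<lambda>x. torus_exp (- k) x * f x)"
  unfolding torus_ft_eq
  by (rule integral_cube_continuous) (intro continuous_intros assms)

text \<open>Translation by half a period \<open>?t\<close>, in a coordinate with
  \<open>k $ i \<noteq> 0\<close>, preserves the integral but changes the sign of the integrand. The
  half period is at most 1 since \<open>k $ i\<close> is an integer.\<close>

lemma integral_torus_exp: "(LINT x|cube_measure. torus_exp k x) = (if k = 0 then 1 else 0)"
proof (cases "k = 0")
  case True
  then show ?thesis by (simp add: measure_cube)
next
  case False
  then obtain i where i: "k $ i \<noteq> 0" by (auto simp: cart_eq)
  let ?t = "1 / (2 * \<bar>real_of_int (k $ i)\<bar>)"
  have "1 \<le> \<bar>k $ i\<bar>" using i by linarith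
  then have k1: "1 \<le> \<bar>real_of_int (k $ i)\<bar>" by linarith
  then have t: "0 \<le> ?t" "?t \<le> 1" by (auto simp: divide_le_eq)
  have c: "cis (2 * pi * ?t * real_of_int (k $ i)) = - 1"
  proof (cases "k $ i > 0")
    case True
    then have "2 * pi * ?t * real_of_int (k $ i) = pi" by (simp add: field_simps)
    then show ?thesis by simp
  next
    case False
    then have "2 * pi * ?t * real_of_int (k $ i) = - pi" using i by (simp add: field_simps)
    then show ?thesis by (simp flip: cis_cnj)
  qed
  have cont: "continuous_on UNIV (torus_exp k)" by (intro continuous_intros)
  have "integral (cbox 0 One) (torus_exp k) = integral (cbox 0 One) (\<lambda>x. torus_exp k (x + ?t *\<^sub>R axis i 1))"
    by (rule integral_cube_translate[OF cont torus_exp_periodic_axis t, symmetric])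
  also have "\<dots> = - integral (cbox 0 One) (torus_exp k)"
    unfolding torus_exp_translate c by simp
  finally have "integral (cbox 0 One) (torus_exp k) = 0" by simp
  then show ?thesis using False by (simp add: integral_cube_continuous[OF cont])
qed

lemma torus_ft_torus_exp: "torus_ft (torus_exp l) k = (if l = k then 1 else 0)"
proof -
  have "torus_exp (- k) x * torus_exp l x = torus_exp (l - k) x" for x
    using torus_exp_add[of "- k" l x] by simp
  then show ?thesis by (simp add: torus_ft_eq integral_torus_exp)
qed

text \<open>The Weierstrass M-test allows integration term by term. Both Fourier series and the
  series of \<open>pdo_smooth\<close> are of this form.\<close>

lemma has_sum_torus_ft:
  fixes s :: "'a \<Rightarrow> real^'n \<Rightarrow> complex"
  assumes s: "\<And>k. continuous_on UNIV (s k)" and M: "\<And>k x. cmod (s k x) \<le> M k" "M summable_on UNIV"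
  shows "continuous_on UNIV (\<lambda>x. \<Sum>\<^sub>\<infinity>k. s k x)"
    and "((\<lambda>k. torus_ft (s k) j) has_sum torus_ft (\<lambda>x. \<Sum>\<^sub>\<infinity>k. s k x) j) UNIV"
proof -
  have u: "uniform_limit UNIV (\<lambda>F x. \<Sum>k\<in>F. s k x) (\<lambda>x. \<Sum>\<^sub>\<infinity>k. s k x) (finite_subsets_at_top UNIV)"
    by (rule Weierstrass_m_test_general[OF M])
  show c: "continuous_on UNIV (\<lambda>x. \<Sum>\<^sub>\<infinity>k. s k x)"
    by (rule uniform_limit_theorem[OF _ u]) (auto intro!: continuous_on_sum s always_eventually)
  have sf: "(\<lambda>k. s k x) summable_on UNIV" for x
    by (rule abs_summable_summable, rule Infinite_Sum.abs_summable_on_comparison_test'[OF M(2)]) (rule M(1))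
  have "uniform_limit UNIV (\<lambda>F x. \<Sum>k\<in>F. torus_exp (- j) x * s k x) (\<lambda>x. \<Sum>\<^sub>\<infinity>k. torus_exp (- j) x * s k x)
      (finite_subsets_at_top UNIV)"
    by (rule Weierstrass_m_test_general[OF _ M(2)]) (simp add: norm_mult M(1))
  then have u': "uniform_limit (cbox 0 One) (\<lambda>F x. \<Sum>k\<in>F. torus_exp (- j) x * s k x)
      (\<lambda>x. \<Sum>\<^sub>\<infinity>k. torus_exp (- j) x * s k x) (finite_subsets_at_top UNIV)"
    by (rule uniform_limit_on_subset) simp
  obtain I J where IJ: "\<And>F. ((\<lambda>x. \<Sum>k\<in>F. torus_exp (- j) x * s k x) has_integral I F) (cbox 0 One)"
    "((\<lambda>x. \<Sum>\<^sub>\<infinity>k. torus_exp (- j) x * s k x) has_integral J) (cbox 0 One)"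
    "(I \<longlongrightarrow> J) (finite_subsets_at_top UNIV)"
    by (rule uniform_limit_integral_cbox[OF u'])
      (auto intro!: continuous_on_sum continuous_intros continuous_on_subset[OF s])
  have int: "(\<lambda>x. torus_exp (- j) x * s k x) integrable_on cbox 0 One" for k
    by (intro integrable_continuous continuous_intros continuous_on_subset[OF s]) auto
  have "I F = (\<Sum>k\<in>F. torus_ft (s k) j)" for F
  proof (cases "finite F")
    case True
    have "I F = integral (cbox 0 One) (\<lambda>x. \<Sum>k\<in>F. torus_exp (- j) x * s k x)"
      using IJ(1)[of F] by (simp add: integral_unique)
    also have "\<dots> = (\<Sum>k\<in>F. torus_ft (s k) j)"
      using True int by (simp add: integral_sum torus_ft_continuous[OF s])
    finally show ?thesis .
  next
    case False
    then show ?thesis using integral_unique[OF IJ(1)[of F]] by simp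
  qed
  moreover have "J = torus_ft (\<lambda>x. \<Sum>\<^sub>\<infinity>k. s k x) j"
    using integral_unique[OF IJ(2)] by (simp add: torus_ft_continuous[OF c] infsum_cmult_right')
  ultimately show "((\<lambda>k. torus_ft (s k) j) has_sum torus_ft (\<lambda>x. \<Sum>\<^sub>\<infinity>k. s k x) j) UNIV"
    using IJ(3) unfolding has_sum_def by presburger
qed

lemma cmod_torus_ft_le:
  fixes f :: "real^'n \<Rightarrow> complex"
  assumes "continuous_on UNIV f" "\<And>x. cmod (f x) \<le> C"
  shows "cmod (torus_ft f k) \<le> C"
proof -
  have int: "integrable cube_measure (\<lambda>x. torus_exp (- k) x * f x)"
    by (intro integrable_cube_continuous continuous_intros assms)
  have "cmod (torus_ft f k) \<le> (LINT x|cube_measure. cmod (torus_exp (- k) x * f x))"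
    unfolding torus_ft_eq by (rule integral_norm_bound)
  also have "\<dots> \<le> (LINT x|(cube_measure :: (real^'n) measure). C)"
    by (rule integral_mono[OF integrable_norm[OF int]])
      (use assms(2) integrable_cube_const in \<open>auto simp: norm_mult\<close>)
  also have "\<dots> = C" using measure_cube[where 'n = 'n] by simp
  finally show ?thesis .
qed


section \<open>Fourier coefficients of derivatives\<close>

lemma torus_smooth_continuous: "f \<in> torus_smooth \<Longrightarrow> continuous_on UNIV f"
proof -
  assume "f \<in> torus_smooth"
  then have "continuous_on UNIV (iter_deriv [] f)" unfolding torus_smooth_def by blast
  then show ?thesis by (simp add: iter_deriv_def)
qed

lemma torus_smooth_periodic: "f \<in> torus_smooth \<Longrightarrow> f (x + real_vec m) = f x"
  by (simp add: torus_smooth_def)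

lemma torus_smooth_periodic_axis: "f \<in> torus_smooth \<Longrightarrow> f (x + axis i 1) = f x"
  using torus_smooth_periodic[of f x "axis i 1"] by (simp add: real_vec_axis)

lemma torus_smooth_partial_deriv:
  assumes f: "f \<in> torus_smooth"
  shows "partial_deriv i f \<in> torus_smooth"
proof -
  have 1: "iter_deriv \<beta> (partial_deriv i f) = iter_deriv (\<beta> @ [i]) f" for \<beta>
    by (simp add: iter_deriv_def)
  have 2: "partial_deriv i f (x + real_vec m) = partial_deriv i f x" for x m
  proof -
    have "f (x + real_vec m + t *\<^sub>R axis i 1) = f (x + t *\<^sub>R axis i 1)" for t
      using torus_smooth_periodic[OF f, of "x + t *\<^sub>R axis i 1" m] by (simp add: algebra_simps)
    then show ?thesis by (simp add: partial_deriv_def)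
  qed
  show ?thesis using f 2 unfolding torus_smooth_def mem_Collect_eq 1 by blast
qed

lemma torus_smooth_iter_deriv: "f \<in> torus_smooth \<Longrightarrow> iter_deriv \<beta> f \<in> torus_smooth"
  by (induction \<beta>) (auto simp: iter_deriv_def intro: torus_smooth_partial_deriv)

text \<open>\<open>torus_smooth\<close> speaks of derivatives at parameter 0 only; the chain rule
  with the translation by \<open>s\<close> moves the base point.\<close>

lemma torus_smooth_has_vector_derivative:
  assumes f: "f \<in> torus_smooth"
  shows "((\<lambda>t. f (x + t *\<^sub>R axis i 1)) has_vector_derivative partial_deriv i f (x + s *\<^sub>R axis i 1)) (at s)"
proof -
  let ?y = "x + s *\<^sub>R axis i 1"
  have "\<forall>\<beta>. \<forall>i x. (\<lambda>t. iter_deriv \<beta> f (x + t *\<^sub>R axis i 1)) differentiable (at 0)"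
    using f by (simp add: torus_smooth_def)
  then have "(\<lambda>t. iter_deriv [] f (?y + t *\<^sub>R axis i 1)) differentiable (at 0)" by blast
  then have "((\<lambda>t. f (?y + t *\<^sub>R axis i 1)) has_vector_derivative partial_deriv i f ?y) (at 0)"
    by (simp add: iter_deriv_def partial_deriv_def vector_derivative_works)
  then have y: "((\<lambda>t. f (?y + t *\<^sub>R axis i 1)) has_vector_derivative partial_deriv i f ?y) (at (s - s))"
    by simp
  have "((\<lambda>t. t - s) has_vector_derivative 1 - 0) (at s)"
    by (intro has_vector_derivative_diff has_vector_derivative_id has_vector_derivative_const)
  from vector_diff_chain_at[OF this y]
  have "((\<lambda>t. f (?y + (t - s) *\<^sub>R axis i 1)) has_vector_derivative partial_deriv i f ?y) (at s)"
    by (simp add: o_def)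
  then show ?thesis by (simp add: algebra_simps)
qed

text \<open>Difference quotients along a sequence, the form in which dominated convergence can use
  them.\<close>

lemma has_vector_derivative_sequentially:
  fixes g :: "real \<Rightarrow> complex"
  assumes g: "(g has_vector_derivative D) (at 0)" and t: "t \<longlonglongrightarrow> 0" "\<And>m. t m \<noteq> 0"
  shows "(\<lambda>m. (g (t m) - g 0) / of_real (t m)) \<longlonglongrightarrow> D"
proof -
  have "((\<lambda>h. norm (g (0 + h) - g 0 - h *\<^sub>R D) / norm h) \<longlongrightarrow> 0) (at 0)"
    using g unfolding has_vector_derivative_def has_derivative_at by simp
  then have "(\<lambda>m. norm (g (0 + t m) - g 0 - t m *\<^sub>R D) / norm (t m)) \<longlonglongrightarrow> 0"
    by (rule filterlim_compose) (use t in \<open>simp add: filterlim_at\<close>)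
  moreover have "norm (g (0 + t m) - g 0 - t m *\<^sub>R D) / norm (t m) = norm ((g (t m) - g 0) / of_real (t m) - D)" for m
  proof -
    have "(g (t m) - g 0) / of_real (t m) - D = (g (0 + t m) - g 0 - t m *\<^sub>R D) / of_real (t m)"
      using t(2)[of m] by (simp add: scaleR_conv_of_real field_simps)
    then show ?thesis by (simp add: norm_divide)
  qed
  ultimately have "(\<lambda>m. (g (t m) - g 0) / of_real (t m) - D) \<longlonglongrightarrow> 0"
    by (simp only: tendsto_norm_zero_iff)
  then show ?thesis by (rule LIM_zero_cancel)
qed

text \<open>Translation invariance takes the place of boundary terms: the coefficient of the
  difference quotient \<open>q m\<close> is
  \<open>(cis (2 * pi * t m * of_int (l $ i)) - 1) / t m\<close> times that of \<open>f\<close>.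
  Both sides converge as \<open>t m\<close> tends to 0, the left one by dominated
  convergence.\<close>

lemma torus_ft_partial_deriv:
  assumes f: "f \<in> torus_smooth"
  shows "torus_ft (partial_deriv i f) l = 2 * pi * \<i> * of_int (l $ i) * torus_ft f l"
proof -
  let ?d = "partial_deriv i f"
  define t where "t m = 1 / real (Suc m)" for m
  have t: "0 < t m" "t m \<le> 1" for m by (auto simp: t_def)
  have t0: "t \<longlonglongrightarrow> 0" unfolding t_def by (rule LIMSEQ_Suc[OF lim_1_over_n])
  note cf = torus_smooth_continuous[OF f]
  note cd = torus_smooth_continuous[OF torus_smooth_partial_deriv[OF f, of i]]
  define q where "q m x = (f (x + t m *\<^sub>R axis i 1) - f x) / t m" for m x
  have cft: "continuous_on UNIV (\<lambda>x. f (x + s *\<^sub>R axis i 1))" for s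
    by (rule continuous_on_compose2[OF cf]) (auto intro!: continuous_intros)
  have cq: "continuous_on UNIV (q m)" for m
    unfolding q_def using t[of m] by (intro continuous_intros cf cft) auto
  \<comment> \<open>The doubled cube contains all points reached from the unit cube by a step of
    length at most 1, so \<open>C\<close> bounds every quotient through the mean value
    inequality.\<close>
  have "compact (?d ` cbox 0 (2 *\<^sub>R One))"
    by (intro compact_continuous_image continuous_on_subset[OF cd]) auto
  then obtain C where C: "\<And>x. x \<in> cbox 0 (2 *\<^sub>R One) \<Longrightarrow> cmod (?d x) \<le> C"
    unfolding bounded_iff compact_eq_bounded_closed by (metis image_eqI)
  have bound: "cmod (q m x) \<le> C" if x: "x \<in> cbox 0 One" for m x
  proof -
    have "\<exists>s\<in>{0<..<t m}. norm (f (x + t m *\<^sub>R axis i 1) - f (x + 0 *\<^sub>R axis i 1))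
        \<le> norm ((t m - 0) *\<^sub>R ?d (x + s *\<^sub>R axis i 1))"
    proof (rule mvt_general[where f = "\<lambda>s. f (x + s *\<^sub>R axis i 1)" and f' = "\<lambda>s h. h *\<^sub>R ?d (x + s *\<^sub>R axis i 1)"])
      show "continuous_on {0..t m} (\<lambda>s. f (x + s *\<^sub>R axis i 1))"
        by (rule continuous_on_compose2[OF cf]) (auto intro!: continuous_intros)
    qed (use t torus_smooth_has_vector_derivative[OF f] in \<open>auto simp: has_vector_derivative_def\<close>)
    then obtain s where s: "0 < s" "s < t m" "cmod (f (x + t m *\<^sub>R axis i 1) - f x) \<le> t m * cmod (?d (x + s *\<^sub>R axis i 1))"
      using t[of m] by auto
    have "0 \<le> (x + s *\<^sub>R axis i 1) $ j \<and> (x + s *\<^sub>R axis i 1) $ j \<le> 2" for j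
    proof -
      have "0 \<le> x $ j" "x $ j \<le> 1" using x by (auto simp: mem_cube_iff)
      then show ?thesis using s t(2)[of m] by (auto simp: axis_def)
    qed
    then have "x + s *\<^sub>R axis i 1 \<in> cbox 0 (2 *\<^sub>R One)"
      unfolding mem_box_cart by simp
    then have "t m * cmod (?d (x + s *\<^sub>R axis i 1)) \<le> t m * C"
      using C t[of m] by (intro mult_left_mono) auto
    with s(3) have "cmod (f (x + t m *\<^sub>R axis i 1) - f x) \<le> t m * C" by linarith
    then show ?thesis using t[of m] by (simp add: q_def norm_divide divide_le_eq mult.commute)
  qed
  have lim: "(\<lambda>m. q m x) \<longlonglongrightarrow> ?d x" for x
  proof -
    have "((\<lambda>s. f (x + s *\<^sub>R axis i 1)) has_vector_derivative ?d x) (at 0)"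
      using torus_smooth_has_vector_derivative[OF f, of x i 0] by simp
    from has_vector_derivative_sequentially[OF this t0] t show ?thesis
      by (simp add: q_def less_imp_neq[symmetric])
  qed
  have "(\<lambda>m. LINT x|cube_measure. torus_exp (- l) x * q m x) \<longlonglongrightarrow> (LINT x|cube_measure. torus_exp (- l) x * ?d x)"
  proof (rule integral_dominated_convergence[where w = "\<lambda>_. C"])
    show "(\<lambda>x. torus_exp (- l) x * ?d x) \<in> borel_measurable cube_measure"
      "(\<lambda>x. torus_exp (- l) x * q m x) \<in> borel_measurable cube_measure" for m
      by (intro borel_measurable_integrable integrable_cube_continuous continuous_intros cd cq)+
    show "integrable cube_measure (\<lambda>_. C)"
      by (rule integrable_cube_const)
    show "AE x in cube_measure. cmod (torus_exp (- l) x * q m x) \<le> C" for m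
      by (rule AE_I2) (use bound in \<open>simp add: norm_mult\<close>)
  qed (auto intro!: tendsto_mult_left lim)
  then have L: "(\<lambda>m. torus_ft (q m) l) \<longlonglongrightarrow> torus_ft ?d l" by (simp add: torus_ft_eq)
  have shift: "torus_ft (\<lambda>x. f (x + t m *\<^sub>R axis i 1)) l = cis (2 * pi * t m * of_int (l $ i)) * torus_ft f l" for m
  proof -
    let ?G = "\<lambda>x. torus_exp (- l) x * f x"
    have cis1: "cis (2 * pi * t m * of_int (l $ i)) * cis (2 * pi * t m * of_int ((- l) $ i)) = 1"
      by (simp add: cis_mult)
    have "torus_ft f l = integral (cbox 0 One) (\<lambda>x. ?G (x + t m *\<^sub>R axis i 1))"
      unfolding torus_ft_continuous[OF cf]
      using t[of m] by (intro integral_cube_translate[symmetric])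
        (auto intro!: continuous_intros cf simp: torus_exp_periodic_axis torus_smooth_periodic_axis[OF f])
    also have "\<dots> = cis (2 * pi * t m * of_int ((- l) $ i)) * torus_ft (\<lambda>x. f (x + t m *\<^sub>R axis i 1)) l"
      unfolding torus_ft_continuous[OF cft] torus_exp_translate mult.assoc by simp
    finally have T: "torus_ft f l = cis (2 * pi * t m * of_int ((- l) $ i)) * torus_ft (\<lambda>x. f (x + t m *\<^sub>R axis i 1)) l" .
    show ?thesis unfolding T mult.assoc[symmetric] cis1 by simp
  qed
  have ft_q: "torus_ft (q m) l = (cis (2 * pi * t m * of_int (l $ i)) - 1) / t m * torus_ft f l" for m
  proof -
    have i: "(\<lambda>x. torus_exp (- l) x * h x) integrable_on cbox 0 One" if "continuous_on UNIV h" for h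
      by (intro integrable_continuous continuous_intros continuous_on_subset[OF that]) simp
    have "torus_ft (q m) l = integral (cbox 0 One)
        (\<lambda>x. (torus_exp (- l) x * f (x + t m *\<^sub>R axis i 1) - torus_exp (- l) x * f x) * (1 / t m))"
      unfolding torus_ft_continuous[OF cq] by (simp add: q_def algebra_simps diff_divide_distrib)
    also have "\<dots> = (torus_ft (\<lambda>x. f (x + t m *\<^sub>R axis i 1)) l - torus_ft f l) * (1 / t m)"
      using integral_diff[OF i[OF cft] i[OF cf]] by (simp add: torus_ft_continuous[OF cf] torus_ft_continuous[OF cft])
    finally show ?thesis by (simp add: shift left_diff_distrib diff_divide_distrib)
  qed
  have "((\<lambda>s. exp (of_real s * (2 * pi * \<i> * of_int (l $ i)))) has_vector_derivative
      2 * pi * \<i> * of_int (l $ i)) (at (0 :: real))"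
    by (rule has_vector_derivative_real_field) (auto intro!: derivative_eq_intros)
  from has_vector_derivative_sequentially[OF this t0]
  have "(\<lambda>m. (exp (of_real (t m) * (2 * pi * \<i> * of_int (l $ i))) - 1) / t m) \<longlonglongrightarrow> 2 * pi * \<i> * of_int (l $ i)"
    using t(1) by (simp add: less_imp_neq[symmetric])
  moreover have "exp (of_real (t m) * (2 * pi * \<i> * of_int (l $ i))) = cis (2 * pi * t m * of_int (l $ i))" for m
    unfolding cis_conv_exp by (rule arg_cong[where f = exp]) simp
  ultimately have R: "(\<lambda>m. (cis (2 * pi * t m * of_int (l $ i)) - 1) / t m) \<longlonglongrightarrow> 2 * pi * \<i> * of_int (l $ i)"
    by (simp only:)
  have "(\<lambda>m. torus_ft (q m) l) \<longlonglongrightarrow> 2 * pi * \<i> * of_int (l $ i) * torus_ft f l"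
    unfolding ft_q by (intro tendsto_mult_right R)
  with L show ?thesis by (rule LIMSEQ_unique)
qed

lemma torus_ft_iter_deriv:
  assumes f: "f \<in> torus_smooth"
  shows "torus_ft (iter_deriv (replicate N i) f) l = (2 * pi * \<i> * of_int (l $ i)) ^ N * torus_ft f l"
proof (induction N)
  case (Suc N)
  then show ?case
    using torus_ft_partial_deriv[OF torus_smooth_iter_deriv[OF f], of i "replicate N i" l]
    by (simp add: iter_deriv_def)
qed (simp add: iter_deriv_def)

text \<open>Pure derivatives suffice: if \<open>i\<close> is the coordinate of largest modulus
  \<open>a\<close>, then \<open>norm (real_vec l)\<close> is at most \<open>a\<close> times the
  dimension, so for \<open>a \<ge> 1\<close> the factor \<open>(2 * pi * a) ^ N\<close> produced by
  differentiation controls the weight. This is the origin of \<open>1 + real CARD('n)\<close>; if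
  \<open>a\<close> is 0, then \<open>l\<close> is 0.\<close>

lemma torus_ft_decay:
  fixes f :: "real^'n \<Rightarrow> complex"
  assumes f: "f \<in> torus_smooth" and C: "\<And>x. cmod (f x) \<le> C" "\<And>i x. cmod (iter_deriv (replicate N i) f x) \<le> C"
  shows "cmod (torus_ft f l) * (1 + norm (real_vec l)) ^ N \<le> C * (1 + real CARD('n)) ^ N"
proof -
  define a where "a = Max (range (\<lambda>i. \<bar>real_of_int (l $ i)\<bar>))"
  have "a \<in> range (\<lambda>i. \<bar>real_of_int (l $ i)\<bar>)"
    unfolding a_def by (rule Max_in) auto
  then obtain i where i: "a = \<bar>real_of_int (l $ i)\<bar>" by (rule rangeE)
  have le: "\<bar>real_of_int (l $ j)\<bar> \<le> a" for j unfolding a_def by (rule Max_ge) auto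
  have "norm (real_vec l) \<le> (\<Sum>j\<in>UNIV. \<bar>real_vec l $ j\<bar>)" by (rule norm_le_l1_cart)
  also have "\<dots> \<le> (\<Sum>j\<in>(UNIV :: 'n set). a)" by (rule sum_mono) (simp add: le)
  also have "\<dots> = real CARD('n) * a" by simp
  finally have n: "1 + norm (real_vec l) \<le> 1 + real CARD('n) * a" by simp
  have b0: "cmod (torus_ft f l) \<le> C"
    by (rule cmod_torus_ft_le[OF torus_smooth_continuous[OF f] C(1)])
  show ?thesis
  proof (cases "l $ i = 0")
    case True
    then have "1 + norm (real_vec l) \<le> 1" using n i by simp
    then have "1 + norm (real_vec l) = 1" by simp
    moreover have "1 \<le> (1 + real CARD('n)) ^ N" by simp
    ultimately show ?thesis using b0 order_trans[OF norm_ge_zero b0] by (simp add: mult_le_cancel_left1 order_trans[OF b0])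
  next
    case False
    then have a1: "1 \<le> a" unfolding i by linarith
    have "cmod (torus_ft (iter_deriv (replicate N i) f) l) \<le> C"
      by (rule cmod_torus_ft_le[OF torus_smooth_continuous[OF torus_smooth_iter_deriv[OF f]] C(2)])
    then have "(2 * pi * a) ^ N * cmod (torus_ft f l) \<le> C"
      unfolding torus_ft_iter_deriv[OF f] by (simp add: norm_mult norm_power i)
    moreover have "a ^ N * cmod (torus_ft f l) \<le> (2 * pi * a) ^ N * cmod (torus_ft f l)"
      using a1 pi_ge_two by (intro mult_right_mono power_mono) auto
    ultimately have aN: "a ^ N * cmod (torus_ft f l) \<le> C" by linarith
    have "(1 + norm (real_vec l)) ^ N \<le> ((1 + real CARD('n)) * a) ^ N"
      using n a1 by (intro power_mono) (auto simp: algebra_simps)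
    then have "cmod (torus_ft f l) * (1 + norm (real_vec l)) ^ N
        \<le> cmod (torus_ft f l) * ((1 + real CARD('n)) * a) ^ N"
      by (intro mult_left_mono) auto
    also have "\<dots> = (a ^ N * cmod (torus_ft f l)) * (1 + real CARD('n)) ^ N"
      by (simp add: power_mult_distrib)
    also have "\<dots> \<le> C * (1 + real CARD('n)) ^ N"
      by (intro mult_right_mono aN) auto
    finally show ?thesis .
  qed
qed


section \<open>The Fourier transform on \<open>torus_L2\<close> and its injectivity\<close>

section \<open>Square integrable functions on the torus\<close>

lemma square_integrable_rep: "square_integrable (rep_torus_L2 u)"
  using Quotient3_rep_reflp[OF Quotient3_torus_L2, of u] by (simp add: L2_eq_def)

lemma L2_eq_rep_abs: "square_integrable f \<Longrightarrow> L2_eq (rep_torus_L2 (abs_torus_L2 f)) f"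
  by (rule rep_abs_rsp_left[OF Quotient3_torus_L2 L2_eq_refl])

lemma abs_torus_L2_eqI: "L2_eq f g \<Longrightarrow> abs_torus_L2 f = abs_torus_L2 g"
  by (rule Quotient3_rel_abs[OF Quotient3_torus_L2])

lemma abs_rep_torus_L2 [simp]: "abs_torus_L2 (rep_torus_L2 u) = u"
  by (rule Quotient3_abs_rep[OF Quotient3_torus_L2])

lemma abs_torus_L2_add:
  "square_integrable f \<Longrightarrow> square_integrable g \<Longrightarrow> abs_torus_L2 f + abs_torus_L2 g = abs_torus_L2 (\<lambda>x. f x + g x)"
  by (rule plus_torus_L2.abs_eq) (auto intro: L2_eq_refl)

lemma abs_torus_L2_scaleC:
  "square_integrable f \<Longrightarrow> c *\<^sub>C abs_torus_L2 f = abs_torus_L2 (\<lambda>x. c * f x)"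
  by (rule scaleC_torus_L2.abs_eq) (rule L2_eq_refl)

lemma abs_torus_L2_inner:
  "square_integrable f \<Longrightarrow> square_integrable g \<Longrightarrow>
    abs_torus_L2 f \<bullet> abs_torus_L2 g = (LINT x|cube_measure. f x \<bullet> g x)"
  by (rule inner_torus_L2.abs_eq) (auto intro: L2_eq_refl)

lemma abs_torus_L2_diff:
  assumes "square_integrable f" "square_integrable g"
  shows "abs_torus_L2 f - abs_torus_L2 g = abs_torus_L2 (\<lambda>x. f x - g x)"
proof -
  have eq: "abs_torus_L2 f - abs_torus_L2 g = abs_torus_L2 f + (- 1) *\<^sub>C abs_torus_L2 g"
    by (simp add: complex_vector.scale_minus_left scaleC_one)
  show ?thesis
    unfolding eq abs_torus_L2_scaleC[OF assms(2)]
      abs_torus_L2_add[OF assms(1) square_integrable_scale[OF assms(2)]] by simp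
qed

lemma norm_abs_torus_L2_square:
  "square_integrable f \<Longrightarrow> (norm (abs_torus_L2 f))\<^sup>2 = (LINT x|cube_measure. (cmod (f x))\<^sup>2)"
  by (simp add: power2_norm_eq_inner abs_torus_L2_inner)

lemma square_integrable_continuous:
  assumes "continuous_on UNIV f"
  shows "square_integrable f"
  unfolding square_integrable_def
proof
  show "f \<in> borel_measurable cube_measure"
    by (intro borel_measurable_integrable integrable_cube_continuous assms)
  show "integrable cube_measure (\<lambda>x. (cmod (f x))\<^sup>2)"
    by (intro continuous_imp_integrable continuous_intros continuous_on_subset[OF assms]) simp
qed

lemma square_integrable_imp_integrable:
  assumes "square_integrable f"
  shows "integrable cube_measure f"
proof (rule Bochner_Integration.integrable_bound)
  show "integrable cube_measure (\<lambda>x. 1 + (cmod (f x))\<^sup>2)"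
    using assms integrable_cube_const
    by (intro Bochner_Integration.integrable_add) (auto simp: square_integrable_def)
  have "a \<le> 1 + a\<^sup>2" if "0 \<le> a" for a :: real
    using sum_squares_bound[of a 1] that by simp
  then show "AE x in cube_measure. norm (f x) \<le> norm (1 + (cmod (f x))\<^sup>2)"
    by simp
qed (use assms in \<open>simp add: square_integrable_def\<close>)

lemma square_integrable_torus_exp_mult:
  assumes "square_integrable f"
  shows "square_integrable (\<lambda>x. torus_exp k x * f x)"
  unfolding square_integrable_def
proof
  have "torus_exp k \<in> borel_measurable cube_measure"
    by (intro borel_measurable_integrable integrable_cube_continuous continuous_intros)
  then show "(\<lambda>x. torus_exp k x * f x) \<in> borel_measurable cube_measure"
    using assms by (auto simp: square_integrable_def)
qed (use assms in \<open>simp add: square_integrable_def norm_mult\<close>)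

lemma norm_abs_torus_L2_le:
  assumes f: "square_integrable f" and B: "\<And>x. x \<in> cbox 0 One \<Longrightarrow> cmod (f x) \<le> B" "0 \<le> B"
  shows "norm (abs_torus_L2 f) \<le> B"
proof -
  have "(norm (abs_torus_L2 f))\<^sup>2 \<le> (LINT x|(cube_measure :: (real^'a) measure). B\<^sup>2)"
    unfolding norm_abs_torus_L2_square[OF f]
    by (rule integral_mono) (use f B integrable_cube_const in
        \<open>auto simp: square_integrable_def power_mono\<close>)
  also have "\<dots> = B\<^sup>2" using measure_cube[where 'n = 'a] by simp
  finally show ?thesis using B(2) by (rule power2_le_imp_le)
qed


section \<open>Fourier coefficients of square integrable functions\<close>

text \<open>\<open>fourier\<close> passes through \<open>Abs_ell2\<close>, which is faithful only
  after Bessel's inequality; until then the coefficients are handled as a plain function.\<close>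

definition tft :: "('n::finite) torus_L2 \<Rightarrow> int^'n \<Rightarrow> complex" where
  "tft u = torus_ft (rep_torus_L2 u)"

definition torus_basis :: "int^'n \<Rightarrow> ('n::finite) torus_L2" where
  "torus_basis k = abs_torus_L2 (torus_exp k)"

lemma square_integrable_torus_exp: "square_integrable (torus_exp k)"
  by (intro square_integrable_continuous continuous_intros)

lemma tft_abs:
  assumes "square_integrable f"
  shows "tft (abs_torus_L2 f) k = torus_ft f k"
proof -
  note eq = L2_eq_rep_abs[OF assms]
  have "AE x in cube_measure. torus_exp (- k) x * rep_torus_L2 (abs_torus_L2 f) x = torus_exp (- k) x * f x"
    using L2_eq_AE[OF eq] by eventually_elim simp
  then show ?thesis
    unfolding tft_def torus_ft_eq
    by (intro integral_cong_AE borel_measurable_integrable square_integrable_imp_integrable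
        square_integrable_torus_exp_mult square_integrable_rep assms)
qed

lemma tft_torus_basis: "tft (torus_basis l) k = (if l = k then 1 else 0)"
  by (simp add: torus_basis_def tft_abs square_integrable_torus_exp torus_ft_torus_exp)

lemma integrable_torus_ft: "square_integrable f \<Longrightarrow> integrable cube_measure (\<lambda>x. torus_exp (- k) x * f x)"
  by (intro square_integrable_imp_integrable square_integrable_torus_exp_mult)

lemma tft_add: "tft (u + v) k = tft u k + tft v k"
proof -
  have "u + v = abs_torus_L2 (\<lambda>x. rep_torus_L2 u x + rep_torus_L2 v x)"
    using abs_torus_L2_add[OF square_integrable_rep[of u] square_integrable_rep[of v]] by simp
  then show ?thesis
    by (simp add: tft_abs square_integrable_add square_integrable_rep torus_ft_eq distrib_left
        integrable_torus_ft) (simp add: tft_def torus_ft_eq)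
qed

lemma tft_scaleC: "tft (c *\<^sub>C u) k = c * tft u k"
proof -
  have "c *\<^sub>C u = abs_torus_L2 (\<lambda>x. c * rep_torus_L2 u x)"
    using abs_torus_L2_scaleC[OF square_integrable_rep[of u]] by simp
  then show ?thesis
    by (simp add: tft_abs square_integrable_scale square_integrable_rep torus_ft_eq mult.left_commute[of _ c])
      (simp add: tft_def torus_ft_eq)
qed

text \<open>The inner product is only the real part of the Hermitian one; the free scalar
  \<open>c\<close> gives access to the whole coefficient.\<close>

lemma inner_torus_basis: "u \<bullet> (c *\<^sub>C torus_basis k) = Re (cnj c * tft u k)"
proof -
  note s = square_integrable_scale[OF square_integrable_torus_exp[of k], of c]
  have "u \<bullet> (c *\<^sub>C torus_basis k) = (LINT x|cube_measure. rep_torus_L2 u x \<bullet> (c * torus_exp k x))"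
    using abs_torus_L2_inner[OF square_integrable_rep[of u] s]
    by (simp add: torus_basis_def abs_torus_L2_scaleC square_integrable_torus_exp)
  also have "\<dots> = (LINT x|cube_measure. Re (cnj c * (torus_exp (- k) x * rep_torus_L2 u x)))"
    by (rule Bochner_Integration.integral_cong) (auto simp: torus_exp_minus inner_complex_def algebra_simps)
  also have "\<dots> = Re (LINT x|cube_measure. cnj c * (torus_exp (- k) x * rep_torus_L2 u x))"
    by (rule integral_Re) (intro integrable_mult_right integrable_torus_ft square_integrable_rep)
  also have "\<dots> = Re (cnj c * tft u k)"
    by (simp add: tft_def torus_ft_eq)
  finally show ?thesis .
qed

text \<open>Expand \<open>0 \<le> (u - ?p) \<bullet> (u - ?p)\<close>: both
  \<open>u \<bullet> ?p\<close> and \<open>?p \<bullet> ?p\<close> equal \<open>?S\<close>.\<close>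

lemma torus_bessel:
  assumes "finite F"
  shows "(\<Sum>k\<in>F. (cmod (tft u k))\<^sup>2) \<le> (norm u)\<^sup>2"
proof -
  let ?p = "\<Sum>k\<in>F. tft u k *\<^sub>C torus_basis k" and ?S = "\<Sum>k\<in>F. (cmod (tft u k))\<^sup>2"
  have re: "Re z * Re z + Im z * Im z = (cmod z)\<^sup>2" for z unfolding cmod_power2 by (simp add: power2_eq_square)
  have tp: "tft ?p k = (if k \<in> F then tft u k else 0)" for k
  proof -
    have "tft (\<Sum>l\<in>G. tft u l *\<^sub>C torus_basis l) k = (\<Sum>l\<in>G. if l = k then tft u k else 0)" if "finite G" for G
      using that by (induction G) (use tft_scaleC[of 0 _ k] in \<open>auto simp: tft_add tft_scaleC tft_torus_basis\<close>)
    then show ?thesis using assms by simp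
  qed
  have up: "u \<bullet> ?p = ?S"
    by (simp add: inner_sum_right inner_torus_basis re)
  have pp: "?p \<bullet> ?p = ?S"
    by (subst (2) sum.cong[OF refl refl]) (simp add: inner_sum_right inner_torus_basis tp re)
  have "0 \<le> (u - ?p) \<bullet> (u - ?p)" by simp
  also have "\<dots> = u \<bullet> u - 2 * (u \<bullet> ?p) + ?p \<bullet> ?p"
    by (simp add: inner_diff_left inner_diff_right inner_commute)
  finally show ?thesis by (simp add: up pp power2_norm_eq_inner)
qed

lemma Rep_fourier: "Rep_ell2 (fourier u) = tft u"
  and norm_fourier_le: "norm (fourier u) \<le> norm u"
proof -
  have s: "(\<lambda>k. (cmod (tft u k))\<^sup>2) summable_on UNIV"
    by (rule nonneg_bdd_above_summable_on) (auto intro!: bdd_aboveI[of _ "(norm u)\<^sup>2"] torus_bessel)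
  then show R: "Rep_ell2 (fourier u) = tft u"
    unfolding fourier_def tft_def by (intro Abs_ell2_inverse) simp
  have "(norm (fourier u))\<^sup>2 \<le> (norm u)\<^sup>2"
    unfolding norm_ell2_square R by (rule infsum_le_finite_sums[OF s]) (rule torus_bessel)
  then show "norm (fourier u) \<le> norm u"
    by (rule power2_le_imp_le) simp
qed

lemma bounded_clinear_fourier: "bounded_clinear fourier"
  by (rule bounded_clinearI[of _ 1])
    (auto simp: norm_fourier_le Rep_fourier Rep_ell2_simps tft_add tft_scaleC intro!: ell2_eqI)

lemma fourier_torus_basis: "fourier (torus_basis k) = unit_vec_ell2 k"
  by (rule ell2_eqI) (auto simp: Rep_fourier tft_torus_basis Rep_unit_vec_ell2)


section \<open>Density of trigonometric polynomials\<close>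

inductive trig_poly :: "(real^'n \<Rightarrow> complex) \<Rightarrow> bool" where
  exp: "trig_poly (\<lambda>x. c * torus_exp k x)"
| add: "trig_poly f \<Longrightarrow> trig_poly g \<Longrightarrow> trig_poly (\<lambda>x. f x + g x)"

lemma trig_poly_const: "trig_poly (\<lambda>x. c)"
  using trig_poly.exp[of c 0] by simp

lemma trig_poly_sum: "finite A \<Longrightarrow> (\<And>a. a \<in> A \<Longrightarrow> trig_poly (f a)) \<Longrightarrow> trig_poly (\<lambda>x. \<Sum>a\<in>A. f a x)"
  by (induction A rule: finite_induct) (auto intro: trig_poly_const trig_poly.add)

lemma trig_poly_exp_mult: "trig_poly f \<Longrightarrow> trig_poly (\<lambda>x. c * torus_exp k x * f x)"
proof (induction rule: trig_poly.induct)
  case (exp d l)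
  then show ?case using trig_poly.exp[of "c * d" "k + l"] by (simp add: torus_exp_add mult_ac)
next
  case (add f g)
  then show ?case using trig_poly.add[OF add.IH] by (simp add: distrib_left)
qed

lemma trig_poly_mult: "trig_poly f \<Longrightarrow> trig_poly g \<Longrightarrow> trig_poly (\<lambda>x. f x * g x)"
proof (induction rule: trig_poly.induct)
  case (exp c k)
  then show ?case by (rule trig_poly_exp_mult)
next
  case (add f h)
  then show ?case using trig_poly.add[OF add.IH(1)[OF add.prems] add.IH(2)[OF add.prems]] by (simp add: distrib_right)
qed

lemma trig_poly_continuous: "trig_poly f \<Longrightarrow> continuous_on UNIV f"
  by (induction rule: trig_poly.induct) (auto intro!: continuous_intros)

lemma trig_poly_in_span: "trig_poly f \<Longrightarrow> abs_torus_L2 f \<in> complex_vector.span (range torus_basis)"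
proof (induction rule: trig_poly.induct)
  case (exp c k)
  have "abs_torus_L2 (\<lambda>x. c * torus_exp k x) = c *\<^sub>C torus_basis k"
    by (simp add: torus_basis_def abs_torus_L2_scaleC square_integrable_torus_exp)
  then show ?case by (simp add: complex_vector.span_scale complex_vector.span_base)
next
  case (add f g)
  have "abs_torus_L2 (\<lambda>x. f x + g x) = abs_torus_L2 f + abs_torus_L2 g"
    by (rule abs_torus_L2_add[symmetric]) (intro square_integrable_continuous trig_poly_continuous add.hyps)+
  with add.IH show ?case by (simp add: complex_vector.span_add)
qed

text \<open>Realises the torus as a compact subset of complex space, where polynomial approximation
  applies; opposite faces of the cube are identified.\<close>

definition torus_embed :: "real^'n \<Rightarrow> complex^'n" where
  "torus_embed x = (\<chi> i. torus_exp (axis i 1) x)"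

lemma torus_embed_nth: "torus_embed x $ i = cis (2 * pi * x $ i)"
  by (simp add: torus_embed_def torus_exp_cis real_vec_axis inner_axis)

text \<open>A real linear functional combines the real and imaginary parts of the coordinates, and
  on the embedded torus these are combinations of the exponentials with frequencies
  \<open>axis i 1\<close> and \<open>- axis i 1\<close>.\<close>

lemma trig_poly_real_polynomial:
  fixes r :: "complex^'n \<Rightarrow> real"
  assumes "real_polynomial_function r"
  shows "trig_poly (\<lambda>x. complex_of_real (r (torus_embed x)))"
  using assms
proof (induction rule: real_polynomial_function.induct)
  case (linear f)
  then have lin: "linear f" by (rule bounded_linear.linear)
  have ReIm: "trig_poly (\<lambda>x. complex_of_real (Re (torus_embed x $ i)))"
    "trig_poly (\<lambda>x. complex_of_real (Im (torus_embed x $ i)))" for i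
  proof -
    have cnjE: "cnj (torus_exp (axis i 1) x) = torus_exp (- axis i 1) x" for x
      by (simp add: torus_exp_minus)
    have "complex_of_real (Re (torus_embed x $ i))
        = 1 / 2 * torus_exp (axis i 1) x + 1 / 2 * torus_exp (- axis i 1) x" for x
      unfolding cnjE[symmetric] by (simp add: torus_embed_def complex_eq_iff)
    then show "trig_poly (\<lambda>x. complex_of_real (Re (torus_embed x $ i)))"
      by (simp only:) (intro trig_poly.intros)
    have "complex_of_real (Im (torus_embed x $ i))
        = (- \<i> / 2) * torus_exp (axis i 1) x + (\<i> / 2) * torus_exp (- axis i 1) x" for x
      unfolding cnjE[symmetric] by (simp add: torus_embed_def complex_eq_iff)
    then show "trig_poly (\<lambda>x. complex_of_real (Im (torus_embed x $ i)))"
      by (simp only:) (intro trig_poly.intros)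
  qed
  have axis_mul: "axis i (a *\<^sub>R w) = a *\<^sub>R axis i w" for i :: 'n and a and w :: complex
    by (simp add: cart_eq axis_def)
  define A B where "A i = f (axis i 1)" and "B i = f (axis i \<i>)" for i
  have f_eq: "f w = (\<Sum>i\<in>UNIV. Re (w $ i) * A i + Im (w $ i) * B i)" for w
  proof -
    have "w = (\<Sum>i\<in>UNIV. Re (w $ i) *\<^sub>R axis i 1 + Im (w $ i) *\<^sub>R axis i \<i>)"
      unfolding axis_mul[symmetric] by (simp add: cart_eq axis_def complex_eq_iff
          sum.If_cases if_distrib cong: if_cong)
    then have "f w = f (\<Sum>i\<in>UNIV. Re (w $ i) *\<^sub>R axis i 1 + Im (w $ i) *\<^sub>R axis i \<i>)" by (rule arg_cong)
    then show ?thesis by (simp add: linear_sum[OF lin] linear_add[OF lin] linear_scale[OF lin] A_def B_def)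
  qed
  have "(\<lambda>x. complex_of_real (f (torus_embed x))) = (\<lambda>x. \<Sum>i\<in>UNIV.
      complex_of_real (Re (torus_embed x $ i)) * of_real (A i)
      + complex_of_real (Im (torus_embed x $ i)) * of_real (B i))"
    by (rule ext, subst f_eq) simp
  then show ?case
    by (simp only:) (intro trig_poly_sum trig_poly.add trig_poly_mult ReIm trig_poly_const finite)
next
  case (const c)
  then show ?case by (simp add: trig_poly_const)
next
  case (add f g)
  then show ?case using trig_poly.add[OF add.IH] by simp
next
  case (mult f g)
  then show ?case using trig_poly_mult[OF mult.IH] by simp
qed

text \<open>A continuous function vanishing at the boundary of the cube factors through the compact torus
  in \<open>\<complex>\<^sup>n\<close>, where it can be approximated by polynomials.\<close>

lemma trig_poly_approx:
  fixes g :: "real^'n \<Rightarrow> complex"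
  assumes g: "continuous_on UNIV g" "\<And>x. x \<notin> box 0 One \<Longrightarrow> g x = 0" and e: "0 < e"
  obtains p where "trig_poly p" "\<And>x. x \<in> cbox 0 One \<Longrightarrow> cmod (g x - p x) < e"
proof -
  let ?Q = "cbox 0 (One :: real^'n)"
  have cont_emb: "continuous_on S (torus_embed :: real^'n \<Rightarrow> _)" for S
    unfolding torus_embed_def by (intro continuous_intros)
  \<comment> \<open>Distinct coordinates in the unit interval that agree modulo 1 are 0 and 1, so
    both points lie on the boundary, where \<open>g\<close> vanishes.\<close>
  have inj: "g x = g y" if xy: "x \<in> ?Q" "y \<in> ?Q" "torus_embed x = torus_embed y" for x y
  proof (cases "x = y")
    case False
    then obtain i where i: "x $ i \<noteq> y $ i" by (auto simp: cart_eq)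
    have b: "0 \<le> x $ i" "x $ i \<le> 1" "0 \<le> y $ i" "y $ i \<le> 1" using xy by (auto simp: mem_cube_iff)
    have "cis (2 * pi * x $ i) = cis (2 * pi * y $ i)"
      using xy(3) by (metis torus_embed_nth)
    then have "cis (2 * pi * x $ i - 2 * pi * y $ i) = 1"
      by (simp flip: cis_divide)
    then obtain n :: int where "2 * pi * x $ i - 2 * pi * y $ i = 2 * pi * n"
      unfolding cis_conv_exp exp_eq_1 by (auto simp: algebra_simps)
    then have "2 * pi * (x $ i - y $ i) = 2 * pi * n" by (simp add: right_diff_distrib)
    then have n: "x $ i - y $ i = n" by simp
    with i have "n \<noteq> 0" by auto
    then have "1 \<le> \<bar>n\<bar>" by linarith
    then have "1 \<le> \<bar>real_of_int n\<bar>" by linarith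
    with n b have "(x $ i = 0 \<or> x $ i = 1) \<and> (y $ i = 0 \<or> y $ i = 1)" by linarith
    then have "x \<notin> box 0 One" "y \<notin> box 0 One" by (auto simp: mem_box_cart intro!: exI[of _ i])
    then show ?thesis by (simp add: g(2))
  qed simp
  define h where "h w = g (SOME x. x \<in> ?Q \<and> torus_embed x = w)" for w
  have h: "h (torus_embed x) = g x" if "x \<in> ?Q" for x
  proof -
    have "(SOME y. y \<in> ?Q \<and> torus_embed y = torus_embed x) \<in> ?Q \<and>
        torus_embed (SOME y. y \<in> ?Q \<and> torus_embed y = torus_embed x) = torus_embed x"
      by (rule someI[of _ x]) (use that in auto)
    then show ?thesis unfolding h_def using inj that by blast
  qed
  let ?T = "torus_embed ` ?Q"
  have compT: "compact ?T" by (rule compact_continuous_image[OF cont_emb]) simp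
  \<comment> \<open>The preimage of a closed set under \<open>h\<close> is the image of a closed
    part of the compact cube, hence compact.\<close>
  have "continuous_on ?T h"
    unfolding continuous_on_closed_vimage[OF compact_imp_closed[OF compT]]
  proof (intro allI impI)
    fix C :: "complex set" assume "closed C"
    then have "closed (g -` C)" using g(1) by (simp add: continuous_on_closed_vimage)
    then have "compact (?Q \<inter> g -` C)" by (intro compact_Int_closed) auto
    then have "compact (torus_embed ` (?Q \<inter> g -` C))" by (rule compact_continuous_image[OF cont_emb])
    moreover have "h -` C \<inter> ?T = torus_embed ` (?Q \<inter> g -` C)" by (auto simp: h)
    ultimately show "closed (h -` C \<inter> ?T)" by (simp add: compact_imp_closed)
  qed
  from Stone_Weierstrass_polynomial_function[OF compT this e]
  obtain q where q: "polynomial_function q" "\<And>w. w \<in> ?T \<Longrightarrow> cmod (h w - q w) < e" by blast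
  let ?p = "\<lambda>x. q (torus_embed x)"
  have "real_polynomial_function (Re \<circ> q)" "real_polynomial_function (Im \<circ> q)"
    using q(1) bounded_linear_Re bounded_linear_Im unfolding polynomial_function_def by blast+
  from this[THEN trig_poly_real_polynomial]
  have "trig_poly (\<lambda>x. complex_of_real (Re (?p x)) + \<i> * complex_of_real (Im (?p x)))"
    by (intro trig_poly.add trig_poly_mult trig_poly_const) (simp_all add: o_def)
  then have "trig_poly ?p" by (simp flip: complex_eq)
  moreover have "cmod (g x - ?p x) < e" if "x \<in> ?Q" for x
    using q(2)[of "torus_embed x"] h[OF that] that by auto
  ultimately show ?thesis using that by blast
qed

text \<open>Measurability supplies continuous \<open>G n\<close> converging almost everywhere. The
  nearest-point projection \<open>?P\<close> onto the disc of radius \<open>M\<close> makes them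
  uniformly bounded for dominated convergence, and a cut-off forces them to vanish outside the open
  cube.\<close>

lemma bounded_measurable_approx:
  fixes h :: "real^'n \<Rightarrow> complex"
  assumes h: "h \<in> borel_measurable cube_measure" "\<And>x. cmod (h x) \<le> M" and e: "0 < e"
  obtains g where "continuous_on UNIV g" "\<And>x. x \<notin> box 0 One \<Longrightarrow> g x = 0"
    "(LINT x|cube_measure. (cmod (h x - g x))\<^sup>2) < e"
proof -
  let ?Q = "cbox 0 (One :: real^'n)" and ?B = "box 0 (One :: real^'n)"
  define h' where "h' x = (if x \<in> ?Q then h x else 0)" for x
  have M: "0 \<le> M" using order_trans[OF norm_ge_zero h(2)] .
  have "h' \<in> borel_measurable lebesgue"
    unfolding h'_def by (rule borel_measurable_if_I[OF h(1)]) simp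
  then have "h' measurable_on UNIV" by (rule lebesgue_measurable_imp_measurable_on) simp
  then obtain N G where N: "negligible N" and G: "\<And>n. continuous_on UNIV (G n)"
    "\<And>x. x \<notin> N \<Longrightarrow> (\<lambda>n. G n x) \<longlonglongrightarrow> h' x"
    unfolding measurable_on_def by auto
  let ?P = "closest_point (cball (0 :: complex) M)"
  have contP: "continuous_on S ?P" for S by (rule continuous_on_closest_point) (use M in auto)
  have Pin: "cmod (?P z) \<le> M" for z using closest_point_in_set[of "cball 0 M" z] M by simp
  have Pid: "?P z = z" if "cmod z \<le> M" for z using that by (simp add: closest_point_self)
  \<comment> \<open>Zero outside the open cube and eventually 1 at each of its points; convergence
    can fail only on the boundary, a null set.\<close>
  define c where "c n x = min 1 (real n * infdist x (- ?B))" for n x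
  have contc: "continuous_on S (c n)" for S n
    unfolding c_def by (intro continuous_intros)
  have nB: "- ?B \<noteq> {}" by (metis Compl_empty_eq double_compl not_bounded_UNIV bounded_box)
  have c0: "c n x = 0" if "x \<notin> ?B" for n x using that by (simp add: c_def)
  have c01: "0 \<le> c n x" "c n x \<le> 1" for n x by (auto simp: c_def infdist_nonneg)
  have c1: "(\<lambda>n. c n x) \<longlonglongrightarrow> 1" if x: "x \<in> ?B" for x
  proof -
    have "closed (- ?B)" by (simp add: open_box closed_Compl)
    then have pos: "0 < infdist x (- ?B)"
      using x nB in_closed_iff_infdist_zero[of "- ?B" x] infdist_nonneg[of x "- ?B"] by (auto simp: less_le)
    obtain n0 :: nat where n0: "1 / infdist x (- ?B) \<le> real n0" using real_arch_simple by blast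
    have "c n x = 1" if "n0 \<le> n" for n
    proof -
      have "1 \<le> real n0 * infdist x (- ?B)" using n0 pos by (simp add: divide_le_eq)
      also have "\<dots> \<le> real n * infdist x (- ?B)" using that pos by (intro mult_right_mono) auto
      finally show ?thesis by (simp add: c_def)
    qed
    then show ?thesis by (intro tendsto_eventually) (auto simp: eventually_sequentially)
  qed
  define g where "g n x = of_real (c n x) * ?P (G n x)" for n x
  have contg: "continuous_on UNIV (g n)" for n
    unfolding g_def by (intro continuous_intros contc continuous_on_compose2[OF contP G(1)]) auto
  have g_le: "cmod (g n x) \<le> M" for n x
    using mult_mono[OF c01(2)[of n x] Pin[of "G n x"]] c01(1)[of n x] by (simp add: g_def norm_mult)
  have "negligible (N \<union> (?Q - ?B))"
    by (intro negligible_Un N negligible_frontier_interval)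
  then have null: "N \<union> (?Q - ?B) \<in> null_sets lebesgue" by (simp add: negligible_iff_null_sets)
  have lim: "(\<lambda>n. (cmod (h x - g n x))\<^sup>2) \<longlonglongrightarrow> 0" if "x \<in> ?Q" "x \<notin> N \<union> (?Q - ?B)" for x
  proof -
    have "(\<lambda>n. ?P (G n x)) \<longlonglongrightarrow> ?P (h' x)"
      by (rule continuous_on_tendsto_compose[OF contP[of UNIV] G(2)]) (use that in auto)
    then have "(\<lambda>n. ?P (G n x)) \<longlonglongrightarrow> h x" using that h(2) by (simp add: h'_def Pid)
    then have "(\<lambda>n. g n x) \<longlonglongrightarrow> of_real 1 * h x"
      unfolding g_def using that by (intro tendsto_mult tendsto_of_real c1) auto
    then have "(\<lambda>n. (cmod (h x - g n x))\<^sup>2) \<longlonglongrightarrow> (cmod (h x - 1 * h x))\<^sup>2"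
      by (intro tendsto_intros) simp
    then show ?thesis by simp
  qed
  have "(\<lambda>n. LINT x|cube_measure. (cmod (h x - g n x))\<^sup>2) \<longlonglongrightarrow> (LINT x|(cube_measure :: (real^'n) measure). 0)"
  proof (rule integral_dominated_convergence[where w = "\<lambda>_. (2 * M)\<^sup>2"])
    have gm: "g n \<in> borel_measurable cube_measure" for n
      by (intro borel_measurable_integrable integrable_cube_continuous contg)
    then show "(\<lambda>x. (cmod (h x - g n x))\<^sup>2) \<in> borel_measurable cube_measure" for n
      using h(1) by measurable
    show "AE x in cube_measure. norm ((cmod (h x - g n x))\<^sup>2) \<le> (2 * M)\<^sup>2" for n
    proof (rule AE_I2)
      fix x
      have "cmod (h x - g n x) \<le> 2 * M"
        using norm_triangle_ineq4[of "h x" "g n x"] h(2)[of x] g_le[of n x] by linarith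
      then show "norm ((cmod (h x - g n x))\<^sup>2) \<le> (2 * M)\<^sup>2"
        by (simp only: real_norm_def abs_power2) (rule power_mono, simp_all)
    qed
    have "AE x in lebesgue. x \<in> ?Q \<longrightarrow> (\<lambda>n. (cmod (h x - g n x))\<^sup>2) \<longlonglongrightarrow> 0"
      by (rule AE_I'[OF null]) (use lim in auto)
    then show "AE x in cube_measure. (\<lambda>n. (cmod (h x - g n x))\<^sup>2) \<longlonglongrightarrow> 0"
      by (simp add: AE_restrict_space_iff)
  qed (auto intro: integrable_cube_const)
  then have "\<forall>\<^sub>F n in sequentially. (LINT x|cube_measure. (cmod (h x - g n x))\<^sup>2) < e"
    using e by (intro order_tendstoD(2)) auto
  then obtain n where "(LINT x|cube_measure. (cmod (h x - g n x))\<^sup>2) < e"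
    by (auto simp: eventually_sequentially)
  then show ?thesis using that[OF contg[of n]] c0 by (auto simp: g_def)
qed

lemma square_integrable_truncate:
  assumes f: "square_integrable f" and e: "0 < e"
  obtains n :: nat where "(LINT x|cube_measure. (cmod (f x - (if cmod (f x) \<le> n then f x else 0)))\<^sup>2) < e"
proof -
  let ?t = "\<lambda>(n::nat) x. if cmod (f x) \<le> n then f x else 0"
  have m: "f \<in> borel_measurable cube_measure" using f by (simp add: square_integrable_def)
  have "(\<lambda>n. LINT x|cube_measure. (cmod (f x - ?t n x))\<^sup>2) \<longlonglongrightarrow> (LINT x|(cube_measure :: (real^'a) measure). 0)"
  proof (rule integral_dominated_convergence[where w = "\<lambda>x. (cmod (f x))\<^sup>2"])
    show "(\<lambda>x. (cmod (f x - ?t n x))\<^sup>2) \<in> borel_measurable cube_measure" for n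
      using m by measurable
    show "AE x in cube_measure. (\<lambda>n. (cmod (f x - ?t n x))\<^sup>2) \<longlonglongrightarrow> 0"
    proof (rule AE_I2)
      fix x
      obtain n0 :: nat where n0: "cmod (f x) \<le> real n0" using real_arch_simple by blast
      have "(cmod (f x - ?t n x))\<^sup>2 = 0" if "n0 \<le> n" for n
        using order_trans[OF n0, of "real n"] that by simp
      then show "(\<lambda>n. (cmod (f x - ?t n x))\<^sup>2) \<longlonglongrightarrow> 0"
        by (intro tendsto_eventually) (unfold eventually_sequentially, blast)
    qed
  qed (use f in \<open>auto simp: square_integrable_def\<close>)
  then have "\<forall>\<^sub>F n in sequentially. (LINT x|cube_measure. (cmod (f x - ?t n x))\<^sup>2) < e"
    using e by (intro order_tendstoD(2)) auto
  then show ?thesis using that by (auto simp: eventually_sequentially)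
qed

text \<open>One third of \<open>e\<close> each is spent on truncating \<open>u\<close>, on passing
  to a continuous function that vanishes at the boundary, and on the uniform approximation of the
  latter.\<close>

lemma trig_poly_dense:
  fixes u :: "('n::finite) torus_L2"
  assumes e: "0 < e"
  obtains p where "trig_poly p" "norm (u - abs_torus_L2 p) < e"
proof -
  let ?f = "rep_torus_L2 u"
  note f = square_integrable_rep[of u]
  have e3: "0 < (e / 3)\<^sup>2" using e by simp
  obtain n :: nat where n: "(LINT x|cube_measure. (cmod (?f x - (if cmod (?f x) \<le> n then ?f x else 0)))\<^sup>2) < (e / 3)\<^sup>2"
    by (rule square_integrable_truncate[OF f e3])
  define h where "h x = (if cmod (?f x) \<le> n then ?f x else 0)" for x
  have hm: "h \<in> borel_measurable cube_measure"
  proof -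
    have [measurable]: "?f \<in> borel_measurable cube_measure"
      using f by (simp add: square_integrable_def)
    show ?thesis unfolding h_def by measurable
  qed
  have hb: "cmod (h x) \<le> n" for x by (simp add: h_def)
  have h: "square_integrable h"
    unfolding square_integrable_def
  proof
    show "integrable cube_measure (\<lambda>x. (cmod (h x))\<^sup>2)"
      by (rule finite_measure.integrable_const_bound[OF finite_measure_cube, of _ "(real n)\<^sup>2"])
        (use hm hb in \<open>auto intro!: AE_I2 power_mono\<close>)
  qed (rule hm)
  obtain g where g: "continuous_on UNIV g" "\<And>x. x \<notin> box 0 One \<Longrightarrow> g x = 0"
    "(LINT x|cube_measure. (cmod (h x - g x))\<^sup>2) < (e / 3)\<^sup>2"
    by (rule bounded_measurable_approx[OF hm hb e3], rule that)
  obtain p where p: "trig_poly p" "\<And>x. x \<in> cbox 0 One \<Longrightarrow> cmod (g x - p x) < e / 3"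
    by (rule trig_poly_approx[OF g(1,2), of "e / 3"]) (use e in auto)
  note sg = square_integrable_continuous[OF g(1)]
  note sp = square_integrable_continuous[OF trig_poly_continuous[OF p(1)]]
  have d: "square_integrable (\<lambda>x. a x - b x)" if "square_integrable a" "square_integrable b" for a b :: "real^'n \<Rightarrow> complex"
    using square_integrable_add[OF that(1) square_integrable_scale[OF that(2), of "- 1"]] by simp
  have lt: "norm (abs_torus_L2 a - abs_torus_L2 b) < e / 3"
    if "square_integrable a" "square_integrable b" "(LINT x|cube_measure. (cmod (a x - b x))\<^sup>2) < (e / 3)\<^sup>2"
    for a b :: "real^'n \<Rightarrow> complex"
    by (rule power_less_imp_less_base[of _ 2])
      (use that e in \<open>auto simp: abs_torus_L2_diff norm_abs_torus_L2_square d\<close>)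
  have 1: "norm (u - abs_torus_L2 h) < e / 3"
    using lt[OF f h] n by (simp add: h_def)
  have 2: "norm (abs_torus_L2 h - abs_torus_L2 g) < e / 3"
    by (rule lt[OF h sg g(3)])
  have 3: "norm (abs_torus_L2 g - abs_torus_L2 p) \<le> e / 3"
    unfolding abs_torus_L2_diff[OF sg sp]
    by (rule norm_abs_torus_L2_le[OF d[OF sg sp]]) (use p(2) e in \<open>auto intro: less_imp_le\<close>)
  have "norm (u - abs_torus_L2 p) \<le> norm (u - abs_torus_L2 h) + norm (abs_torus_L2 h - abs_torus_L2 g)
      + norm (abs_torus_L2 g - abs_torus_L2 p)"
    using norm_triangle_ineq[of "u - abs_torus_L2 h + (abs_torus_L2 h - abs_torus_L2 g)" "abs_torus_L2 g - abs_torus_L2 p"]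
      norm_triangle_ineq[of "u - abs_torus_L2 h" "abs_torus_L2 h - abs_torus_L2 g"] by simp
  with 1 2 3 have "norm (u - abs_torus_L2 p) < e" by simp
  with p(1) show ?thesis by (rule that)
qed

text \<open>If all coefficients vanish, \<open>u\<close> is orthogonal to every trigonometric
  polynomial, so one that is closer to \<open>u\<close> than \<open>norm u\<close> contradicts
  Cauchy-Schwarz.\<close>

lemma fourier_eq_0_imp:
  fixes u :: "('n::finite) torus_L2"
  assumes "fourier u = 0"
  shows "u = 0"
proof (rule ccontr)
  assume "u \<noteq> 0"
  then have pos: "0 < norm u" by simp
  obtain p where p: "trig_poly p" "norm (u - abs_torus_L2 p) < norm u"
    by (rule trig_poly_dense[OF pos])
  have t0: "tft u k = 0" for k
    using assms Rep_fourier[of u] by (simp add: zero_ell2.rep_eq fun_eq_iff)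
  have "u \<bullet> v = 0" if "v \<in> complex_vector.span (range torus_basis)" for v
    using that
  proof (induction rule: complex_vector.span_induct_alt)
    case (step c x y)
    then obtain k where "x = torus_basis k" by auto
    then show ?case using step by (simp add: inner_add_right inner_torus_basis t0)
  qed simp
  then have "u \<bullet> abs_torus_L2 p = 0" using trig_poly_in_span[OF p(1)] by blast
  then have "norm u * norm u = u \<bullet> (u - abs_torus_L2 p)"
    by (simp add: inner_diff_right norm_eq_sqrt_inner)
  also have "\<dots> \<le> norm u * norm (u - abs_torus_L2 p)" by (rule norm_cauchy_schwarz)
  also have "\<dots> < norm u * norm u" using p(2) pos by simp
  finally show False by simp
qed

lemma inj_fourier: "inj (fourier :: ('n::finite) torus_L2 \<Rightarrow> _)"
proof (rule injI)
  fix u v :: "'n torus_L2" assume "fourier u = fourier v"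
  then have "fourier (u - v) = 0" by (simp add: bounded_clinear_diff[OF bounded_clinear_fourier])
  then show "u = v" using fourier_eq_0_imp by fastforce
qed

text \<open>Density gives the uniqueness of the bounded extension behind \<open>pdo\<close>; testing
  on trigonometric polynomials is enough, as these are smooth.\<close>

lemma bounded_clinear_torus_eqI:
  fixes T T' :: "('n::finite) torus_L2 \<Rightarrow> 'n torus_L2"
  assumes T: "bounded_clinear T" "bounded_clinear T'" and eq: "\<And>p. trig_poly p \<Longrightarrow> T (abs_torus_L2 p) = T' (abs_torus_L2 p)"
  shows "T = T'"
proof
  fix u
  let ?D = "\<lambda>u. T u - T' u"
  have D: "bounded_linear ?D"
    by (rule bounded_clinear_bounded_linear[OF bounded_clinear_minus_fun[OF T]])
  obtain K where K: "0 < K" "\<And>x. norm (?D x) \<le> norm x * K"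
    using bounded_linear.pos_bounded[OF D] by blast
  have "norm (?D u) \<le> e" if e: "0 < e" for e
  proof -
    obtain p where p: "trig_poly p" "norm (u - abs_torus_L2 p) < e / K"
      by (rule trig_poly_dense[of "e / K" u]) (use e K in auto)
    have "?D u = ?D (u - abs_torus_L2 p)"
      using eq[OF p(1)] by (simp add: bounded_clinear_diff[OF T(1)] bounded_clinear_diff[OF T(2)])
    also have "norm \<dots> \<le> norm (u - abs_torus_L2 p) * K" by (rule K(2))
    also have "\<dots> \<le> e" using p(2) K(1) by (simp add: less_divide_eq less_imp_le)
    finally show ?thesis .
  qed
  then have "norm (?D u) \<le> 0" by (rule field_le_epsilon[of _ 0, simplified])
  then show "T u = T' u" by simp
qed


section \<open>Absolutely convergent Fourier series\<close>

definition fourier_series :: "(int^'n) ell2 \<Rightarrow> real^'n \<Rightarrow> complex" where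
  "fourier_series \<phi> x = (\<Sum>\<^sub>\<infinity>k. Rep_ell2 \<phi> k * torus_exp k x)"

text \<open>An explicit preimage under \<open>fourier\<close>; with injectivity it evaluates
  \<open>inv_into UNIV fourier\<close> on the images of operators in \<open>D2\<close>.\<close>

lemma
  fixes \<phi> :: "(int^'n) ell2"
  assumes \<phi>: "Rep_ell2 \<phi> abs_summable_on UNIV"
  shows continuous_fourier_series: "continuous_on UNIV (fourier_series \<phi>)"
    and fourier_fourier_series: "fourier (abs_torus_L2 (fourier_series \<phi>)) = \<phi>"
    and norm_fourier_series_le: "norm (abs_torus_L2 (fourier_series \<phi>)) \<le> (\<Sum>\<^sub>\<infinity>k. cmod (Rep_ell2 \<phi> k))"
proof -
  let ?s = "\<lambda>k x. Rep_ell2 \<phi> k * torus_exp k x"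
  have c: "continuous_on UNIV (?s k)" for k by (intro continuous_intros)
  have b: "cmod (?s k x) \<le> cmod (Rep_ell2 \<phi> k)" for k x by (simp add: norm_mult)
  note H = has_sum_torus_ft[of ?s, OF c b \<phi>, folded fourier_series_def]
  show cont: "continuous_on UNIV (fourier_series \<phi>)" by (rule H(1))
  note sq = square_integrable_continuous[OF cont]
  show "fourier (abs_torus_L2 (fourier_series \<phi>)) = \<phi>"
  proof (rule ell2_eqI)
    fix j
    have "torus_ft (?s k) j = (if k = j then Rep_ell2 \<phi> k else 0)" for k
    proof -
      have "torus_ft (?s k) j = Rep_ell2 \<phi> k * torus_ft (torus_exp k) j"
        unfolding torus_ft_eq by (simp add: mult.left_commute)
      then show ?thesis by (simp add: torus_ft_torus_exp)
    qed
    then have "((\<lambda>k. if k = j then Rep_ell2 \<phi> k else 0) has_sum torus_ft (fourier_series \<phi>) j) UNIV"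
      using H(2)[of j] by simp
    moreover have "((\<lambda>k. if k = j then Rep_ell2 \<phi> k else 0) has_sum Rep_ell2 \<phi> j) UNIV"
      by (rule has_sum_finite_neutralI[of "{j}"]) auto
    ultimately show "Rep_ell2 (fourier (abs_torus_L2 (fourier_series \<phi>))) j = Rep_ell2 \<phi> j"
      unfolding Rep_fourier tft_abs[OF sq] by (rule has_sum_unique)
  qed
  show "norm (abs_torus_L2 (fourier_series \<phi>)) \<le> (\<Sum>\<^sub>\<infinity>k. cmod (Rep_ell2 \<phi> k))"
  proof (rule norm_abs_torus_L2_le[OF sq])
    show "cmod (fourier_series \<phi> x) \<le> (\<Sum>\<^sub>\<infinity>k. cmod (Rep_ell2 \<phi> k))" for x
      unfolding fourier_series_def
      using norm_infsum_bound[of "\<lambda>k. ?s k x" UNIV] \<phi> by (simp add: norm_mult)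
  qed (simp add: infsum_nonneg)
qed


section \<open>Lattice weights, discrete symbols and the counterexample\<close>

section \<open>Weights on the lattice\<close>

definition weight :: "int^'n \<Rightarrow> real" where
  "weight k = 1 + norm (real_vec k)"

lemma weight_ge_1: "1 \<le> weight k"
  by (simp add: weight_def)

lemma weight_pos: "0 < weight k"
  using weight_ge_1[of k] by linarith

lemma weight_0 [simp]: "weight 0 = 1"
  by (simp add: weight_def real_vec_0)

lemma weight_shift:
  "weight (k + axis i 1) \<le> 2 * weight k"
  "weight k \<le> 2 * weight (k + axis i 1)"
proof -
  have n: "norm (axis i (1::real)) = 1" by (simp add: norm_axis_1)
  have 1: "norm (real_vec k + axis i 1) \<le> norm (real_vec k) + 1"
    using norm_triangle_ineq[of "real_vec k" "axis i 1"] by (simp add: n)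
  have 2: "norm (real_vec k) \<le> norm (real_vec k + axis i 1) + 1"
    using norm_triangle_ineq4[of "real_vec k + axis i 1" "axis i 1"] by (simp add: n)
  have 3: "1 + a \<le> 2 * (1 + b)" if "a \<le> b + 1" "0 \<le> b" for a b :: real using that by simp
  show "weight (k + axis i 1) \<le> 2 * weight k"
    unfolding weight_def real_vec_add real_vec_axis by (rule 3[OF 1 norm_ge_zero])
  show "weight k \<le> 2 * weight (k + axis i 1)"
    unfolding weight_def real_vec_add real_vec_axis by (rule 3[OF 2 norm_ge_zero])
qed

text \<open>A unit step changes the weight at most by a factor 2 either way, so orders of both signs
  survive it. Differences of products and reciprocals involve such shifted values.\<close>

lemma weight_shift_powr:
  "weight (k + axis i 1) powr s \<le> 2 powr \<bar>s\<bar> * weight k powr s"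
proof (cases "0 \<le> s")
  case True
  then have "weight (k + axis i 1) powr s \<le> (2 * weight k) powr s"
    using weight_shift(1)[of k i] weight_pos[of "k + axis i 1"] by (intro powr_mono2) auto
  also have "\<dots> = 2 powr \<bar>s\<bar> * weight k powr s"
    using True weight_pos[of k] by (simp add: powr_mult)
  finally show ?thesis .
next
  case False
  then have "weight (k + axis i 1) powr s \<le> (weight k / 2) powr s"
    using weight_shift(2)[of k i] weight_pos[of k] by (intro powr_mono2') auto
  also have "\<dots> = 2 powr \<bar>s\<bar> * weight k powr s"
    using False weight_pos[of k] by (simp add: powr_divide powr_minus field_simps)
  finally show ?thesis .
qed

lemma summable_on_int_powr:
  assumes "p < - 1"
  shows "(\<lambda>m::int. (1 + \<bar>real_of_int m\<bar>) powr p) summable_on UNIV"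
proof -
  let ?f = "\<lambda>m::int. (1 + \<bar>real_of_int m\<bar>) powr p"
  have "summable (\<lambda>n. real (Suc n) powr p)"
    using summable_ignore_initial_segment[of "\<lambda>n. real n powr p" 1] assms
    by (simp add: summable_real_powr_iff)
  then have n: "(\<lambda>n. (1 + real n) powr p) summable_on UNIV"
    by (intro summable_nonneg_imp_summable_on) (simp_all add: add.commute)
  have 1: "?f summable_on range int"
    using n summable_on_reindex[of int UNIV ?f] by (simp add: o_def)
  have "inj (\<lambda>n. - int n)" by (auto simp: inj_on_def)
  then have 2: "?f summable_on range (\<lambda>n. - int n)"
    using n summable_on_reindex[of "\<lambda>n. - int n" UNIV ?f] by (simp add: o_def)
  have "range int \<union> range (\<lambda>n. - int n) = UNIV"
  proof -
    have "m \<in> range int \<union> range (\<lambda>n. - int n)" for m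
      by (cases m rule: int_cases2) auto
    then show ?thesis by auto
  qed
  with summable_on_union[OF 1 2] show ?thesis by simp
qed

text \<open>With \<open>p = s / CARD('n)\<close> the weight to the power \<open>s\<close> is a
  product of equal factors, one per coordinate. As \<open>p\<close> is negative, each is at most the
  power of \<open>1 + \<bar>k $ i\<bar>\<close>, and the sum is dominated by a product of
  one-dimensional sums with \<open>p < - 1\<close>.\<close>

lemma summable_on_weight:
  assumes "s < - real CARD('n)"
  shows "(\<lambda>k :: int^'n. weight k powr s) summable_on UNIV"
proof -
  define p where "p = s / real CARD('n)"
  have n: "0 < real CARD('n)" by simp
  have p: "p < - 1" using assms n by (simp add: p_def divide_less_eq)
  let ?f = "\<lambda>(i::'n) (m::int). (1 + \<bar>real_of_int m\<bar>) powr p"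
  have "Infinite_Set_Sum.abs_summable_on (\<lambda>g. \<Prod>i\<in>UNIV. ?f i (g i)) (PiE UNIV (\<lambda>_::'n. UNIV))"
    by (rule abs_summable_on_prod_PiE)
      (use summable_on_int_powr[OF p] in \<open>auto simp: abs_summable_equivalent[symmetric]\<close>)
  then have "(\<lambda>g :: 'n \<Rightarrow> int. \<Prod>i\<in>UNIV. ?f i (g i)) summable_on UNIV"
    by (auto simp: abs_summable_equivalent[symmetric] abs_prod intro: abs_summable_summable)
  moreover have "bij_betw (\<lambda>k :: int^'n. \<lambda>i. k $ i) UNIV UNIV"
    by (rule bij_betw_byWitness[of _ vec_lambda]) auto
  ultimately have P: "(\<lambda>k :: int^'n. \<Prod>i\<in>UNIV. ?f i (k $ i)) summable_on UNIV"
    using summable_on_reindex_bij_betw[of "\<lambda>k :: int^'n. \<lambda>i. k $ i" UNIV UNIV "\<lambda>g. \<Prod>i\<in>UNIV. ?f i (g i)"] by simp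
  show ?thesis
  proof (rule summable_on_comparison_test[OF P])
    fix k :: "int^'n"
    have "weight k powr s = (\<Prod>i\<in>(UNIV :: 'n set). weight k powr p)"
    proof -
      have s: "s = p * real CARD('n)" by (simp add: p_def)
      have "0 < weight k powr p" using weight_pos[of k] by simp
      then show ?thesis unfolding s by (simp add: powr_powr[symmetric] powr_realpow)
    qed
    also have "\<dots> \<le> (\<Prod>i\<in>UNIV. ?f i (k $ i))"
    proof (rule prod_mono, intro conjI)
      fix i
      have "1 + \<bar>real_of_int (k $ i)\<bar> \<le> weight k"
        using component_le_norm_cart[of "real_vec k" i] by (simp add: weight_def)
      then show "weight k powr p \<le> ?f i (k $ i)"
        using p by (intro powr_mono2') auto
    qed simp
    finally show "weight k powr s \<le> (\<Prod>i\<in>UNIV. ?f i (k $ i))" .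
  qed simp
qed


section \<open>Discrete symbols\<close>

text \<open>Only differences of order at most \<open>N\<close> are controlled, so that products and reciprocals can be
  treated by induction on \<open>N\<close>.\<close>

definition dsym :: "nat \<Rightarrow> real \<Rightarrow> (int^'n \<Rightarrow> complex) set" where
  "dsym N \<mu> = {a. \<forall>\<alpha>. length \<alpha> \<le> N \<longrightarrow>
     (\<exists>C. \<forall>k. cmod (iter_diff \<alpha> a k) \<le> C * weight k powr (\<mu> - real (length \<alpha>)))}"

lemma iter_diff_Nil [simp]: "iter_diff [] a = a"
  by (simp add: iter_diff_def)

text \<open>\<open>foldr\<close> applies the last entry of the list first; peeling off there
  replaces \<open>a\<close> by \<open>forward_diff i a\<close>, which fits the induction on
  \<open>N\<close>.\<close>

lemma iter_diff_snoc: "iter_diff (\<alpha> @ [i]) a = iter_diff \<alpha> (forward_diff i a)"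
  by (simp add: iter_diff_def)

lemma dsym_0: "a \<in> dsym 0 \<mu> \<longleftrightarrow> (\<exists>C. \<forall>k. cmod (a k) \<le> C * weight k powr \<mu>)"
  by (simp add: dsym_def)

lemma dsym_imp_0:
  assumes "a \<in> dsym N \<mu>"
  shows "a \<in> dsym 0 \<mu>"
  unfolding dsym_def
proof (intro CollectI allI impI)
  fix \<alpha> :: "'a list" assume "length \<alpha> \<le> 0"
  then have "length \<alpha> \<le> N" by linarith
  then show "\<exists>C. \<forall>k. cmod (iter_diff \<alpha> a k) \<le> C * weight k powr (\<mu> - real (length \<alpha>))"
    using assms unfolding dsym_def by blast
qed

text \<open>With this recursion each closure property reduces to its order 0 case and a rule for a
  single difference.\<close>

lemma dsym_Suc:
  "a \<in> dsym (Suc N) \<mu> \<longleftrightarrow> a \<in> dsym 0 \<mu> \<and> (\<forall>i. forward_diff i a \<in> dsym N (\<mu> - 1))"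
proof
  assume a: "a \<in> dsym (Suc N) \<mu>"
  have "forward_diff i a \<in> dsym N (\<mu> - 1)" for i
    unfolding dsym_def
  proof (intro CollectI allI impI)
    fix \<alpha> :: "'a list" assume "length \<alpha> \<le> N"
    then have "length (\<alpha> @ [i]) \<le> Suc N" by simp
    then obtain C where "\<And>k. cmod (iter_diff (\<alpha> @ [i]) a k) \<le> C * weight k powr (\<mu> - real (length (\<alpha> @ [i])))"
      using a unfolding dsym_def by blast
    then show "\<exists>C. \<forall>k. cmod (iter_diff \<alpha> (forward_diff i a) k) \<le> C * weight k powr (\<mu> - 1 - real (length \<alpha>))"
      unfolding iter_diff_snoc by (intro exI[of _ C]) (simp add: algebra_simps)
  qed
  moreover have "a \<in> dsym 0 \<mu>" using a by (rule dsym_imp_0)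
  ultimately show "a \<in> dsym 0 \<mu> \<and> (\<forall>i. forward_diff i a \<in> dsym N (\<mu> - 1))" by blast
next
  assume a: "a \<in> dsym 0 \<mu> \<and> (\<forall>i. forward_diff i a \<in> dsym N (\<mu> - 1))"
  show "a \<in> dsym (Suc N) \<mu>"
    unfolding dsym_def
  proof (intro CollectI allI impI)
    fix \<alpha> :: "'a list" assume len: "length \<alpha> \<le> Suc N"
    show "\<exists>C. \<forall>k. cmod (iter_diff \<alpha> a k) \<le> C * weight k powr (\<mu> - real (length \<alpha>))"
    proof (cases \<alpha> rule: rev_cases)
      case Nil
      then show ?thesis using a by (simp add: dsym_0)
    next
      case (snoc \<alpha>' i)
      then have "length \<alpha>' \<le> N" using len by simp
      then obtain C where "\<And>k. cmod (iter_diff \<alpha>' (forward_diff i a) k) \<le> C * weight k powr (\<mu> - 1 - real (length \<alpha>'))"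
        using a unfolding dsym_def by blast
      then show ?thesis unfolding snoc iter_diff_snoc by (intro exI[of _ C]) (simp add: algebra_simps)
    qed
  qed
qed

lemma dsym_0D:
  assumes "a \<in> dsym 0 \<mu>"
  obtains C where "0 \<le> C" "\<And>k. cmod (a k) \<le> C * weight k powr \<mu>"
proof -
  obtain C where C: "\<And>k. cmod (a k) \<le> C * weight k powr \<mu>"
    using assms by (auto simp: dsym_0)
  have "0 \<le> C" using order_trans[OF norm_ge_zero C[of 0]] by simp
  with C show ?thesis using that by blast
qed

lemma dsym_Suc_imp: "a \<in> dsym (Suc N) \<mu> \<Longrightarrow> a \<in> dsym N \<mu>"
  by (simp add: dsym_def)

lemma dsym_order_mono:
  assumes "a \<in> dsym N \<mu>" "\<mu> \<le> \<rho>"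
  shows "a \<in> dsym N \<rho>"
  using assms
proof (induction N arbitrary: a \<mu> \<rho>)
  case 0
  then obtain C where C: "0 \<le> C" "\<And>k. cmod (a k) \<le> C * weight k powr \<mu>"
    by (auto elim: dsym_0D)
  have "cmod (a k) \<le> C * weight k powr \<rho>" for k
    by (rule order_trans[OF C(2)]) (intro mult_left_mono C(1) powr_mono 0 weight_ge_1)
  then show ?case by (auto simp: dsym_0)
next
  case (Suc N)
  have "forward_diff i a \<in> dsym N (\<rho> - 1)" for i
    by (rule Suc.IH[of _ "\<mu> - 1"]) (use Suc.prems in \<open>simp_all add: dsym_Suc\<close>)
  moreover have "a \<in> dsym 0 \<rho>"
    using Suc.IH[of a \<mu> \<rho>] dsym_Suc_imp[OF Suc.prems(1)] Suc.prems(2) dsym_imp_0 by blast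
  ultimately show ?case by (simp add: dsym_Suc)
qed

lemma dsym_add:
  assumes "a \<in> dsym N \<mu>" "b \<in> dsym N \<mu>"
  shows "(\<lambda>k. a k + b k) \<in> dsym N \<mu>"
proof -
  have 0: "(\<lambda>k. a k + b k) \<in> dsym 0 \<mu>" if ab: "a \<in> dsym 0 \<mu>" "b \<in> dsym 0 \<mu>" for a b :: "int^'a \<Rightarrow> complex" and \<mu>
  proof -
    obtain C D where C: "\<And>k. cmod (a k) \<le> C * weight k powr \<mu>"
      and D: "\<And>k. cmod (b k) \<le> D * weight k powr \<mu>"
      using ab by (auto simp: dsym_0)
    have "cmod (a k + b k) \<le> (C + D) * weight k powr \<mu>" for k
      using norm_triangle_ineq[of "a k" "b k"] C[of k] D[of k] by (simp add: distrib_right)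
    then show ?thesis by (auto simp: dsym_0)
  qed
  show ?thesis using assms
  proof (induction N arbitrary: a b \<mu>)
    case (Suc N)
    have "forward_diff i (\<lambda>k. a k + b k) = (\<lambda>k. forward_diff i a k + forward_diff i b k)" for i
      by (simp add: fun_eq_iff forward_diff_def)
    with Suc 0 show ?case by (auto simp: dsym_Suc)
  qed (rule 0)
qed

lemma forward_diff_shift: "forward_diff j (\<lambda>k. a (k + e)) = (\<lambda>k. forward_diff j a (k + e))"
  by (simp add: fun_eq_iff forward_diff_def add_ac)

lemma dsym_shift:
  assumes "a \<in> dsym N \<mu>"
  shows "(\<lambda>k. a (k + axis i 1)) \<in> dsym N \<mu>"
  using assms
proof (induction N arbitrary: a \<mu>)
  case 0
  then obtain C where C: "0 \<le> C" "\<And>k. cmod (a k) \<le> C * weight k powr \<mu>"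
    by (auto elim: dsym_0D)
  have "cmod (a (k + axis i 1)) \<le> (C * 2 powr \<bar>\<mu>\<bar>) * weight k powr \<mu>" for k
    using order_trans[OF C(2)[of "k + axis i 1"] mult_left_mono[OF weight_shift_powr C(1)]]
    by (simp add: mult.assoc)
  then show ?case by (auto simp: dsym_0)
next
  case (Suc N)
  have "(\<lambda>k. a (k + axis i 1)) \<in> dsym 0 \<mu>"
    using Suc.IH[of a \<mu>] dsym_Suc_imp[OF Suc.prems] dsym_imp_0 by blast
  with Suc show ?case by (simp add: dsym_Suc forward_diff_shift)
qed

text \<open>Discrete Leibniz rule; one factor is evaluated at the neighbouring lattice point, which
  \<open>dsym_shift\<close> allows.\<close>

lemma dsym_mult:
  assumes "a \<in> dsym N \<mu>" "b \<in> dsym N \<rho>"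
  shows "(\<lambda>k. a k * b k) \<in> dsym N (\<mu> + \<rho>)"
proof -
  have 0: "(\<lambda>k. a k * b k) \<in> dsym 0 (\<mu> + \<rho>)" if ab: "a \<in> dsym 0 \<mu>" "b \<in> dsym 0 \<rho>" for a b :: "int^'a \<Rightarrow> complex" and \<mu> \<rho>
  proof -
    obtain C D where C: "0 \<le> C" "\<And>k. cmod (a k) \<le> C * weight k powr \<mu>"
      and D: "0 \<le> D" "\<And>k. cmod (b k) \<le> D * weight k powr \<rho>"
      using ab by (auto elim!: dsym_0D)
    have "cmod (a k * b k) \<le> (C * D) * weight k powr (\<mu> + \<rho>)" for k
      using mult_mono[OF C(2)[of k] D(2)[of k]] C(1) by (simp add: norm_mult powr_add mult_ac)
    then show ?thesis by (auto simp: dsym_0)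
  qed
  show ?thesis using assms
  proof (induction N arbitrary: a b \<mu> \<rho>)
    case (Suc N)
    have "forward_diff i (\<lambda>k. a k * b k) \<in> dsym N (\<mu> + \<rho> - 1)" for i
    proof -
      have eq: "forward_diff i (\<lambda>k. a k * b k)
          = (\<lambda>k. forward_diff i a k * b (k + axis i 1) + a k * forward_diff i b k)"
        by (simp add: fun_eq_iff forward_diff_def algebra_simps)
      have "(\<lambda>k. forward_diff i a k * b (k + axis i 1)) \<in> dsym N ((\<mu> - 1) + \<rho>)"
        using Suc.prems(1) dsym_shift[OF dsym_Suc_imp[OF Suc.prems(2)]] by (intro Suc.IH) (simp_all add: dsym_Suc)
      moreover have "(\<lambda>k. a k * forward_diff i b k) \<in> dsym N (\<mu> + (\<rho> - 1))"
        using dsym_Suc_imp[OF Suc.prems(1)] Suc.prems(2) by (intro Suc.IH) (simp_all add: dsym_Suc)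
      ultimately show ?thesis
        unfolding eq by (intro dsym_add) (simp_all add: algebra_simps)
    qed
    moreover have "(\<lambda>k. a k * b k) \<in> dsym 0 (\<mu> + \<rho>)"
      by (rule 0) (use Suc.prems in \<open>auto intro: dsym_imp_0\<close>)
    ultimately show ?case by (simp add: dsym_Suc)
  qed (rule 0)
qed

lemma dsym_zero: "(\<lambda>k :: int^'n. 0) \<in> dsym N \<mu>"
proof (induction N arbitrary: \<mu>)
  case (Suc N)
  have "forward_diff i (\<lambda>k :: int^'n. 0) = (\<lambda>k. 0)" for i by (simp add: fun_eq_iff forward_diff_def)
  with Suc show ?case by (auto simp: dsym_Suc dsym_0 intro!: exI[of _ 0])
qed (auto simp: dsym_0 intro!: exI[of _ 0])

lemma dsym_const: "(\<lambda>k :: int^'n. c) \<in> dsym N 0"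
proof (cases N)
  case (Suc M)
  have "forward_diff i (\<lambda>k :: int^'n. c) = (\<lambda>k. 0)" for i by (simp add: fun_eq_iff forward_diff_def)
  then show ?thesis using weight_pos less_imp_neq[OF weight_pos]
    by (auto simp: Suc dsym_Suc dsym_0 dsym_zero intro!: exI[of _ "cmod c"])
qed (use less_imp_neq[OF weight_pos] in \<open>auto simp: dsym_0 intro!: exI[of _ "cmod c"]\<close>)

lemma dsym_coord: "(\<lambda>k :: int^'n. of_int (k $ j)) \<in> dsym N 1"
proof -
  have "cmod (of_int (k $ j)) \<le> 1 * weight k powr 1" for k :: "int^'n"
    using component_le_norm_cart[of "real_vec k" j] weight_pos[of k] by (simp add: weight_def)
  then have 0: "(\<lambda>k. of_int (k $ j)) \<in> dsym 0 1" unfolding dsym_0 by blast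
  show ?thesis
  proof (cases N)
    case (Suc M)
    have "forward_diff i (\<lambda>k :: int^'n. of_int (k $ j)) = (\<lambda>k. of_int (axis i 1 $ j))" for i
      by (simp add: fun_eq_iff forward_diff_def)
    with 0 show ?thesis by (simp add: Suc dsym_Suc dsym_const)
  qed (use 0 in simp)
qed

lemma dsym_power: "a \<in> dsym N \<mu> \<Longrightarrow> (\<lambda>k. a k ^ m) \<in> dsym N (real m * \<mu>)"
proof (induction m)
  case (Suc m)
  then show ?case using dsym_mult[OF Suc.prems Suc.IH[OF Suc.prems]] by (simp add: algebra_simps)
qed (simp add: dsym_const)

lemma dsym_sum:
  "finite I \<Longrightarrow> (\<And>i. i \<in> I \<Longrightarrow> a i \<in> dsym N \<mu>) \<Longrightarrow> (\<lambda>k. \<Sum>i\<in>I. a i k) \<in> dsym N \<mu>"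
  by (induction I rule: finite_induct) (auto intro: dsym_zero dsym_add)

text \<open>Discrete quotient rule: the difference of \<open>1 / a\<close> is minus
  \<open>forward_diff i a\<close> times \<open>1 / a\<close> at \<open>k\<close> and at its
  neighbour, of order \<open>\<mu> - 1 - 2 * \<mu>\<close>. The induction hypothesis handles both
  reciprocals. The lower bound is ellipticity: it gives the order 0 estimate and excludes
  zeros.\<close>

lemma dsym_inverse:
  assumes a: "\<And>N. a \<in> dsym N \<mu>" and c: "0 < c" "\<And>k. c * weight k powr \<mu> \<le> cmod (a k)"
  shows "(\<lambda>k. 1 / a k) \<in> dsym N (- \<mu>)"
proof (induction N)
  case 0
  have "cmod (1 / a k) \<le> (1 / c) * weight k powr (- \<mu>)" for k
  proof -
    have pos: "0 < c * weight k powr \<mu>" using c(1) weight_pos[of k] by simp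
    have "1 / cmod (a k) \<le> 1 / (c * weight k powr \<mu>)"
      using c(2)[of k] pos by (intro frac_le) auto
    then show ?thesis by (simp add: norm_divide powr_minus divide_simps)
  qed
  then show ?case unfolding dsym_0 by blast
next
  case (Suc N)
  have nz: "a k \<noteq> 0" for k
    using c(2)[of k] c(1) weight_pos[of k] by (auto simp: mult_le_0_iff)
  have "forward_diff i (\<lambda>k. 1 / a k) \<in> dsym N (- \<mu> - 1)" for i
  proof -
    have eq: "forward_diff i (\<lambda>k. 1 / a k)
        = (\<lambda>k. (- 1) * (forward_diff i a k * ((1 / a k) * (1 / a (k + axis i 1)))))"
      using nz by (simp add: fun_eq_iff forward_diff_def field_simps)
    have "forward_diff i a \<in> dsym N (\<mu> - 1)" using a[of "Suc N"] by (simp add: dsym_Suc)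
    note D = dsym_mult[OF dsym_const[of "- 1"] dsym_mult[OF this dsym_mult[OF Suc dsym_shift[OF Suc]]]]
    have ord: "- \<mu> - 1 = 0 + (\<mu> - 1 + (- \<mu> + - \<mu>))" by simp
    show ?thesis unfolding eq ord by (rule D)
  qed
  with Suc show ?case by (simp add: dsym_Suc dsym_imp_0)
qed

text \<open>A rational function of \<open>k\<close>, so that all its differences are controlled by
  the rules for products and reciprocals alone.\<close>

definition sharp_symbol :: "'n \<Rightarrow> int^'n \<Rightarrow> complex" where
  "sharp_symbol i k = (of_int (k $ i)) ^ CARD('n) * (1 / (1 + (\<Sum>j\<in>UNIV. (of_int (k $ j))\<^sup>2))) ^ CARD('n)"

lemma norm_real_vec_square: "(norm (real_vec k))\<^sup>2 = (\<Sum>j\<in>UNIV. (real_of_int (k $ j))\<^sup>2)"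
  unfolding power2_norm_eq_inner inner_vec_def by (simp add: power2_eq_square)

lemma sharp_symbol_dsym: "sharp_symbol (i :: 'n::finite) \<in> dsym N (- real CARD('n))"
proof -
  let ?q = "\<lambda>k :: int^'n. 1 + (\<Sum>j\<in>UNIV. (complex_of_int (k $ j))\<^sup>2)"
  have q: "?q \<in> dsym N 2" for N
  proof (rule dsym_add)
    show "(\<lambda>k. 1) \<in> dsym N 2" by (rule dsym_order_mono[OF dsym_const]) simp
    show "(\<lambda>k. \<Sum>j\<in>UNIV. (complex_of_int (k $ j))\<^sup>2) \<in> dsym N 2"
      using dsym_power[OF dsym_coord, where m = 2] by (intro dsym_sum) simp_all
  qed
  \<comment> \<open>The constant comes from (1 + t)^2 \<le> 2 (1 + t^2).\<close>
  have "(1 / 2) * weight k powr 2 \<le> cmod (?q k)" for k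
  proof -
    have "?q k = complex_of_real (1 + (norm (real_vec k))\<^sup>2)" by (simp add: norm_real_vec_square)
    then have "cmod (?q k) = 1 + (norm (real_vec k))\<^sup>2" by (simp only: norm_of_real) simp
    moreover have "(weight k)\<^sup>2 \<le> 2 * (1 + (norm (real_vec k))\<^sup>2)"
      using sum_squares_bound[of 1 "norm (real_vec k)"] by (simp add: weight_def power2_sum)
    ultimately show ?thesis using weight_pos[of k] by (simp add: powr_numeral)
  qed
  then have "(\<lambda>k. 1 / ?q k) \<in> dsym N (- 2)"
    by (intro dsym_inverse[OF q, where c = "1 / 2"]) auto
  from dsym_mult[OF dsym_power[OF dsym_coord[of i], where m = "CARD('n)"] dsym_power[OF this, where m = "CARD('n)"]]
  show ?thesis unfolding sharp_symbol_def[abs_def] by simp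
qed

text \<open>The layer \<open>P m\<close> fixes coordinate \<open>i\<close> at \<open>m\<close> and
  lets the others run from 1 to \<open>m\<close>. Its m^(n-1) points carry values of modulus at
  least c / m^n, so it contributes at least c / m; the layers are disjoint.\<close>

lemma sharp_symbol_not_summable: "\<not> (sharp_symbol (i :: 'n::finite)) abs_summable_on UNIV"
proof
  let ?n = "CARD('n)"
  assume s: "sharp_symbol i abs_summable_on UNIV"
  define T where "T m = (\<lambda>j. if j = i then {int m} else {1..int m})" for m
  define P where "P m = vec_lambda ` (PiE UNIV (T m))" for m
  have finP: "finite (P m)" for m
    unfolding P_def T_def by (intro finite_imageI finite_PiE) auto
  have inj: "inj_on vec_lambda A" for A :: "('n \<Rightarrow> int) set" by (rule inj_onI) (simp add: vec_lambda_inject)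
  have cardP: "card (P m) = m ^ (?n - 1)" for m
  proof -
    have "card (P m) = (\<Prod>j\<in>UNIV. card (T m j))"
      unfolding P_def card_image[OF inj] by (rule card_PiE) simp
    also have "\<dots> = (\<Prod>j\<in>UNIV - {i}. card (T m j))"
      by (rule prod.mono_neutral_right) (auto simp: T_def)
    also have "\<dots> = (\<Prod>j\<in>UNIV - {i}. m)" by (rule prod.cong) (auto simp: T_def)
    finally show ?thesis by (simp add: card_Diff_singleton)
  qed
  have memP: "k $ i = int m" "\<And>j. 0 \<le> k $ j \<and> k $ j \<le> int m" if k: "k \<in> P m" for k m
  proof -
    obtain g where g: "g \<in> PiE UNIV (T m)" "k = vec_lambda g" using k unfolding P_def by blast
    have T: "g j \<in> T m j" for j using g(1) by auto
    show "k $ i = int m" using T[of i] by (simp add: g(2) T_def)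
    show "0 \<le> k $ j \<and> k $ j \<le> int m" for j
      using T[of j] by (cases "j = i") (auto simp: g(2) T_def)
  qed
  \<comment> \<open>On \<open>P m\<close> one has 1 + |k|^2 \<le> (1 + n) m^2, so the base of the
    n-th power is at least 1 / ((1 + n) m).\<close>
  define c where "c = 1 / (1 + real ?n) ^ ?n"
  have c: "0 < c" by (simp add: c_def)
  have lower: "c / real m ^ ?n \<le> cmod (sharp_symbol i k)" if k: "k \<in> P m" and m: "1 \<le> m" for k m
  proof -
    have "(\<Sum>j\<in>UNIV. (real_of_int (k $ j))\<^sup>2) \<le> (\<Sum>j\<in>(UNIV :: 'n set). (real m)\<^sup>2)"
    proof (rule sum_mono)
      fix j
      have "0 \<le> k $ j" "k $ j \<le> int m" using memP(2)[OF k] by auto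
      then have "\<bar>real_of_int (k $ j)\<bar> \<le> real m" by linarith
      then show "(real_of_int (k $ j))\<^sup>2 \<le> (real m)\<^sup>2" by (metis abs_le_square_iff abs_of_nat)
    qed
    then have "(\<Sum>j\<in>UNIV. (real_of_int (k $ j))\<^sup>2) \<le> real ?n * (real m)\<^sup>2" by simp
    moreover have "1 \<le> (real m)\<^sup>2" using m by simp
    ultimately have le: "1 + (\<Sum>j\<in>UNIV. (real_of_int (k $ j))\<^sup>2) \<le> (1 + real ?n) * (real m)\<^sup>2"
      unfolding distrib_right mult_1_left by linarith
    have pos: "0 < 1 + (\<Sum>j\<in>UNIV. (real_of_int (k $ j))\<^sup>2)"
      by (rule add_pos_nonneg) (auto intro: sum_nonneg)
    have "sharp_symbol i k = complex_of_real ((real m / (1 + (\<Sum>j\<in>UNIV. (real_of_int (k $ j))\<^sup>2))) ^ ?n)"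
      by (simp add: sharp_symbol_def memP(1)[OF k] power_divide)
    then have "cmod (sharp_symbol i k) = (real m / (1 + (\<Sum>j\<in>UNIV. (real_of_int (k $ j))\<^sup>2))) ^ ?n"
      using pos by (simp only: norm_of_real) (simp add: less_imp_le)
    moreover have "(real m / ((1 + real ?n) * (real m)\<^sup>2)) ^ ?n
        \<le> (real m / (1 + (\<Sum>j\<in>UNIV. (real_of_int (k $ j))\<^sup>2))) ^ ?n"
      using le pos m by (intro power_mono divide_left_mono mult_pos_pos) auto
    moreover have "(real m / ((1 + real ?n) * (real m)\<^sup>2)) ^ ?n = c / real m ^ ?n"
      using m by (simp add: c_def power2_eq_square power_divide power_mult_distrib)
    ultimately show ?thesis by simp
  qed
  have block: "c / real m \<le> (\<Sum>k\<in>P m. cmod (sharp_symbol i k))" if m: "1 \<le> m" for m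
  proof -
    have "real m ^ ?n = real m * real m ^ (?n - 1)"
      using power_Suc[of "real m" "?n - 1"] by simp
    then have "c / real m = real (card (P m)) * (c / real m ^ ?n)"
      using m by (simp add: cardP)
    also have "\<dots> \<le> (\<Sum>k\<in>P m. cmod (sharp_symbol i k))"
      by (rule sum_bounded_below) (rule lower[OF _ m])
    finally show ?thesis .
  qed
  have disj: "P m \<inter> P m' = {}" if m: "m \<noteq> m'" for m m'
  proof -
    have False if "k \<in> P m" "k \<in> P m'" for k
      using memP(1)[OF that(1)] memP(1)[OF that(2)] m by simp
    then show ?thesis by blast
  qed
  let ?S = "\<Sum>\<^sub>\<infinity>k. cmod (sharp_symbol i k)"
  have bound: "(\<Sum>m<M. inverse (real (Suc m))) \<le> ?S / c" for M
  proof -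
    have "(\<Sum>m<M. c / real (Suc m)) \<le> (\<Sum>m<M. \<Sum>k\<in>P (Suc m). cmod (sharp_symbol i k))"
      by (intro sum_mono block) simp
    also have "\<dots> = (\<Sum>k\<in>(\<Union>m<M. P (Suc m)). cmod (sharp_symbol i k))"
      by (rule sum.UNION_disjoint[symmetric]) (auto simp: finP disj)
    also have "\<dots> \<le> ?S"
      by (rule finite_sum_le_infsum[OF s]) (auto simp: finP)
    finally have "c * (\<Sum>m<M. inverse (real (Suc m))) \<le> ?S"
      by (simp add: sum_distrib_left divide_inverse)
    then show ?thesis using c by (simp add: le_divide_eq mult.commute)
  qed
  have "summable (\<lambda>m. inverse (real (Suc m)))"
    by (rule summableI_nonneg_bounded[OF _ bound]) simp
  then have "summable (\<lambda>m. inverse (real m))"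
    by (subst (asm) summable_Suc_iff)
  then show False using not_summable_harmonic[where 'a = real] by simp
qed


section \<open>Trigonometric polynomials are smooth\<close>

lemma trig_poly_has_vector_derivative:
  assumes "trig_poly p"
  shows "\<exists>q. trig_poly q \<and> (\<forall>x. ((\<lambda>t. p (x + t *\<^sub>R axis i 1)) has_vector_derivative q x) (at 0))"
  using assms
proof (induction rule: trig_poly.induct)
  case (exp c k)
  let ?z = "2 * pi * \<i> * of_int (k $ i)"
  have "((\<lambda>t. c * torus_exp k (x + t *\<^sub>R axis i 1)) has_vector_derivative (c * ?z) * torus_exp k x) (at 0)" for x
  proof -
    have "((\<lambda>w. c * (exp (w * ?z) * torus_exp k x)) has_field_derivative (c * ?z) * torus_exp k x) (at (of_real 0))"
      by (auto intro!: derivative_eq_intros)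
    then have "((\<lambda>t. c * (exp (of_real t * ?z) * torus_exp k x)) has_vector_derivative (c * ?z) * torus_exp k x) (at 0)"
      by (rule has_vector_derivative_real_field)
    moreover have "exp (of_real t * ?z) = cis (2 * pi * t * real_of_int (k $ i))" for t
      unfolding cis_conv_exp by (rule arg_cong[where f = exp]) simp
    ultimately show ?thesis by (simp only: torus_exp_translate)
  qed
  then show ?case using trig_poly.exp[of "c * ?z" k] by blast
next
  case (add f g)
  then obtain f' g' where fg: "trig_poly f'" "trig_poly g'"
    "\<And>x. ((\<lambda>t. f (x + t *\<^sub>R axis i 1)) has_vector_derivative f' x) (at 0)"
    "\<And>x. ((\<lambda>t. g (x + t *\<^sub>R axis i 1)) has_vector_derivative g' x) (at 0)" by blast
  show ?case
    by (intro exI[of _ "\<lambda>x. f' x + g' x"] conjI allI trig_poly.add fg has_vector_derivative_add)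
qed

lemma trig_poly_partial_deriv:
  assumes "trig_poly p"
  shows "trig_poly (partial_deriv i p)"
proof -
  obtain q where "trig_poly q" "\<And>x. ((\<lambda>t. p (x + t *\<^sub>R axis i 1)) has_vector_derivative q x) (at 0)"
    using trig_poly_has_vector_derivative[OF assms, of i] by blast
  moreover from this have "partial_deriv i p = q"
    by (simp add: fun_eq_iff partial_deriv_def vector_derivative_at)
  ultimately show ?thesis by simp
qed

lemma trig_poly_iter_deriv: "trig_poly p \<Longrightarrow> trig_poly (iter_deriv \<beta> p)"
  by (induction \<beta>) (auto simp: iter_deriv_def intro: trig_poly_partial_deriv)

lemma trig_poly_periodic: "trig_poly p \<Longrightarrow> p (x + real_vec m) = p x"
  by (induction rule: trig_poly.induct) (simp_all add: torus_exp_periodic)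

lemma trig_poly_torus_smooth:
  assumes p: "trig_poly p"
  shows "p \<in> torus_smooth"
  unfolding torus_smooth_def
proof (intro CollectI conjI allI)
  show "p (x + real_vec m) = p x" for x m by (rule trig_poly_periodic[OF p])
  show "continuous_on UNIV (iter_deriv \<beta> p)" for \<beta>
    by (rule trig_poly_continuous[OF trig_poly_iter_deriv[OF p]])
  show "(\<lambda>t. iter_deriv \<beta> p (x + t *\<^sub>R axis i 1)) differentiable (at 0)" for \<beta> i x
    using trig_poly_has_vector_derivative[OF trig_poly_iter_deriv[OF p, of \<beta>], of i] differentiableI_vector by blast
qed

lemma iter_deriv_const: "iter_deriv \<beta> (\<lambda>y. c) = (\<lambda>y. if \<beta> = [] then c else 0)"
proof (induction \<beta>)
  case (Cons i \<beta>)
  have "partial_deriv i (\<lambda>y. d) = (\<lambda>y. 0)" for d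
    by (simp add: partial_deriv_def fun_eq_iff)
  with Cons show ?case by (simp add: iter_deriv_def)
qed (simp add: iter_deriv_def)

lemma sharp_symbol_in_symbol_class: "(\<lambda>x. sharp_symbol (i :: 'n::finite)) \<in> symbol_class (- real CARD('n))"
  unfolding symbol_class_def
proof (intro CollectI conjI allI)
  show "(\<lambda>x. sharp_symbol i k) \<in> torus_smooth" for k
    by (rule trig_poly_torus_smooth[OF trig_poly_const])
  fix \<alpha> \<beta> :: "'n list"
  obtain C where C: "\<And>k. cmod (iter_diff \<alpha> (sharp_symbol i) k) \<le> C * weight k powr (- real CARD('n) - real (length \<alpha>))"
    using sharp_symbol_dsym[of i "length \<alpha>"] unfolding dsym_def by blast
  \<comment> \<open>The sign matters for nonempty \<beta>, where the derivative is 0 and the bound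
    must be nonnegative.\<close>
  have "0 \<le> C" using order_trans[OF norm_ge_zero C[of 0]] by simp
  then have C0: "0 \<le> C * weight k powr s" for k :: "int^'n" and s by simp
  show "\<exists>C. \<forall>x k. cmod (iter_deriv \<beta> (\<lambda>y. iter_diff \<alpha> (sharp_symbol i) k) x)
        \<le> C * (1 + norm (real_vec k)) powr (- real CARD('n) - real (length \<alpha>))"
    unfolding weight_def[symmetric] iter_deriv_const
    by (rule exI[of _ C]) (use C C0 in auto)
qed


section \<open>Pseudo-differential operators as conjugated matrices\<close>

section \<open>The matrix of a pseudo-differential operator\<close>

definition symbol_matrix :: "(real^'n \<Rightarrow> int^'n \<Rightarrow> complex) \<Rightarrow> int^'n \<Rightarrow> int^'n \<Rightarrow> complex" where
  "symbol_matrix \<sigma> j k = symbol_ft \<sigma> (j - k) k"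

lemma symbol_class_smooth: "\<sigma> \<in> symbol_class \<nu> \<Longrightarrow> (\<lambda>x. \<sigma> x k) \<in> torus_smooth"
  by (simp add: symbol_class_def)

lemma symbol_class_bound:
  assumes "\<sigma> \<in> symbol_class \<nu>"
  obtains C where "\<And>x k. cmod (iter_deriv \<beta> (\<lambda>y. \<sigma> y k) x) \<le> C * weight k powr \<nu>"
proof -
  have "\<forall>\<alpha> \<beta>. \<exists>C. \<forall>x k. cmod (iter_deriv \<beta> (\<lambda>y. iter_diff \<alpha> (\<sigma> y) k) x)
        \<le> C * (1 + norm (real_vec k)) powr (\<nu> - real (length \<alpha>))"
    using assms by (simp add: symbol_class_def)
  from this[rule_format, of \<beta> "[]"] show ?thesis
    using that by (auto simp: weight_def)
qed

text \<open>One derivative more than the dimension makes the decay in \<open>l\<close> summable over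
  the lattice, uniformly in \<open>k\<close> up to the factor
  \<open>weight k powr \<nu>\<close>.\<close>

lemma symbol_ft_bound:
  fixes \<sigma> :: "real^'n \<Rightarrow> int^'n \<Rightarrow> complex"
  assumes \<sigma>: "\<sigma> \<in> symbol_class \<nu>"
  obtains K where "0 \<le> K"
    "\<And>l k. cmod (symbol_ft \<sigma> l k) \<le> K * weight l powr (- real (Suc CARD('n))) * weight k powr \<nu>"
proof -
  let ?N = "Suc CARD('n)"
  obtain C0 where C0: "\<And>x k. cmod (iter_deriv [] (\<lambda>y. \<sigma> y k) x) \<le> C0 * weight k powr \<nu>"
    by (rule symbol_class_bound[OF \<sigma>], rule that)
  have "\<exists>C. \<forall>x k. cmod (iter_deriv (replicate ?N i) (\<lambda>y. \<sigma> y k) x) \<le> C * weight k powr \<nu>" for i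
    using symbol_class_bound[OF \<sigma>, of "replicate ?N i"] by metis
  then obtain C1 where C1: "\<And>i x k. cmod (iter_deriv (replicate ?N i) (\<lambda>y. \<sigma> y k) x) \<le> C1 i * weight k powr \<nu>"
    by metis
  \<comment> \<open>A single constant for the symbol and its pure derivatives in all directions, as
    \<open>torus_ft_decay\<close> requires.\<close>
  define C where "C = \<bar>C0\<bar> + (\<Sum>i\<in>UNIV. \<bar>C1 i\<bar>)"
  have CC: "C0 \<le> C" "C1 i \<le> C" "0 \<le> C" for i
  proof -
    have s: "0 \<le> (\<Sum>i\<in>UNIV. \<bar>C1 i\<bar>)" by (rule sum_nonneg) simp
    then show "C0 \<le> C" "0 \<le> C" unfolding C_def by linarith+
    have "\<bar>C1 i\<bar> \<le> (\<Sum>i\<in>UNIV. \<bar>C1 i\<bar>)" by (rule member_le_sum) auto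
    then show "C1 i \<le> C" by (simp add: C_def)
  qed
  let ?K = "C * (1 + real CARD('n)) ^ ?N"
  have "cmod (symbol_ft \<sigma> l k) \<le> ?K * weight l powr (- real ?N) * weight k powr \<nu>" for l k
  proof -
    let ?B = "C * weight k powr \<nu>"
    have "cmod (symbol_ft \<sigma> l k) * weight l ^ ?N \<le> ?B * (1 + real CARD('n)) ^ ?N"
      unfolding symbol_ft_def weight_def[of l]
    proof (rule torus_ft_decay[OF symbol_class_smooth[OF \<sigma>]])
      show "cmod (\<sigma> x k) \<le> ?B" for x
        using order_trans[OF C0[of k x] mult_right_mono[OF CC(1)]] by (simp add: iter_deriv_def)
      show "cmod (iter_deriv (replicate ?N i) (\<lambda>x. \<sigma> x k) x) \<le> ?B" for i x
        by (rule order_trans[OF C1 mult_right_mono[OF CC(2)]]) simp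
    qed
    then have "cmod (symbol_ft \<sigma> l k) \<le> ?B * (1 + real CARD('n)) ^ ?N / weight l ^ ?N"
      using weight_pos[of l] by (simp add: le_divide_eq)
    also have "\<dots> = ?K * weight l powr (- real ?N) * weight k powr \<nu>"
      using weight_pos[of l] by (simp only: powr_minus powr_realpow divide_inverse mult_ac)
    finally show ?thesis .
  qed
  then show ?thesis using that[of ?K] CC(3) by simp
qed

text \<open>Both claims rest on the bound \<open>(K * ?Z) * weight k powr \<nu>\<close> for the
  \<ell>1 norm of column \<open>k\<close>: its square is summable when \<open>2 * \<nu>\<close> is
  below - n, the bound itself when \<nu> is.\<close>

lemma symbol_matrix_summable:
  fixes \<sigma> :: "real^'n \<Rightarrow> int^'n \<Rightarrow> complex"
  assumes \<sigma>: "\<sigma> \<in> symbol_class \<nu>"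
  shows "\<nu> < - real CARD('n) / 2 \<Longrightarrow> col_ell2 (symbol_matrix \<sigma>)"
    and "\<nu> < - real CARD('n) \<Longrightarrow> (\<lambda>(j, k). symbol_matrix \<sigma> j k) abs_summable_on UNIV"
proof -
  obtain K where K: "0 \<le> K"
    "\<And>l k. cmod (symbol_ft \<sigma> l k) \<le> K * weight l powr (- real (Suc CARD('n))) * weight k powr \<nu>"
    by (rule symbol_ft_bound[OF \<sigma>], rule that)
  let ?f = "\<lambda>l :: int^'n. weight l powr (- real (Suc CARD('n)))"
  let ?Z = "infsum ?f UNIV"
  have Z: "?f summable_on UNIV" by (rule summable_on_weight) simp
  have bij: "bij_betw (\<lambda>j. j - k) UNIV UNIV" for k :: "int^'n"
    by (rule bij_betw_byWitness[of _ "\<lambda>j. j + k"]) auto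
  have sh: "(\<lambda>j. ?f (j - k)) summable_on UNIV" "(\<Sum>\<^sub>\<infinity>j. ?f (j - k)) = ?Z" for k :: "int^'n"
    using Z summable_on_reindex_bij_betw[OF bij[of k], of ?f] infsum_reindex_bij_betw[OF bij[of k], of ?f] by simp_all
  have le: "cmod (symbol_matrix \<sigma> j k) \<le> (K * weight k powr \<nu>) * ?f (j - k)" for j k
    using K(2)[of "j - k" k] by (simp add: symbol_matrix_def mult_ac)
  have maj: "(\<lambda>j. (K * weight k powr \<nu>) * ?f (j - k)) summable_on UNIV" for k
    by (intro summable_on_cmult_right sh)
  have col: "(\<lambda>j. symbol_matrix \<sigma> j k) abs_summable_on UNIV" for k
    by (rule Infinite_Sum.abs_summable_on_comparison_test'[OF maj le])
  have colsum: "(\<Sum>\<^sub>\<infinity>j. cmod (symbol_matrix \<sigma> j k)) \<le> (K * ?Z) * weight k powr \<nu>" for k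
  proof -
    have "(\<Sum>\<^sub>\<infinity>j. cmod (symbol_matrix \<sigma> j k)) \<le> (\<Sum>\<^sub>\<infinity>j. (K * weight k powr \<nu>) * ?f (j - k))"
      by (rule infsum_mono[OF col maj le])
    also have "\<dots> = (K * ?Z) * weight k powr \<nu>"
      by (simp only: infsum_cmult_right' sh(2) mult_ac)
    finally show ?thesis .
  qed
  have colnn: "0 \<le> (\<Sum>\<^sub>\<infinity>j. cmod (symbol_matrix \<sigma> j k))" for k by (simp add: infsum_nonneg)
  show "col_ell2 (symbol_matrix \<sigma>)" if \<nu>: "\<nu> < - real CARD('n) / 2"
    unfolding col_ell2_def
  proof (intro conjI allI col)
    have "(\<lambda>k :: int^'n. (K * ?Z)\<^sup>2 * weight k powr (2 * \<nu>)) summable_on UNIV"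
      by (intro summable_on_cmult_right summable_on_weight) (use \<nu> in simp)
    then show "(\<lambda>k. (\<Sum>\<^sub>\<infinity>j. cmod (symbol_matrix \<sigma> j k))\<^sup>2) summable_on UNIV"
    proof (rule summable_on_comparison_test)
      fix k
      have "(\<Sum>\<^sub>\<infinity>j. cmod (symbol_matrix \<sigma> j k))\<^sup>2 \<le> ((K * ?Z) * weight k powr \<nu>)\<^sup>2"
        by (rule power_mono[OF colsum colnn])
      also have "\<dots> = (K * ?Z)\<^sup>2 * weight k powr (2 * \<nu>)"
        using powr_add[of "weight k" \<nu> \<nu>] by (simp add: power_mult_distrib power2_eq_square)
      finally show "(\<Sum>\<^sub>\<infinity>j. cmod (symbol_matrix \<sigma> j k))\<^sup>2 \<le> (K * ?Z)\<^sup>2 * weight k powr (2 * \<nu>)" .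
    qed simp
  qed
  show "(\<lambda>(j, k). symbol_matrix \<sigma> j k) abs_summable_on UNIV" if \<nu>: "\<nu> < - real CARD('n)"
  proof -
    have "(\<lambda>k :: int^'n. (K * ?Z) * weight k powr \<nu>) summable_on UNIV"
      by (intro summable_on_cmult_right summable_on_weight \<nu>)
    then have "(\<lambda>k. \<Sum>\<^sub>\<infinity>j. cmod (symbol_matrix \<sigma> j k)) summable_on UNIV"
      by (rule summable_on_comparison_test) (use colsum colnn in auto)
    then have "(\<lambda>(k, j). symbol_matrix \<sigma> j k) abs_summable_on UNIV"
      unfolding abs_summable_on_pairs_iff using col by simp
    then show ?thesis
      using abs_summable_on_swap_UNIV[of "\<lambda>(j, k). symbol_matrix \<sigma> j k"] by simp
  qed
qed

text \<open>\<open>Gamma_op\<close> with the inverse transform replaced by the Fourier series. It is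
  meaningful for every \<open>col_ell2\<close> matrix and so reaches order - n.\<close>

definition fourier_conj :: "((int^'n) ell2 \<Rightarrow> (int^'n) ell2) \<Rightarrow> ('n::finite) torus_L2 \<Rightarrow> 'n torus_L2" where
  "fourier_conj A u = abs_torus_L2 (fourier_series (A (fourier u)))"

lemma fourier_conj_eq_Gamma_op:
  assumes "\<And>\<phi>. Rep_ell2 (A \<phi>) abs_summable_on UNIV"
  shows "Gamma_op A = fourier_conj A"
  unfolding Gamma_op_def fourier_conj_def
  by (rule ext) (simp add: inv_f_eq[OF inj_fourier fourier_fourier_series[OF assms]])

lemma fourier_Gamma_op:
  assumes "A \<in> D2"
  shows "fourier (Gamma_op A u) = A (fourier u)"
  using fourier_conj_eq_Gamma_op[OF D2_ell1[OF assms]] fourier_fourier_series[OF D2_ell1[OF assms]]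
  by (simp add: fourier_conj_def)

text \<open>Makes the operator \<open>A\<close> in \<open>Gamma_det\<close> unique: it is recovered
  by testing on the exponentials.\<close>

lemma Gamma_op_inj:
  assumes "A \<in> D2" "B \<in> D2" "Gamma_op A = Gamma_op B"
  shows "A = B"
proof (rule bounded_clinear_eqI)
  show "bounded_clinear A" "bounded_clinear B" using assms by (auto simp: D2_bounded_clinear)
  show "A (unit_vec_ell2 k) = B (unit_vec_ell2 k)" for k
    using fourier_Gamma_op[OF assms(1), of "torus_basis k"] fourier_Gamma_op[OF assms(2), of "torus_basis k"]
    by (simp add: fourier_torus_basis assms(3))
qed

lemma Gamma_op_scaleC:
  assumes "A \<in> D2"
  shows "Gamma_op (\<lambda>x. c *\<^sub>C A x) = (\<lambda>u. c *\<^sub>C Gamma_op A u)"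
proof
  fix u
  have "fourier (Gamma_op (\<lambda>x. c *\<^sub>C A x) u) = fourier (c *\<^sub>C Gamma_op A u)"
    by (simp add: fourier_Gamma_op[OF D2_scaleC(1)[OF assms]] fourier_Gamma_op[OF assms]
        bounded_clinear_scaleC[OF bounded_clinear_fourier])
  then show "Gamma_op (\<lambda>x. c *\<^sub>C A x) u = c *\<^sub>C Gamma_op A u"
    by (rule injD[OF inj_fourier])
qed

lemma Gamma_det_Gamma_op:
  assumes "A \<in> D2"
  shows "Gamma_det (Gamma_op A) = D2_det A"
proof -
  have "(THE B. B \<in> D2 \<and> Gamma_op B = Gamma_op A) = A"
    by (rule the_equality) (use assms Gamma_op_inj in auto)
  then show ?thesis by (simp add: Gamma_det_def)
qed

text \<open>Linearity is pulled back along the injective \<open>fourier\<close>. The norm estimate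
  passes through the supremum norm of the series, which is at most the \<ell>1 norm of its
  coefficients and hence at most \<open>mat_bound a * norm (fourier u)\<close>.\<close>

lemma bounded_clinear_fourier_conj_mat_op:
  fixes a :: "int^'n \<Rightarrow> int^'n \<Rightarrow> complex"
  assumes a: "col_ell2 a"
  shows "bounded_clinear (fourier_conj (mat_op a) :: 'n torus_L2 \<Rightarrow> 'n torus_L2)"
proof (rule bounded_clinearI[of _ "mat_bound a"])
  let ?T = "fourier_conj (mat_op a) :: 'n torus_L2 \<Rightarrow> 'n torus_L2"
  have T: "fourier (?T u) = mat_op a (fourier u)" for u
    unfolding fourier_conj_def by (rule fourier_fourier_series[OF mat_op_ell1[OF a]])
  note lin = bounded_clinear_mat_op[OF a]
  show "?T (u + v) = ?T u + ?T v" for u v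
    by (rule injD[OF inj_fourier]) (simp add: T bounded_clinear_add[OF bounded_clinear_fourier] bounded_clinear_add[OF lin])
  show "?T (c *\<^sub>C u) = c *\<^sub>C ?T u" for c u
    by (rule injD[OF inj_fourier]) (simp add: T bounded_clinear_scaleC[OF bounded_clinear_fourier] bounded_clinear_scaleC[OF lin])
  show "norm (?T u) \<le> mat_bound a * norm u" for u
  proof -
    have "0 \<le> mat_bound a" by (simp add: mat_bound_def infsum_nonneg)
    then show ?thesis
      unfolding fourier_conj_def
      by (intro order_trans[OF norm_fourier_series_le[OF mat_op_ell1[OF a]]]
          order_trans[OF mat_op_ell1_le[OF a]] mult_left_mono norm_fourier_le)
  qed
qed

text \<open>Of the coefficients of \<open>f\<close> only square summability is used: below order - n
  / 2 the weights are square summable too, so by Cauchy-Schwarz the defining series converges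
  uniformly and its coefficients can be computed term by term.\<close>

lemma fourier_pdo_smooth:
  fixes \<sigma> :: "real^'n \<Rightarrow> int^'n \<Rightarrow> complex"
  assumes \<sigma>: "\<sigma> \<in> symbol_class \<nu>" and \<nu>: "\<nu> < - real CARD('n) / 2" and f: "f \<in> torus_smooth"
  shows "continuous_on UNIV (pdo_smooth \<sigma> f)"
    and "abs_torus_L2 (pdo_smooth \<sigma> f) = fourier_conj (mat_op (symbol_matrix \<sigma>)) (abs_torus_L2 f)"
proof -
  note a = symbol_matrix_summable(1)[OF \<sigma> \<nu>]
  let ?u = "abs_torus_L2 f"
  have sf: "square_integrable f" by (rule square_integrable_continuous[OF torus_smooth_continuous[OF f]])
  have ft: "torus_ft f k = Rep_ell2 (fourier ?u) k" for k by (simp add: Rep_fourier tft_abs[OF sf])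
  obtain C where C: "\<And>x k. cmod (iter_deriv [] (\<lambda>y. \<sigma> y k) x) \<le> C * weight k powr \<nu>"
    by (rule symbol_class_bound[OF \<sigma>], rule that)
  then have C: "cmod (\<sigma> x k) \<le> C * weight k powr \<nu>" for x k
    by (simp add: iter_deriv_def)
  let ?s = "\<lambda>k x. torus_exp k x * \<sigma> x k * torus_ft f k"
  have c: "continuous_on UNIV (?s k)" for k
    by (intro continuous_intros torus_smooth_continuous[OF symbol_class_smooth[OF \<sigma>]])
  have le: "cmod (?s k x) \<le> C * (weight k powr \<nu> * cmod (Rep_ell2 (fourier ?u) k))" for k x
    using mult_right_mono[OF C[of x k], of "cmod (torus_ft f k)"] by (simp add: norm_mult ft mult.assoc)
  have "(\<lambda>k :: int^'n. (weight k powr \<nu>)\<^sup>2) summable_on UNIV"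
  proof -
    have "(weight k powr \<nu>)\<^sup>2 = weight k powr (2 * \<nu>)" for k :: "int^'n"
      using powr_add[of "weight k" \<nu> \<nu>] by (simp add: power2_eq_square)
    then show ?thesis using summable_on_weight[where 'n = 'n and s = "2 * \<nu>"] \<nu> by simp
  qed
  from infsum_mult_ell2_le(1)[OF this]
  have M: "(\<lambda>k. C * (weight k powr \<nu> * cmod (Rep_ell2 (fourier ?u) k))) summable_on UNIV"
    by (intro summable_on_cmult_right) simp
  note H = has_sum_torus_ft[of ?s, OF c le M]
  have eq: "(\<lambda>x. \<Sum>\<^sub>\<infinity>k. ?s k x) = pdo_smooth \<sigma> f"
    by (simp add: fun_eq_iff pdo_smooth_def torus_exp_def)
  show cont: "continuous_on UNIV (pdo_smooth \<sigma> f)" using H(1) unfolding eq .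
  note sp = square_integrable_continuous[OF cont]
  show "abs_torus_L2 (pdo_smooth \<sigma> f) = fourier_conj (mat_op (symbol_matrix \<sigma>)) ?u"
  proof (rule injD[OF inj_fourier], rule ell2_eqI)
    fix j
    have "torus_ft (?s k) j = symbol_matrix \<sigma> j k * Rep_ell2 (fourier ?u) k" for k
    proof -
      \<comment> \<open>Term \<open>k\<close> multiplies the symbol by an exponential and so shifts
        the frequency from \<open>j\<close> to \<open>j - k\<close>.\<close>
      have "torus_exp (- j) x * torus_exp k x = torus_exp (- (j - k)) x" for x
        using torus_exp_add[of "- j" k x] by simp
      then have "torus_exp (- j) x * ?s k x = (torus_exp (- (j - k)) x * \<sigma> x k) * torus_ft f k" for x
        by (simp add: mult.assoc[symmetric])
      then show ?thesis
        unfolding torus_ft_eq[of "?s k"] symbol_matrix_def symbol_ft_def torus_ft_eq[of "\<lambda>x. \<sigma> x k"] ft[symmetric]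
        by (simp only: integral_mult_left_zero)
    qed
    then have "((\<lambda>k. symbol_matrix \<sigma> j k * Rep_ell2 (fourier ?u) k) has_sum torus_ft (pdo_smooth \<sigma> f) j) UNIV"
      using H(2)[of j] unfolding eq by simp
    then show "Rep_ell2 (fourier (abs_torus_L2 (pdo_smooth \<sigma> f))) j
        = Rep_ell2 (fourier (fourier_conj (mat_op (symbol_matrix \<sigma>)) ?u)) j"
      unfolding fourier_conj_def fourier_fourier_series[OF mat_op_ell1[OF a]] Rep_mat_op[OF a]
      by (simp add: Rep_fourier tft_abs[OF sp] infsumI)
  qed
qed

text \<open>The Fourier conjugate of the matrix is an extension, and density makes it the only one;
  this resolves the definite description in \<open>pdo\<close>.\<close>

lemma
  fixes \<sigma> :: "real^'n \<Rightarrow> int^'n \<Rightarrow> complex"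
  assumes \<sigma>: "\<sigma> \<in> symbol_class \<nu>" and \<nu>: "\<nu> < - real CARD('n) / 2"
  shows pdo_eq: "pdo \<sigma> = fourier_conj (mat_op (symbol_matrix \<sigma>))"
    and L2_extension_pdo: "L2_extension \<sigma> (pdo \<sigma>)"
proof -
  let ?T = "fourier_conj (mat_op (symbol_matrix \<sigma>))"
  note P = fourier_pdo_smooth[OF \<sigma> \<nu>]
  note bT = bounded_clinear_fourier_conj_mat_op[OF symbol_matrix_summable(1)[OF \<sigma> \<nu>]]
  have ext: "L2_extension \<sigma> ?T"
    unfolding L2_extension_def
  proof (intro conjI bT ballI)
    fix f :: "real^'n \<Rightarrow> complex" assume f: "f \<in> torus_smooth"
    have "L2_eq (rep_torus_L2 (abs_torus_L2 (pdo_smooth \<sigma> f))) (pdo_smooth \<sigma> f)"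
      by (rule L2_eq_rep_abs[OF square_integrable_continuous[OF P(1)[OF f]]])
    then show "L2_eq (pdo_smooth \<sigma> f) (rep_torus_L2 (?T (abs_torus_L2 f)))"
      unfolding P(2)[OF f] by (auto simp: L2_eq_def)
  qed
  have "T' = ?T" if T': "L2_extension \<sigma> T'" for T'
  proof (rule bounded_clinear_torus_eqI)
    show "bounded_clinear T'" using T' by (simp add: L2_extension_def)
    show "bounded_clinear ?T" by (rule bT)
    fix p :: "real^'n \<Rightarrow> complex" assume "trig_poly p"
    then have p: "p \<in> torus_smooth" by (rule trig_poly_torus_smooth)
    then have "abs_torus_L2 (pdo_smooth \<sigma> p) = abs_torus_L2 (rep_torus_L2 (T' (abs_torus_L2 p)))"
      using T' unfolding L2_extension_def by (intro abs_torus_L2_eqI) blast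
    then show "T' (abs_torus_L2 p) = ?T (abs_torus_L2 p)" by (simp add: P(2)[OF p])
  qed
  with ext show "pdo \<sigma> = ?T" unfolding pdo_def by (rule the_equality)
  with ext show "L2_extension \<sigma> (pdo \<sigma>)" by simp
qed

lemma pdo_eq_Gamma_op:
  fixes \<sigma> :: "real^'n \<Rightarrow> int^'n \<Rightarrow> complex"
  assumes \<sigma>: "\<sigma> \<in> symbol_class \<nu>" and \<nu>: "\<nu> < - real CARD('n)"
  shows "mat_op (symbol_matrix \<sigma>) \<in> D2" "pdo \<sigma> = Gamma_op (mat_op (symbol_matrix \<sigma>))"
proof -
  have "0 \<le> real CARD('n)" by simp
  with \<nu> have \<nu>': "\<nu> < - real CARD('n) / 2" by linarith
  show D: "mat_op (symbol_matrix \<sigma>) \<in> D2" by (rule mat_op_in_D2[OF symbol_matrix_summable(2)[OF \<sigma> \<nu>]])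
  show "pdo \<sigma> = Gamma_op (mat_op (symbol_matrix \<sigma>))"
    unfolding pdo_eq[OF \<sigma> \<nu>'] by (rule fourier_conj_eq_Gamma_op[OF D2_ell1[OF D], symmetric])
qed

lemma funpow_scaleC:
  fixes A :: "'a::complex_normed_vector \<Rightarrow> 'a"
  assumes "bounded_clinear A"
  shows "((\<lambda>x. c *\<^sub>C A x) ^^ m) x = c ^ m *\<^sub>C (A ^^ m) x"
  by (induction m) (simp_all add: scaleC_one bounded_clinear_scaleC[OF assms] scaleC_scaleC)

lemma D2_det_scaleC:
  assumes A: "A \<in> D2" and l: "cmod l * D2_norm A < 1"
  shows "\<exists>S. (\<lambda>i. (- 1) ^ i / of_nat (Suc i) * l ^ Suc i * D2_trace (A ^^ Suc i)) sums S \<and>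
    D2_det (\<lambda>x. l *\<^sub>C A x) = exp S"
proof -
  let ?B = "\<lambda>x. l *\<^sub>C A x"
  have B: "?B \<in> D2" "D2_norm ?B < 1" using D2_scaleC[OF A] l by simp_all
  have "trace_log_term ?B = (\<lambda>i. (- 1) ^ i / of_nat (Suc i) * l ^ Suc i * D2_trace (A ^^ Suc i))"
  proof
    fix i
    have "?B ^^ Suc i = (\<lambda>x. l ^ Suc i *\<^sub>C (A ^^ Suc i) x)"
      using funpow_scaleC[OF D2_bounded_clinear[OF A], where c = l and m = "Suc i"] by (simp only: fun_eq_iff) simp
    then show "trace_log_term ?B i = (- 1) ^ i / of_nat (Suc i) * l ^ Suc i * D2_trace (A ^^ Suc i)"
      unfolding trace_log_term_def by (simp only: D2_trace_scaleC mult.assoc)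
  qed
  with trace_log_sums[OF B] D2_det_eq_exp_trace_log[OF B] show ?thesis by auto
qed

text \<open>An operator \<open>A\<close> in \<open>D2\<close> representing \<open>pdo\<close> would
  agree with the symbol matrix on unit vectors. Its diagonal would then be the multiplier itself,
  whereas diagonals in \<open>D2\<close> are absolutely summable.\<close>

lemma pdo_sharp_not_in_Gamma:
  fixes i :: "'n::finite"
  shows "pdo (\<lambda>x :: real^'n. sharp_symbol i) \<notin> Gamma_op ` D2"
proof
  let ?\<sigma> = "\<lambda>x :: real^'n. sharp_symbol i"
  \<comment> \<open>Positivity of the dimension makes - n strictly smaller than - n / 2.\<close>
  have "0 < real CARD('n)" by simp
  then have \<nu>: "- real CARD('n) < - real CARD('n) / 2" by linarith
  note \<sigma> = sharp_symbol_in_symbol_class[of i]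
  note a = symbol_matrix_summable(1)[OF \<sigma> \<nu>]
  assume "pdo ?\<sigma> \<in> Gamma_op ` D2"
  then obtain A where A: "A \<in> D2" "pdo ?\<sigma> = Gamma_op A" by auto
  have "A (unit_vec_ell2 k) = mat_op (symbol_matrix ?\<sigma>) (unit_vec_ell2 k)" for k
  proof -
    have "A (unit_vec_ell2 k) = fourier (pdo ?\<sigma> (torus_basis k))"
      by (simp add: A(2) fourier_Gamma_op[OF A(1)] fourier_torus_basis)
    also have "\<dots> = mat_op (symbol_matrix ?\<sigma>) (unit_vec_ell2 k)"
      unfolding pdo_eq[OF \<sigma> \<nu>] fourier_conj_def fourier_fourier_series[OF mat_op_ell1[OF a]]
      by (simp add: fourier_torus_basis)
    finally show ?thesis .
  qed
  then have "matrix_entry A k k = symbol_matrix ?\<sigma> k k" for k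
    using matrix_entry_mat_op[OF a, of k k] by (simp add: matrix_entry_def)
  also have "symbol_matrix ?\<sigma> k k = sharp_symbol i k" for k
    by (simp add: symbol_matrix_def symbol_ft_def torus_ft_eq measure_cube)
  finally have "sharp_symbol i abs_summable_on UNIV"
    using D2_trace_summable[OF A(1)] by simp
  with sharp_symbol_not_summable show False by blast
qed

text \<open>\<open>infsum\<close> is 0 on families that are not summable, and \<open>THE\<close> is
  arbitrary without a unique witness; hence summability of the path sums and
  \<open>L2_extension\<close> are asserted next to the formula, the latter for
  \<open>\<sigma>\<^sub>0\<close> as well. The index \<open>i\<close> of the series stands for
  \<open>m = Suc i\<close>.\<close>

theorem theorem3p4:
  shows
    "(\<forall>(\<nu>::real) (\<sigma> :: real^'n \<Rightarrow> int^'n \<Rightarrow> complex).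
        \<sigma> \<in> symbol_class \<nu> \<and> \<nu> < - real CARD('n) \<longrightarrow>
        L2_extension \<sigma> (pdo \<sigma>) \<and> pdo \<sigma> \<in> Gamma_op ` D2 \<and>
        (\<forall>m\<ge>1. (\<lambda>j. \<Prod>s=1..m. symbol_ft \<sigma> (j ! (s - 1) - j ! s) (j ! s))
            summable_on {j. length j = Suc m \<and> j ! 0 = j ! m}) \<and>
        (\<exists>r>0. \<forall>l::complex. cmod l < r \<longrightarrow>
          (\<exists>S. (\<lambda>i. let m = Suc i in
                 (- 1) ^ (m + 1) / of_nat m * l ^ m *
                 (\<Sum>\<^sub>\<infinity>j\<in>{j. length j = Suc m \<and> j ! 0 = j ! m}.
                    \<Prod>s=1..m. symbol_ft \<sigma> (j ! (s - 1) - j ! s) (j ! s))) sums S \<and>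
               Gamma_det (\<lambda>u. l *\<^sub>C pdo \<sigma> u) = exp S)))
     \<and> (\<exists>\<sigma>\<^sub>0 :: real^'n \<Rightarrow> int^'n \<Rightarrow> complex.
        \<sigma>\<^sub>0 \<in> symbol_class (- real CARD('n)) \<and> L2_extension \<sigma>\<^sub>0 (pdo \<sigma>\<^sub>0) \<and>
        pdo \<sigma>\<^sub>0 \<notin> Gamma_op ` D2)"
proof (intro conjI allI impI)
  fix \<nu> :: real and \<sigma> :: "real^'n \<Rightarrow> int^'n \<Rightarrow> complex"
  assume *: "\<sigma> \<in> symbol_class \<nu> \<and> \<nu> < - real CARD('n)"
  then have \<sigma>: "\<sigma> \<in> symbol_class \<nu>" and \<nu>: "\<nu> < - real CARD('n)" by auto
  have "0 \<le> real CARD('n)" by simp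
  with \<nu> have \<nu>': "\<nu> < - real CARD('n) / 2" by linarith
  let ?A = "mat_op (symbol_matrix \<sigma>)"
  let ?w = "\<lambda>m j. \<Prod>s=1..m. symbol_ft \<sigma> (j ! (s - 1) - j ! s) (j ! s)" and ?C = "\<lambda>m. {j :: (int^'n) list. length j = Suc m \<and> j ! 0 = j ! m}"
  note A = pdo_eq_Gamma_op[OF \<sigma> \<nu>]
  have path: "?w m = path_weight (matrix_entry ?A) m" for m
    by (simp add: fun_eq_iff path_weight_def matrix_entry_mat_op[OF symbol_matrix_summable(1)[OF \<sigma> \<nu>']] symbol_matrix_def)
  show "L2_extension \<sigma> (pdo \<sigma>)" by (rule L2_extension_pdo[OF \<sigma> \<nu>'])
  show "pdo \<sigma> \<in> Gamma_op ` D2" using A by auto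
  show "?w m summable_on ?C m" if "1 \<le> m" for m
    unfolding path by (rule closed_paths_summable[OF A(1) that])
  show "\<exists>r>0. \<forall>l::complex. cmod l < r \<longrightarrow>
          (\<exists>S. (\<lambda>i. let m = Suc i in
            (- 1) ^ (m + 1) / of_nat m * l ^ m * (\<Sum>\<^sub>\<infinity>j\<in>?C m. ?w m j)) sums S \<and> Gamma_det (\<lambda>u. l *\<^sub>C pdo \<sigma> u) = exp S)"
  \<comment> \<open>Any radius that forces \<open>cmod l * D2_norm ?A < 1\<close> would do; the
    summand 1 avoids division by zero for a vanishing operator.\<close>
  proof (intro exI[of _ "1 / (1 + D2_norm ?A)"] conjI allI impI)
    have nn: "0 \<le> D2_norm ?A" by (rule D2_norm_nonneg)
    then show "0 < 1 / (1 + D2_norm ?A)" by simp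
    fix l :: complex assume "cmod l < 1 / (1 + D2_norm ?A)"
    then have "cmod l * (1 + D2_norm ?A) < 1" using nn by (simp add: less_divide_eq)
    then have l: "cmod l * D2_norm ?A < 1"
      using norm_ge_zero[of l] unfolding distrib_left mult_1_right by linarith
    have "Gamma_det (\<lambda>u. l *\<^sub>C pdo \<sigma> u) = D2_det (\<lambda>x. l *\<^sub>C ?A x)"
      unfolding A(2) Gamma_op_scaleC[OF A(1), symmetric] by (rule Gamma_det_Gamma_op[OF D2_scaleC(1)[OF A(1)]])
    moreover have "(\<Sum>\<^sub>\<infinity>j\<in>{j. length j = Suc (Suc i) \<and> j ! 0 = j ! Suc i}. path_weight (matrix_entry ?A) (Suc i) j)
        = D2_trace (?A ^^ Suc i)" for i
      by (rule closed_paths_trace[OF A(1)]) simp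
    ultimately show "\<exists>S. (\<lambda>i. let m = Suc i in
            (- 1) ^ (m + 1) / of_nat m * l ^ m * (\<Sum>\<^sub>\<infinity>j\<in>?C m. ?w m j)) sums S \<and> Gamma_det (\<lambda>u. l *\<^sub>C pdo \<sigma> u) = exp S"
      using D2_det_scaleC[OF A(1) l] unfolding path Let_def by simp
  qed
next
  \<comment> \<open>Any coordinate may be singled out, so an arbitrary element of the index type is
    taken.\<close>
  let ?\<sigma> = "\<lambda>x :: real^'n. sharp_symbol (undefined :: 'n)"
  have "0 < real CARD('n)" by simp
  then have \<nu>: "- real CARD('n) < - real CARD('n) / 2" by linarith
  show "\<exists>\<sigma>\<^sub>0 :: real^'n \<Rightarrow> int^'n \<Rightarrow> complex.
        \<sigma>\<^sub>0 \<in> symbol_class (- real CARD('n)) \<and> L2_extension \<sigma>\<^sub>0 (pdo \<sigma>\<^sub>0) \<and> pdo \<sigma>\<^sub>0 \<notin> Gamma_op ` D2"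
    by (intro exI[of _ ?\<sigma>] conjI sharp_symbol_in_symbol_class pdo_sharp_not_in_Gamma
        L2_extension_pdo[OF sharp_symbol_in_symbol_class \<nu>])
qed

end
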